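(* Consider the linear model $Y=X\beta+\varepsilon$ with $X\in\mathbb{R}^{n\times p}$ fixed, $X^\top X$ invertible, $S=(X^\top X)^{-1}X^\top$, $Q=I_n-X(X^\top X)^{-1}X^\top$, and $Q\odot Q$ invertible. Assume $\varepsilon=\Sigma^{1/2}Z$, where $\Sigma$ is a diagonal matrix with positive diagonal entries and $Z=(Z_1,\dots,Z_n)^\top$ consists of independent entries that have means zero, variances one, and fourth moments bounded by $C_4$. Further suppose that for all $i\in\{1,\dots,n\}$, $Z_i=\psi_i(N_i)$, where $(N_1,\dots,N_n)^\top\sim\mathcal{N}(0,I_n)$ and $\psi_i:\mathbb{R}\to\mathbb{R}$ are twice-differentiable functions such that $\|\psi_i'\|_\infty<c_1$ and $\|\psi_i''\|_\infty<c_2$ for some positive constants $c_1,c_2$. Let $\hat\varepsilon=Y-X\hat\beta$ with $\hat\beta=SY$, and let $\widehat{\vec\Sigma}=(Q\odot Q)^{-1}(\hat\varepsilon\odot\hat\varepsilon)$. For a sequence of vectors $(w_p)_{p\ge1}$, where $w_p\in\mathbb{R}^p$ for all $p\ge1$, of unit norm, we have $$d_{\mathrm{TV}}\left(\frac{w_p^\top S(\mathrm{diag}\,\widehat{\vec\Sigma})S^\top w_p-w_p^\top S\Sigma S^\top w_p}{\sqrt{\mathrm{Var}\left[w_p^\top S(\mathrm{diag}\,\widehat{\vec\Sigma})S^\top w_p\right]}},\ \mathcal{N}(0,1)\right)\le C_0\frac{\|G(w_p)\|}{\|G(w_p)\|_{\mathrm{Fr}}},$$ where $$G(w_p)=\Sigma^{1/2}Q\,\mathrm{diag}\left\{\left[(w_p^\top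 S)\odot(w_p^\top S)\right](Q\odot Q)^{-1}\right\}Q\,\Sigma^{1/2}$$ and $$C_0=\min\{C_4-1,2\}^{-1}\cdot8\sqrt5\,c_1(4C_4+2)^{1/4}\left[(4C_4+2)^{1/4}c_2+c_1^2\right].$$
   Context: $\odot$ is the Hadamard (entrywise) product. For a (row or column) vector $v$, $\mathrm{diag}(v)$ (or $\mathrm{diag}\{v\}$) is the diagonal matrix with diagonal $v$. $\|\cdot\|$ is the operator norm of a matrix and the Euclidean norm of a vector; $\|\cdot\|_{\mathrm{Fr}}$ is the Frobenius norm; for $f:\mathbb{R}\to\mathbb{R}$, $\|f\|_\infty=\sup_{x\in\mathbb{R}}|f(x)|$. $d_{\mathrm{TV}}$ is the total variation distance between the law of the random variable in its first argument and the law in its second argument. *)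

theory Defs
  imports "HOL-Analysis.Analysis" "HOL-Probability.Probability"
begin

text \<open>
  The library multiplication on \<open>real ^ 'n\<close> is componentwise; as matrices are vectors of
  rows, it is the entrywise product on \<open>real ^ 'n ^ 'm\<close> too (the matrix product is \<open>**\<close>).
\<close>

abbreviation hadamard :: "real ^ 'n ^ 'm \<Rightarrow> real ^ 'n ^ 'm \<Rightarrow> real ^ 'n ^ 'm" (infixl "\<odot>\<^sub>m" 70)
  where "A \<odot>\<^sub>m B \<equiv> A * B"

abbreviation hadamard_vec :: "real ^ 'n \<Rightarrow> real ^ 'n \<Rightarrow> real ^ 'n" (infixl "\<odot>\<^sub>v" 70)
  where "u \<odot>\<^sub>v v \<equiv> u * v"

definition diag_mat :: "real ^ 'n \<Rightarrow> real ^ 'n ^ 'n" where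
  "diag_mat v = (\<chi> i j. if i = j then v $ i else 0)"

definition is_diagonal :: "real ^ 'n ^ 'n \<Rightarrow> bool" where
  "is_diagonal A \<longleftrightarrow> (\<forall>i j. i \<noteq> j \<longrightarrow> A $ i $ j = 0)"

definition op_norm :: "real ^ 'n ^ 'm \<Rightarrow> real" where
  "op_norm A = onorm (\<lambda>v. A *v v)"

definition frob_norm :: "real ^ 'n ^ 'm \<Rightarrow> real" where
  "frob_norm A = sqrt (\<Sum>i\<in>UNIV. \<Sum>j\<in>UNIV. (A $ i $ j)\<^sup>2)"

text \<open>
  The positive semidefinite square root; \<open>mat_sqrt_diag_mat\<close> evaluates it for diagonal matrices.
\<close>

definition mat_sqrt :: "real ^ 'n ^ 'n \<Rightarrow> real ^ 'n ^ 'n" where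
  "mat_sqrt A = (THE B. transpose B = B \<and> (\<forall>v. 0 \<le> v \<bullet> (B *v v)) \<and> B ** B = A)"

lemma diag_mat_mult_vec: "(diag_mat v *v x) $ i = v $ i * x $ i"
proof -
  have "(diag_mat v *v x) $ i = (\<Sum>j\<in>UNIV. if i = j then v $ i * x $ j else 0)"
    unfolding diag_mat_def matrix_vector_mult_def
    by (simp add: if_distrib[of "\<lambda>a. a * _"] cong: if_cong)
  then show ?thesis by simp
qed

lemma mat_sqrt_diag_mat:
  fixes v :: "real ^ 'n"
  assumes pos: "\<And>i. v $ i > 0"
  shows "mat_sqrt (diag_mat v) = diag_mat (\<chi> i. sqrt (v $ i))"
  unfolding mat_sqrt_def
proof (rule the_equality, intro conjI allI)
  let ?D = "diag_mat (\<chi> i. sqrt (v $ i))"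
  show "transpose ?D = ?D"
    by (auto simp: transpose_def diag_mat_def vec_eq_iff)
  fix x :: "real ^ 'n"
  have "0 \<le> sqrt (v $ i) * (x $ i * x $ i)" for i
    using pos[of i] by simp
  then show "0 \<le> x \<bullet> (?D *v x)"
    by (auto simp: inner_vec_def diag_mat_mult_vec algebra_simps intro!: sum_nonneg)
next
  let ?D = "diag_mat (\<chi> i. sqrt (v $ i))"
  have nn: "0 \<le> v $ i" for i using pos[of i] by simp
  show "?D ** ?D = diag_mat v"
    by (simp add: matrix_eq vec_eq_iff matrix_vector_mul_assoc[symmetric] diag_mat_mult_vec
        mult.assoc[symmetric] nn)
next
  fix B :: "real ^ 'n ^ 'n"
  let ?D = "diag_mat (\<chi> i. sqrt (v $ i))"
  assume B: "transpose B = B \<and> (\<forall>v. 0 \<le> v \<bullet> (B *v v)) \<and> B ** B = diag_mat v"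
  have col: "B *v axis i 1 = ?D *v axis i 1" for i
  proof -
    let ?e = "axis i 1 :: real ^ 'n" and ?r = "sqrt (v $ i)"
    define u where "u = B *v ?e - ?r *\<^sub>R ?e"
    have De: "?D *v ?e = ?r *\<^sub>R ?e" and vv: "diag_mat v *v ?e = (v $ i) *\<^sub>R ?e"
      by (auto simp: vec_eq_iff diag_mat_mult_vec axis_def)
    have "B *v (B *v ?e) = (v $ i) *\<^sub>R ?e"
      using B vv by (simp add: matrix_vector_mul_assoc)
    then have "B *v u = (v $ i) *\<^sub>R ?e - ?r *\<^sub>R (B *v ?e)"
      unfolding u_def by (simp add: matrix_vector_mult_diff_distrib matrix_vector_mult_scaleR)
    moreover have "(v $ i) *\<^sub>R ?e = ?r *\<^sub>R (?r *\<^sub>R ?e)"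
      using pos[of i] by simp
    ultimately have "B *v u = - (?r *\<^sub>R u)"
      unfolding u_def by (simp add: scaleR_diff_right)
    then have "u \<bullet> (B *v u) = - (?r * (u \<bullet> u))" by simp
    moreover have "0 \<le> u \<bullet> (B *v u)" using B by blast
    ultimately have "?r * (u \<bullet> u) \<le> 0" by simp
    moreover have "?r > 0" using pos[of i] by simp
    ultimately have "u \<bullet> u \<le> 0" by (simp add: mult_le_0_iff)
    then have "u = 0" by (metis inner_gt_zero_iff not_less)
    then show ?thesis using De unfolding u_def by simp
  qed
  show "B = ?D"
  proof (simp only: vec_eq_iff, intro allI)
    fix j i
    from col[of i] have "(B *v axis i 1) $ j = (?D *v axis i 1) $ j" by simp
    then show "B $ j $ i = ?D $ j $ i"
      by (simp add: matrix_vector_mult_basis column_def)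
  qed
qed

text \<open>The values are extended reals, so that an unbounded function has norm \<open>\<infinity>\<close>.\<close>

definition sup_norm :: "(real \<Rightarrow> real) \<Rightarrow> ereal" where
  "sup_norm f = (SUP x. ereal \<bar>f x\<bar>)"

definition twice_differentiable :: "(real \<Rightarrow> real) \<Rightarrow> bool" where
  "twice_differentiable f \<longleftrightarrow>
     (\<forall>x. f differentiable at x) \<and> (\<forall>x. deriv f differentiable at x)"

text \<open>Total variation distance between probability measures on the same \<open>\<sigma>\<close>-algebra.\<close>

definition tv_dist :: "'a measure \<Rightarrow> 'a measure \<Rightarrow> real" where
  "tv_dist \<mu> \<nu> = (SUP A\<in>sets \<mu>. \<bar>measure \<mu> A - measure \<nu> A\<bar>)"

text \<open>The density of \<open>N(0, I_n)\<close> with respect to Lebesgue measure on \<open>real ^ 'n\<close>.\<close>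

definition std_normal_vec_density :: "real ^ 'n \<Rightarrow> real" where
  "std_normal_vec_density x = (2 * pi) powr (- real CARD('n) / 2) * exp (- (norm x)\<^sup>2 / 2)"

definition ols_mat :: "real ^ 'p ^ 'n \<Rightarrow> real ^ 'n ^ 'p" where
  "ols_mat X = matrix_inv (transpose X ** X) ** transpose X"

definition resid_mat :: "real ^ 'p ^ 'n \<Rightarrow> real ^ 'n ^ 'n" where
  "resid_mat X = mat 1 - X ** matrix_inv (transpose X ** X) ** transpose X"

definition beta_hat :: "real ^ 'p ^ 'n \<Rightarrow> real ^ 'n \<Rightarrow> real ^ 'p" where
  "beta_hat X y = ols_mat X *v y"

definition eps_hat :: "real ^ 'p ^ 'n \<Rightarrow> real ^ 'n \<Rightarrow> real ^ 'n" where
  "eps_hat X y = y - X *v beta_hat X y"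

definition Sigma_hat :: "real ^ 'p ^ 'n \<Rightarrow> real ^ 'n \<Rightarrow> real ^ 'n" where
  "Sigma_hat X y =
     matrix_inv (resid_mat X \<odot>\<^sub>m resid_mat X) *v (eps_hat X y \<odot>\<^sub>v eps_hat X y)"

text \<open>The quadratic form \<open>w\<^sup>T S V S\<^sup>T w\<close>.\<close>

definition sandwich :: "real ^ 'p ^ 'n \<Rightarrow> real ^ 'p \<Rightarrow> real ^ 'n ^ 'n \<Rightarrow> real" where
  "sandwich X w V = w \<bullet> ((ols_mat X ** V ** transpose (ols_mat X)) *v w)"

definition G_mat :: "real ^ 'p ^ 'n \<Rightarrow> real ^ 'n ^ 'n \<Rightarrow> real ^ 'p \<Rightarrow> real ^ 'n ^ 'n" where
  "G_mat X \<Sigma> w =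
     mat_sqrt \<Sigma> ** resid_mat X
       ** diag_mat (((w v* ols_mat X) \<odot>\<^sub>v (w v* ols_mat X))
                      v* matrix_inv (resid_mat X \<odot>\<^sub>m resid_mat X))
       ** resid_mat X ** mat_sqrt \<Sigma>"

definition C0 :: "real \<Rightarrow> real \<Rightarrow> real \<Rightarrow> real" where
  "C0 C4 c1 c2 =
     inverse (min (C4 - 1) 2) * (8 * sqrt 5 * c1 * (4 * C4 + 2) powr (1/4)
       * ((4 * C4 + 2) powr (1/4) * c2 + c1\<^sup>2))"

end

theory Submission
  imports Defs "HOL-Real_Asymp.Real_Asymp"
begin

text \<open>
  With \<open>G\<close> the matrix of the theorem and \<open>Z\<^sub>i = \<psi>\<^sub>i(N\<^sub>i)\<close>, the centred estimator is the quadratic form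
  \<open>W = Z\<^sup>T G Z - tr G\<close> (\<open>sandwich_quadratic_form\<close>, \<open>sandwich_trace\<close>), a function of independent
  standard normal variables. The proof is Stein's method with an explicit kernel: a random variable
  \<open>T\<close> with \<open>E[W \<phi>(W)] = E[T \<phi>'(W)]\<close> and hence \<open>E T = Var W = \<sigma>\<^sup>2\<close>.

  In one variable, \<open>E[a(N) k(N)] = E[(S a)(N) k'(N)]\<close> for centred \<open>a\<close>, where \<open>S a\<close> is the Gaussian tail
  integral of \<open>a\<close> divided by the Gaussian density. Applied to one coordinate at a time,
  with \<open>a = \<psi>\<^sub>i\<close> and \<open>a = \<psi>\<^sub>i\<^sup>2 - 1\<close>, this gives \<open>T\<close> as a polynomial of degree two in
  the off-diagonal sums \<open>\<Sum>\<^sub>j\<^sub>\<noteq>\<^sub>i G\<^sub>i\<^sub>j Z\<^sub>j\<close>, whose coefficients are functions of \<open>N\<^sub>i\<close>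
  (\<open>stein_identity\<close>). The solution of Stein's equation for a test function with values in
  \<open>[0, 1]\<close> has a derivative bounded by 1, so the total variation distance is at most the standard
  deviation of \<open>T\<close> divided by \<open>\<sigma>\<^sup>2\<close> (\<open>stein_solution\<close>, \<open>tv_bound\<close>).

  The variance of \<open>T\<close> comes from its expansion into products of centred functions of distinct
  coordinates (\<open>T_expand\<close>), which are orthogonal unless they use the same coordinates
  (\<open>degenerate_sum\<close>). The result is \<open>Var T \<le> (96 c\<^sup>4 + 32 c\<^sup>2 + 144) \<parallel>G\<parallel>\<^sup>2 \<sigma>\<^sup>2\<close>, with \<open>c = c\<^sub>1\<close>.
  One factor \<open>\<sigma>\<^sup>2\<close> survives, and therefore only one lower bound for the variance is spent.

  The constant \<open>C4\<close> bounds the fourth moments from above, so it cannot bound \<open>\<sigma>\<^sup>2\<close> from below; the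
  Lipschitz constant can. Here \<open>\<sigma>\<^sup>2\<close> is the sum of \<open>2 G\<^sub>i\<^sub>j\<^sup>2\<close> off the diagonal and of
  \<open>\<delta>\<^sub>i G\<^sub>i\<^sub>i\<^sup>2\<close> on it, with \<open>\<delta>\<^sub>i = Var(Z\<^sub>i\<^sup>2)\<close>. The Stein kernel \<open>\<alpha>\<^sub>i\<close> of \<open>Z\<^sub>i\<close> has mean 1 and second
  moment at most \<open>c\<^sup>2\<close>, and its covariance with \<open>Z\<^sub>i\<^sup>2\<close> is \<open>(\<delta>\<^sub>i - 2) / 3\<close>; so \<open>\<delta>\<^sub>i\<close> can be small
  only if \<open>c\<close> is large, quantitatively \<open>(9 c\<^sup>2 - 5) \<delta>\<^sub>i \<ge> 4\<close> (\<open>delta_lower\<close>). Together these bounds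
  give \<open>sqrt 299 c\<^sup>3\<close> times the ratio of the norms of \<open>G\<close> (\<open>tv_bound_ratio\<close>), and
  \<open>sqrt 299 c\<^sup>3 \<le> C0\<close> by minimising over \<open>C4\<close> (\<open>C0_lower\<close>).
\<close>

section \<open>Orthogonality of products over distinct coordinates\<close>

lemma integral_Cauchy_Schwarz:
  fixes f g :: "'a \<Rightarrow> real"
  assumes [measurable]: "f \<in> borel_measurable M" "g \<in> borel_measurable M"
    and f: "integrable M (\<lambda>x. (f x)\<^sup>2)" and g: "integrable M (\<lambda>x. (g x)\<^sup>2)"
  shows "integrable M (\<lambda>x. f x * g x)"
    and "(\<integral>x. f x * g x \<partial>M)\<^sup>2 \<le> (\<integral>x. (f x)\<^sup>2 \<partial>M) * (\<integral>x. (g x)\<^sup>2 \<partial>M)"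
proof -
  have ptw: "\<bar>a * b\<bar> \<le> a\<^sup>2 + b\<^sup>2" for a b :: real
    using sum_squares_bound[of a b] sum_squares_bound[of a "-b"] zero_le_power2[of a]
      zero_le_power2[of b] by (simp add: abs_le_iff)
  show fg: "integrable M (\<lambda>x. f x * g x)"
    by (rule Bochner_Integration.integrable_bound[OF Bochner_Integration.integrable_add[OF f g]])
      (use ptw in auto)
  let ?A = "\<integral>x. (f x)\<^sup>2 \<partial>M" and ?B = "\<integral>x. f x * g x \<partial>M" and ?C = "\<integral>x. (g x)\<^sup>2 \<partial>M"
  have quad: "0 \<le> s\<^sup>2 * ?A - 2 * s * t * ?B + t\<^sup>2 * ?C" for s t
  proof -
    have "0 \<le> (\<integral>x. (s * f x - t * g x)\<^sup>2 \<partial>M)" by simp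
    also have "\<dots> = (\<integral>x. s\<^sup>2 * (f x)\<^sup>2 - 2 * s * t * (f x * g x) + t\<^sup>2 * (g x)\<^sup>2 \<partial>M)"
      by (intro Bochner_Integration.integral_cong refl) (simp add: power2_eq_square algebra_simps)
    also have "\<dots> = s\<^sup>2 * ?A - 2 * s * t * ?B + t\<^sup>2 * ?C"
      using f g fg by simp
    finally show ?thesis .
  qed
  have A0: "0 \<le> ?A" and C0: "0 \<le> ?C" by simp_all
  show "?B\<^sup>2 \<le> ?A * ?C"
  proof (cases "?C = 0")
    case True
    have "?B = 0"
    proof (rule ccontr)
      assume "?B \<noteq> 0"
      then show False
        using quad[of 1 "(?A + 1) / (2 * ?B)"] True A0 by (simp add: field_simps)
    qed
    then show ?thesis using True by simp
  next
    case False
    then have C: "?C > 0" using C0 by (metis less_le)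
    have "0 \<le> ?C * (?A * ?C - ?B\<^sup>2)"
      using quad[of ?C ?B] by (simp add: power2_eq_square algebra_simps)
    then show ?thesis using C by (simp add: zero_le_mult_iff)
  qed
qed

text \<open>
  Two products of centred functions are orthogonal as soon as one coordinate occurs in only one of
  them. In the square of the sum only pairs with equal coordinate sets \<open>s\<close> survive, and \<open>m\<close> counts
  these pairs.
\<close>

lemma degenerate_sum:
  fixes F :: "'t \<Rightarrow> 'n::finite \<Rightarrow> 'a \<Rightarrow> real" and s :: "'t \<Rightarrow> 'n set"
  assumes "prob_space \<nu>"
    and fin: "finite S"
    and meas: "\<And>t l. t \<in> S \<Longrightarrow> F t l \<in> borel_measurable \<nu>"
    and sq: "\<And>t l. t \<in> S \<Longrightarrow> integrable \<nu> (\<lambda>x. (F t l x)\<^sup>2)"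
    and cent: "\<And>t l. t \<in> S \<Longrightarrow> l \<in> s t \<Longrightarrow> (\<integral>x. F t l x \<partial>\<nu>) = 0"
    and triv: "\<And>t l. t \<in> S \<Longrightarrow> l \<notin> s t \<Longrightarrow> F t l = (\<lambda>_. 1)"
    and cls: "\<And>t. t \<in> S \<Longrightarrow> card {t' \<in> S. s t' = s t} \<le> m t"
  shows "integrable (Pi\<^sub>M UNIV (\<lambda>_. \<nu>)) (\<lambda>x. (\<Sum>t\<in>S. c t * (\<Prod>l\<in>UNIV. F t l (x l)))\<^sup>2)"
    and "(\<integral>x. (\<Sum>t\<in>S. c t * (\<Prod>l\<in>UNIV. F t l (x l)))\<^sup>2 \<partial>(Pi\<^sub>M UNIV (\<lambda>_. \<nu>)))
      \<le> (\<Sum>t\<in>S. real (m t) * ((c t)\<^sup>2 * (\<Prod>l\<in>UNIV. (\<integral>x. (F t l x)\<^sup>2 \<partial>\<nu>))))"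
proof -
  interpret prob_space \<nu> by fact
  interpret product_sigma_finite "\<lambda>_::'n. \<nu>" by standard
  let ?P = "Pi\<^sub>M (UNIV::'n set) (\<lambda>_. \<nu>)"
  have int2: "integrable \<nu> (\<lambda>x. F t l x * F t' l x)" if "t \<in> S" "t' \<in> S" for t t' l
    by (rule integral_Cauchy_Schwarz(1)) (use that meas sq in auto)
  define X where "X t x = c t * (\<Prod>l\<in>UNIV. F t l (x l))" for t x
  have XX: "X t x * X t' x = (c t * c t') * (\<Prod>l\<in>UNIV. F t l (x l) * F t' l (x l))" for t t' x
    by (simp add: X_def prod.distrib)
  have intX: "integrable ?P (\<lambda>x. X t x * X t' x)" if "t \<in> S" "t' \<in> S" for t t'
    unfolding XX using product_integrable_prod[of UNIV "\<lambda>l y. F t l y * F t' l y"] int2[OF that]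
    by auto
  have EX: "(\<integral>x. X t x * X t' x \<partial>?P) = c t * c t' * (\<Prod>l\<in>UNIV. (\<integral>y. F t l y * F t' l y \<partial>\<nu>))"
    if "t \<in> S" "t' \<in> S" for t t'
    unfolding XX using product_integral_prod[of UNIV "\<lambda>l y. F t l y * F t' l y"] int2[OF that]
    by simp
  have orth: "(\<integral>x. X t x * X t' x \<partial>?P) = 0" if t: "t \<in> S" "t' \<in> S" and ne: "s t \<noteq> s t'" for t t'
  proof -
    from ne obtain l where "l \<in> s t \<and> l \<notin> s t' \<or> l \<in> s t' \<and> l \<notin> s t" by auto
    then have "(\<integral>y. F t l y * F t' l y \<partial>\<nu>) = 0"
      using cent[OF t(1), of l] cent[OF t(2), of l] triv[OF t(1), of l] triv[OF t(2), of l] by auto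
    then have "(\<Prod>l\<in>UNIV. (\<integral>y. F t l y * F t' l y \<partial>\<nu>)) = 0"
      by (intro prod_zero) auto
    then show ?thesis unfolding EX[OF t] by simp
  qed
  define e where "e t = (\<integral>x. X t x * X t x \<partial>?P)" for t
  have e: "e t = (c t)\<^sup>2 * (\<Prod>l\<in>UNIV. (\<integral>x. (F t l x)\<^sup>2 \<partial>\<nu>))" if "t \<in> S" for t
    unfolding e_def EX[OF that that] by (simp add: power2_eq_square)
  have e0: "e t \<ge> 0" for t unfolding e_def by simp
  have bnd: "(\<integral>x. X t x * X t' x \<partial>?P) \<le> (e t + e t') / 2" if t: "t \<in> S" "t' \<in> S" for t t'
  proof -
    have "(\<integral>x. X t x * X t' x \<partial>?P) \<le> (\<integral>x. (X t x * X t x + X t' x * X t' x) / 2 \<partial>?P)"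
    proof (rule integral_mono)
      show "X t x * X t' x \<le> (X t x * X t x + X t' x * X t' x) / 2" for x
        using sum_squares_bound[of "X t x" "X t' x"] by (simp add: power2_eq_square)
    qed (use intX t in auto)
    then show ?thesis unfolding e_def using intX t by simp
  qed
  have sq_eq: "(\<Sum>t\<in>S. c t * (\<Prod>l\<in>UNIV. F t l (x l)))\<^sup>2 = (\<Sum>t\<in>S. \<Sum>t'\<in>S. X t x * X t' x)" for x
    unfolding X_def power2_eq_square sum_product ..
  show "integrable ?P (\<lambda>x. (\<Sum>t\<in>S. c t * (\<Prod>l\<in>UNIV. F t l (x l)))\<^sup>2)"
    unfolding sq_eq using intX by auto
  have "(\<integral>x. (\<Sum>t\<in>S. c t * (\<Prod>l\<in>UNIV. F t l (x l)))\<^sup>2 \<partial>?P)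
      = (\<Sum>t\<in>S. \<Sum>t'\<in>S. (\<integral>x. X t x * X t' x \<partial>?P))"
    unfolding sq_eq using intX by simp
  also have "\<dots> \<le> (\<Sum>t\<in>S. \<Sum>t'\<in>S. if s t' = s t then (e t + e t') / 2 else 0)"
    by (intro sum_mono) (use bnd orth in auto)
  also have "\<dots> = (\<Sum>t\<in>S. \<Sum>t'\<in>S. if s t' = s t then e t / 2 else 0)
      + (\<Sum>t\<in>S. \<Sum>t'\<in>S. if s t' = s t then e t' / 2 else 0)"
    unfolding sum.distrib[symmetric] by (intro sum.cong refl) (auto simp: add_divide_distrib)
  also have "(\<Sum>t\<in>S. \<Sum>t'\<in>S. if s t' = s t then e t' / 2 else 0)
      = (\<Sum>t\<in>S. \<Sum>t'\<in>S. if s t' = s t then e t / 2 else 0)"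
    by (subst sum.swap) (intro sum.cong refl, auto)
  also have "(\<Sum>t\<in>S. \<Sum>t'\<in>S. if s t' = s t then e t / 2 else 0)
      + (\<Sum>t\<in>S. \<Sum>t'\<in>S. if s t' = s t then e t / 2 else 0)
      = (\<Sum>t\<in>S. real (card {t' \<in> S. s t' = s t}) * e t)"
  proof -
    have "(\<Sum>t'\<in>S. (if s t' = s t then e t / 2 else 0) + (if s t' = s t then e t / 2 else 0))
        = real (card {t' \<in> S. s t' = s t}) * e t" for t
    proof -
      have "(\<Sum>t'\<in>S. (if s t' = s t then e t / 2 else 0) + (if s t' = s t then e t / 2 else 0))
          = (\<Sum>t'\<in>S. if s t' = s t then e t else 0)"
        by (intro sum.cong refl) auto
      also have "\<dots> = (\<Sum>t'\<in>{t' \<in> S. s t' = s t}. e t)"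
        using fin by (intro sum.inter_filter[symmetric])
      finally show ?thesis by simp
    qed
    then show ?thesis unfolding sum.distrib[symmetric] by simp
  qed
  also have "\<dots> \<le> (\<Sum>t\<in>S. real (m t) * e t)"
    by (intro sum_mono mult_right_mono e0) (use cls in simp)
  finally show "(\<integral>x. (\<Sum>t\<in>S. c t * (\<Prod>l\<in>UNIV. F t l (x l)))\<^sup>2 \<partial>?P)
      \<le> (\<Sum>t\<in>S. real (m t) * ((c t)\<^sup>2 * (\<Prod>l\<in>UNIV. (\<integral>x. (F t l x)\<^sup>2 \<partial>\<nu>))))"
    using e by simp
qed

section \<open>The inverse of the Gaussian divergence\<close>

abbreviation (input) \<gamma> :: "real \<Rightarrow> real" where "\<gamma> \<equiv> std_normal_density"
abbreviation (input) \<nu> :: "real measure" where "\<nu> \<equiv> std_normal_distribution"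

abbreviation (input) msq :: "(real \<Rightarrow> real) \<Rightarrow> real" where "msq f \<equiv> (\<integral>x. (f x)\<^sup>2 \<partial>\<nu>)"

lemma gamma_pos: "\<gamma> x > 0" by (rule normal_density_pos) simp

lemma gamma_deriv: "(\<gamma> has_real_derivative - (x * \<gamma> x)) (at x)"
proof -
  have "((\<lambda>x. (1 / sqrt (2 * pi)) * exp (- x\<^sup>2 / 2)) has_real_derivative
      (1 / sqrt (2 * pi)) * (exp (- x\<^sup>2 / 2) * - x)) (at x)"
    by (intro DERIV_cmult DERIV_fun_exp) (auto intro!: derivative_eq_intros)
  then show ?thesis unfolding std_normal_density_def by (simp add: mult_ac)
qed

lemma gamma_cont: "continuous_on A \<gamma>"
  by (meson gamma_deriv DERIV_isCont continuous_at_imp_continuous_on)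

lemma nu_integral: "f \<in> borel_measurable borel \<Longrightarrow> (\<integral>x. f x \<partial>\<nu>) = (\<integral>x. \<gamma> x * f x \<partial>lborel)"
  by (subst integral_real_density) auto

lemma nu_integrable:
  "f \<in> borel_measurable borel \<Longrightarrow> integrable \<nu> f \<longleftrightarrow> integrable lborel (\<lambda>x. \<gamma> x * f x)"
  by (subst integrable_real_density) auto

lemma nu_prob: "prob_space \<nu>"
  by (rule prob_space_normal_density) simp

lemma nu_product: "product_sigma_finite (\<lambda>_. \<nu>)"
  using prob_space_imp_sigma_finite[OF nu_prob] by (simp add: product_sigma_finite_def)

lemma nu_emeasure_finite: "emeasure \<nu> S < \<infinity>"
  by (simp add: finite_measure.emeasure_eq_measure[OF prob_space.finite_measure[OF nu_prob]])

lemma nu_reflect: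
  fixes f :: "real \<Rightarrow> real"
  assumes f: "f \<in> borel_measurable borel"
  shows "(\<integral>x. f (- x) \<partial>\<nu>) = (\<integral>x. f x \<partial>\<nu>)" "integrable \<nu> (\<lambda>x. f (- x)) \<longleftrightarrow> integrable \<nu> f"
proof -
  have [measurable]: "f \<in> borel_measurable borel" by fact
  have g: "\<gamma> (- x) = \<gamma> x" for x by (simp add: std_normal_density_def)
  show "(\<integral>x. f (- x) \<partial>\<nu>) = (\<integral>x. f x \<partial>\<nu>)"
    using lborel_integral_real_affine[of "-1" "\<lambda>x. \<gamma> x * f x" 0] by (simp add: nu_integral g)
  show "integrable \<nu> (\<lambda>x. f (- x)) \<longleftrightarrow> integrable \<nu> f"
    using lborel_integrable_real_affine_iff[of "-1" "\<lambda>x. \<gamma> x * f x" 0] by (simp add: nu_integrable g)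
qed

lemma nu_moment: "integrable \<nu> (\<lambda>x. \<bar>x\<bar> ^ k)"
  by (simp add: nu_integrable integrable_std_normal_moment_abs)

lemma nu_poly:
  assumes f: "f \<in> borel_measurable borel" and b: "\<And>x. \<bar>f x\<bar> \<le> C * (1 + \<bar>x\<bar>) ^ k"
  shows "integrable \<nu> f"
proof -
  have "integrable \<nu> (\<lambda>x. C * (1 + \<bar>x\<bar>) ^ k)"
    unfolding binomial_ring using nu_moment by (auto simp: mult.assoc)
  then show ?thesis
  proof (rule Bochner_Integration.integrable_bound)
    show "AE x in \<nu>. norm (f x) \<le> norm (C * (1 + \<bar>x\<bar>) ^ k)"
      using b by (auto intro!: AE_I2 order_trans[OF b])
  qed (use f in simp)
qed

lemma nu_null_point: "AE y in \<nu>. y \<noteq> (x::real)"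
  by (subst AE_density) (auto intro: AE_mp[OF AE_lborel_singleton[of x]])

text \<open>For centred \<open>a\<close>, \<open>gstein a\<close> is the solution \<open>f\<close> of \<open>x f - f' = a\<close> that does not blow up at
  infinity: it inverts the adjoint of the derivative in the Gaussian \<open>L\<^sup>2\<close> space, and \<open>- gstein a\<close>
  solves Stein's equation with right-hand side \<open>a\<close>.\<close>

definition gtail :: "(real \<Rightarrow> real) \<Rightarrow> real \<Rightarrow> real" where
  "gtail a x = (\<integral>y. indicator {x<..} y * a y \<partial>\<nu>)"

definition gstein :: "(real \<Rightarrow> real) \<Rightarrow> real \<Rightarrow> real" where
  "gstein a x = gtail a x / \<gamma> x"

lemma gtail_eq: "gtail a x = \<gamma> x * gstein a x"
  using gamma_pos[of x] by (simp add: gstein_def)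

lemma gtail_deriv:
  assumes cont: "continuous_on UNIV a" and int: "integrable \<nu> a"
  shows "(gtail a has_real_derivative - (a x * \<gamma> x)) (at x)"
proof -
  have [measurable]: "a \<in> borel_measurable borel" by (rule borel_measurable_continuous_onI[OF cont])
  define g where "g y = \<gamma> y * a y" for y
  have gc: "continuous_on S g" for S
    unfolding g_def by (intro continuous_intros gamma_cont continuous_on_subset[OF cont]) auto
  have gi: "integrable lborel g" using int unfolding g_def by (simp add: nu_integrable)
  have ind: "integrable lborel (\<lambda>y. indicator {z<..} y * g y)" for z
    using integrable_mult_indicator[of "{z<..}" lborel g] gi by simp
  have eq: "gtail a (x - 1) - integral {x - 1..y} g = gtail a y" if "y \<in> {x - 1<..<x + 1}" for y
  proof -
    have "gtail a (x - 1) - gtail a y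
        = (\<integral>z. indicator {x - 1<..} z * g z - indicator {y<..} z * g z \<partial>lborel)"
      unfolding gtail_def g_def by (subst Bochner_Integration.integral_diff)
        (use ind[unfolded g_def] in \<open>auto simp: nu_integral algebra_simps\<close>)
    also have "\<dots> = (\<integral>z. indicator {x - 1..y} z * g z \<partial>lborel)"
    proof (rule integral_cong_AE)
      show "AE z in lborel. indicator {x - 1<..} z * g z - indicator {y<..} z * g z = indicator {x - 1..y} z * g z"
        using AE_lborel_singleton[of "x - 1"]
        by eventually_elim (use that in \<open>auto simp: indicator_def\<close>)
    qed (auto simp: g_def)
    also have "\<dots> = integral {x - 1..y} g"
      using set_borel_integral_eq_integral(2)[OF borel_integrable_atLeastAtMost'[OF gc]]
      by (simp add: set_lebesgue_integral_def)
    finally show ?thesis by simp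
  qed
  have "((\<lambda>y. integral {x - 1..y} g) has_real_derivative g x) (at x within {x - 1..x + 1})"
    by (rule integral_has_real_derivative) (auto intro: gc)
  then have "((\<lambda>y. integral {x - 1..y} g) has_real_derivative g x) (at x)"
    by (simp add: at_within_Icc_at)
  then have "((\<lambda>y. gtail a (x - 1) - integral {x - 1..y} g) has_real_derivative - (a x * \<gamma> x)) (at x)"
    by (auto intro!: derivative_eq_intros simp: g_def)
  then show ?thesis
    by (rule has_field_derivative_transform_within_open[of _ _ _ "{x - 1<..<x + 1}"]) (auto simp: eq)
qed

lemma gstein_deriv:
  assumes "continuous_on UNIV a" "integrable \<nu> a"
  shows "(gstein a has_real_derivative x * gstein a x - a x) (at x)"
  unfolding gstein_def[abs_def]
  by (rule derivative_eq_intros gtail_deriv[OF assms] gamma_deriv refl)+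
    (use gamma_pos[of x] in \<open>auto simp: field_simps power2_eq_square\<close>)

lemma gstein_cont:
  assumes "continuous_on UNIV a" "integrable \<nu> a"
  shows "continuous_on S (gstein a)"
  by (meson gstein_deriv[OF assms] DERIV_isCont continuous_at_imp_continuous_on)

lemma gstein_measurable:
  assumes "continuous_on UNIV a" "integrable \<nu> a"
  shows "gstein a \<in> borel_measurable borel"
  by (rule borel_measurable_continuous_onI[OF gstein_cont[OF assms]])

lemma gamma_tendsto: "(\<gamma> \<longlongrightarrow> 0) at_top"
  unfolding std_normal_density_def by real_asymp

text \<open>Mills' inequality: on the tail, \<open>1 \<le> y / x\<close>, and \<open>y \<gamma>(y)\<close> is the derivative of \<open>- \<gamma>\<close>.\<close>

lemma mills:
  assumes x: "x > 0"
  shows "(\<integral>y. indicator {x<..} y \<partial>\<nu>) \<le> \<gamma> x / x"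
proof -
  have nn: "(\<integral>\<^sup>+y. ennreal (y * \<gamma> y) * indicator {x..} y \<partial>lborel) = 0 - (- \<gamma> x)"
  proof (rule nn_integral_FTC_atLeast)
    show "DERIV (\<lambda>y. - \<gamma> y) y :> y * \<gamma> y" for y
      by (rule derivative_eq_intros gamma_deriv)+ simp
    show "((\<lambda>y. - \<gamma> y) \<longlongrightarrow> 0) at_top" using tendsto_minus[OF gamma_tendsto] by simp
    show "0 \<le> y * \<gamma> y" if "x \<le> y" for y using that x gamma_pos[of y] by simp
  qed simp
  have "ennreal (\<integral>y. indicator {x<..} y * x \<partial>\<nu>) = (\<integral>\<^sup>+y. ennreal (indicator {x<..} y * x) \<partial>\<nu>)"
    by (rule nn_integral_eq_integral[symmetric])
      (use x in \<open>auto intro!: integrable_real_indicator nu_emeasure_finite\<close>)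
  also have "\<dots> = (\<integral>\<^sup>+y. ennreal (\<gamma> y * (indicator {x<..} y * x)) \<partial>lborel)"
    by (subst nn_integral_density) (use x in \<open>auto simp: ennreal_mult'\<close>)
  also have "\<dots> \<le> (\<integral>\<^sup>+y. ennreal (y * \<gamma> y) * indicator {x..} y \<partial>lborel)"
    by (intro nn_integral_mono)
      (use x gamma_pos in \<open>auto simp: indicator_def mult.commute intro!: ennreal_leI mult_right_mono less_imp_le\<close>)
  also have "\<dots> = ennreal (\<gamma> x)" unfolding nn by simp
  finally have "(\<integral>y. indicator {x<..} y * x \<partial>\<nu>) \<le> \<gamma> x"
    using gamma_pos[of x] by (simp add: ennreal_le_iff)
  then show ?thesis using x by (simp add: field_simps)
qed

lemma gtail_sq:
  assumes [measurable]: "a \<in> borel_measurable borel" and a2: "integrable \<nu> (\<lambda>y. (a y)\<^sup>2)" and x: "x > 0"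
  shows "(gtail a x)\<^sup>2 \<le> \<gamma> x / x * gtail (\<lambda>y. (a y)\<^sup>2) x"
proof -
  have i2: "(indicator S y :: real)\<^sup>2 = indicator S y" for S and y :: real by (simp add: indicator_def)
  have "(\<integral>y. indicator {x<..} y * (indicator {x<..} y * a y) \<partial>\<nu>)\<^sup>2
      \<le> (\<integral>y. (indicator {x<..} y)\<^sup>2 \<partial>\<nu>) * (\<integral>y. (indicator {x<..} y * a y)\<^sup>2 \<partial>\<nu>)"
    by (rule integral_Cauchy_Schwarz)
      (use integrable_mult_indicator[of "{x<..}" \<nu> "\<lambda>y. (a y)\<^sup>2"] a2 in
       \<open>auto simp: i2 power_mult_distrib intro!: integrable_real_indicator nu_emeasure_finite\<close>)
  also have "(\<integral>y. indicator {x<..} y * (indicator {x<..} y * a y) \<partial>\<nu>) = gtail a x"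
    unfolding gtail_def by (intro Bochner_Integration.integral_cong) (auto simp: indicator_def)
  also have "(\<integral>y. (indicator {x<..} y * a y)\<^sup>2 \<partial>\<nu>) = gtail (\<lambda>y. (a y)\<^sup>2) x"
    unfolding gtail_def by (simp add: power_mult_distrib i2)
  also have "(\<integral>y. (indicator {x<..} y)\<^sup>2 \<partial>\<nu>) * gtail (\<lambda>y. (a y)\<^sup>2) x
      \<le> \<gamma> x / x * gtail (\<lambda>y. (a y)\<^sup>2) x"
    unfolding i2 using mills[OF x] by (intro mult_right_mono) (auto simp: gtail_def)
  finally show ?thesis .
qed

text \<open>The tail on the left equals minus the tail on the right for centred \<open>a\<close>; this carries every
  estimate at \<open>+\<infinity>\<close> over to \<open>-\<infinity>\<close>.\<close>

lemma gtail_reflect: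
  assumes [measurable]: "a \<in> borel_measurable borel" and ai: "integrable \<nu> a" and a0: "(\<integral>y. a y \<partial>\<nu>) = 0"
  shows "gtail a (- x) = - gtail (\<lambda>y. a (- y)) x"
proof -
  have 1: "integrable \<nu> (\<lambda>y. indicator S y * a y)" if "S \<in> sets borel" for S
    using integrable_mult_indicator[of S \<nu> a] ai that by simp
  have "(\<integral>y. a y \<partial>\<nu>) = (\<integral>y. indicator {- x<..} y * a y + indicator {..- x} y * a y \<partial>\<nu>)"
    by (intro Bochner_Integration.integral_cong) (auto simp: indicator_def)
  also have "\<dots> = gtail a (- x) + (\<integral>y. indicator {..- x} y * a y \<partial>\<nu>)"
    unfolding gtail_def by (intro Bochner_Integration.integral_add 1) auto
  also have "(\<integral>y. indicator {..- x} y * a y \<partial>\<nu>) = (\<integral>y. indicator {..- x} (- y) * a (- y) \<partial>\<nu>)"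
    by (rule nu_reflect(1)[symmetric]) simp
  also have "\<dots> = gtail (\<lambda>y. a (- y)) x"
    unfolding gtail_def
  proof (rule integral_cong_AE)
    show "AE y in \<nu>. indicator {..- x} (- y) * a (- y) = indicator {x<..} y * a (- y)"
      using nu_null_point[of x] by eventually_elim (auto simp: indicator_def)
  qed auto
  finally show ?thesis using a0 by simp
qed

text \<open>With \<open>f = gstein a\<close> the integrand is \<open>f\<^sup>2 + f'\<^sup>2\<close>. The function \<open>\<Phi>(x) = x \<gamma>(x) f(x)\<^sup>2\<close> has
  the derivative \<open>\<gamma> (f\<^sup>2 + f'\<^sup>2 - a\<^sup>2)\<close>, and by Cauchy-Schwarz and Mills' inequality the boundary
  terms of \<open>\<Phi>\<close> on \<open>[-R, R]\<close> are at most the mass of \<open>a\<^sup>2\<close> outside this interval, so the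
  inequality holds before any limit is taken.\<close>

lemma gstein_energy:
  assumes cont: "continuous_on UNIV a" and a2: "integrable \<nu> (\<lambda>y. (a y)\<^sup>2)" and ai: "integrable \<nu> a"
    and a0: "(\<integral>y. a y \<partial>\<nu>) = 0"
  shows "integrable \<nu> (\<lambda>x. (gstein a x)\<^sup>2 + (x * gstein a x - a x)\<^sup>2)"
    and "(\<integral>x. (gstein a x)\<^sup>2 + (x * gstein a x - a x)\<^sup>2 \<partial>\<nu>) \<le> msq a"
proof -
  have [measurable]: "a \<in> borel_measurable borel" by (rule borel_measurable_continuous_onI[OF cont])
  have gsc: "continuous_on S (gstein a)" for S by (rule gstein_cont[OF cont ai])
  have [measurable]: "gstein a \<in> borel_measurable borel" by (rule gstein_measurable[OF cont ai])
  define w where "w x = (gstein a x)\<^sup>2 + (x * gstein a x - a x)\<^sup>2" for x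
  have [measurable]: "w \<in> borel_measurable borel" unfolding w_def by simp
  have w0: "w x \<ge> 0" for x unfolding w_def by simp
  define \<Phi> where "\<Phi> x = x * (gtail a x)\<^sup>2 / \<gamma> x" for x
  have wc: "continuous_on S w" for S unfolding w_def
    by (intro continuous_intros gsc continuous_on_subset[OF cont]) auto
  have \<Phi>: "(\<Phi> has_real_derivative \<gamma> x * w x - \<gamma> x * (a x)\<^sup>2) (at x)" for x
    unfolding \<Phi>_def[abs_def]
    by (rule derivative_eq_intros gtail_deriv[OF cont ai] gamma_deriv refl)+
      (use gamma_pos[of x] in \<open>auto simp: w_def gtail_eq field_simps power2_eq_square\<close>)
  have trunc: "integrable \<nu> (\<lambda>x. indicator {-R..R} x * w x) \<and>
      (\<integral>x. indicator {-R..R} x * w x \<partial>\<nu>) \<le> msq a" if R: "R > 0" for R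
  proof -
    have ia: "integrable \<nu> (\<lambda>y. indicator S y * (a y)\<^sup>2)" if "S \<in> sets borel" for S
      using integrable_mult_indicator[of S \<nu> "\<lambda>y. (a y)\<^sup>2"] a2 that by simp
    have cf: "continuous_on S (\<lambda>x. \<gamma> x * w x - \<gamma> x * (a x)\<^sup>2)" for S
      by (intro continuous_intros wc gamma_cont continuous_on_subset[OF cont]) auto
    have "has_bochner_integral lborel (\<lambda>x. (\<gamma> x * w x - \<gamma> x * (a x)\<^sup>2) * indicator {-R..R} x) (\<Phi> R - \<Phi> (-R))"
      by (rule has_bochner_integral_FTC_Icc_real)
       (use R \<Phi> cf[of UNIV] in \<open>auto simp: continuous_on_eq_continuous_within\<close>)
    then have hb: "has_bochner_integral lborel (\<lambda>x. \<gamma> x * (indicator {-R..R} x * w x) - \<gamma> x * (indicator {-R..R} x * (a x)\<^sup>2)) (\<Phi> R - \<Phi> (-R))"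
      by (simp add: algebra_simps)
    have ia': "integrable lborel (\<lambda>x. \<gamma> x * (indicator {-R..R} x * (a x)\<^sup>2))"
      using ia[of "{-R..R}"] by (simp add: nu_integrable)
    have iw: "integrable lborel (\<lambda>x. \<gamma> x * (indicator {-R..R} x * w x))"
      using Bochner_Integration.integrable_add[OF integrable.intros[OF hb] ia'] by simp
    have "(\<integral>x. indicator {-R..R} x * w x \<partial>\<nu>) - (\<integral>x. indicator {-R..R} x * (a x)\<^sup>2 \<partial>\<nu>) = \<Phi> R - \<Phi> (-R)"
      using has_bochner_integral_integral_eq[OF hb] iw ia' by (simp add: nu_integral)
    moreover have "\<Phi> R \<le> (\<integral>y. indicator {R<..} y * (a y)\<^sup>2 \<partial>\<nu>)"
    proof -
      have "\<Phi> R \<le> R * (\<gamma> R / R * gtail (\<lambda>y. (a y)\<^sup>2) R) / \<gamma> R"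
        unfolding \<Phi>_def using gtail_sq[OF _ a2 R] R gamma_pos[of R]
        by (intro divide_right_mono mult_left_mono) auto
      also have "\<dots> = gtail (\<lambda>y. (a y)\<^sup>2) R" using R gamma_pos[of R] by simp
      finally show ?thesis by (simp add: gtail_def)
    qed
    moreover have "- \<Phi> (-R) \<le> (\<integral>y. indicator {..<-R} y * (a y)\<^sup>2 \<partial>\<nu>)"
    proof -
      have "- \<Phi> (-R) = R * (gtail (\<lambda>y. a (- y)) R)\<^sup>2 / \<gamma> R"
        unfolding \<Phi>_def using gtail_reflect[OF _ ai a0, of R] by (simp add: std_normal_density_def)
      also have "\<dots> \<le> R * (\<gamma> R / R * gtail (\<lambda>y. (a (- y))\<^sup>2) R) / \<gamma> R"
        using R gamma_pos[of R] nu_reflect(2)[of "\<lambda>y. (a y)\<^sup>2"] a2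
        by (intro divide_right_mono mult_left_mono gtail_sq) auto
      also have "\<dots> = gtail (\<lambda>y. (a (- y))\<^sup>2) R" using R gamma_pos[of R] by simp
      also have "\<dots> = (\<integral>y. indicator {..<-R} (- y) * (a (- y))\<^sup>2 \<partial>\<nu>)"
        unfolding gtail_def by (intro Bochner_Integration.integral_cong) (auto simp: indicator_def)
      also have "\<dots> = (\<integral>y. indicator {..<-R} y * (a y)\<^sup>2 \<partial>\<nu>)"
        by (rule nu_reflect(1)) simp
      finally show ?thesis .
    qed
    moreover have "(\<integral>y. indicator {R<..} y * (a y)\<^sup>2 \<partial>\<nu>) + (\<integral>y. indicator {..<-R} y * (a y)\<^sup>2 \<partial>\<nu>)
      + (\<integral>x. indicator {-R..R} x * (a x)\<^sup>2 \<partial>\<nu>) = msq a"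
    proof -
      have "msq a = (\<integral>y. indicator {R<..} y * (a y)\<^sup>2 + indicator {..<-R} y * (a y)\<^sup>2
        + indicator {-R..R} y * (a y)\<^sup>2 \<partial>\<nu>)"
        by (intro Bochner_Integration.integral_cong) (use R in \<open>auto simp: indicator_def\<close>)
      then show ?thesis using ia by simp
    qed
    ultimately show ?thesis using iw by (simp add: nu_integrable)
  qed
  let ?f = "\<lambda>n::nat. \<lambda>x. indicator {- real (Suc n)..real (Suc n)} x * w x"
  have int: "integrable \<nu> (?f n)" and le: "(\<integral>x. ?f n x \<partial>\<nu>) \<le> msq a" for n
    using trunc[of "real (Suc n)"] by auto
  have mono: "mono (\<lambda>n. ?f n x)" for x
    by (rule monoI, rule mult_right_mono) (auto simp: indicator_def w0)
  have "incseq (\<lambda>n. \<integral>x. ?f n x \<partial>\<nu>)"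
    by (rule incseq_SucI, rule integral_mono[OF int int]) (rule monoD[OF mono], simp)
  then obtain L where L: "(\<lambda>n. \<integral>x. ?f n x \<partial>\<nu>) \<longlonglongrightarrow> L"
    using incseq_convergent[of "\<lambda>n. \<integral>x. ?f n x \<partial>\<nu>"] le by metis
  have lim: "(\<lambda>n. ?f n x) \<longlonglongrightarrow> w x" for x
  proof (rule tendsto_eventually)
    show "\<forall>\<^sub>F n in sequentially. ?f n x = w x"
    proof (rule eventually_sequentiallyI[of "nat \<lceil>\<bar>x\<bar>\<rceil>"])
      fix n assume "nat \<lceil>\<bar>x\<bar>\<rceil> \<le> n"
      then have "\<bar>x\<bar> \<le> real (Suc n)" by linarith
      then show "?f n x = w x" by (simp add: indicator_def abs_le_iff)
    qed
  qed
  have "integrable \<nu> w" "(\<integral>x. w x \<partial>\<nu>) = L"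
    by (rule integral_monotone_convergence_nonneg[of \<nu> ?f w L]; use int mono lim L w0 in auto)+
  moreover have "L \<le> msq a" by (rule LIMSEQ_le_const2[OF L]) (use le in auto)
  ultimately show "integrable \<nu> (\<lambda>x. (gstein a x)\<^sup>2 + (x * gstein a x - a x)\<^sup>2)"
    and "(\<integral>x. (gstein a x)\<^sup>2 + (x * gstein a x - a x)\<^sup>2 \<partial>\<nu>) \<le> msq a"
    unfolding w_def by auto
qed

lemma gtail_mult_tendsto:
  assumes [measurable]: "a \<in> borel_measurable borel" and a2: "integrable \<nu> (\<lambda>y. (a y)\<^sup>2)"
    and k: "\<And>x. \<bar>k x\<bar> \<le> C * (1 + \<bar>x\<bar>) ^ 3"
  shows "((\<lambda>x. gtail a x * k x) \<longlongrightarrow> 0) at_top"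
proof (rule Lim_null_comparison)
  let ?D = "\<integral>y. (a y)\<^sup>2 \<partial>\<nu>"
  show "((\<lambda>x. sqrt (?D * \<gamma> x) * (C * (1 + x) ^ 3)) \<longlongrightarrow> 0) at_top"
  proof -
    have "((\<lambda>x. sqrt (\<gamma> x) * (1 + x) ^ 3) \<longlongrightarrow> 0) at_top"
      unfolding std_normal_density_def by real_asymp
    then have "((\<lambda>x. sqrt ?D * C * (sqrt (\<gamma> x) * (1 + x) ^ 3)) \<longlongrightarrow> sqrt ?D * C * 0) at_top"
      by (intro tendsto_intros)
    then show ?thesis by (simp add: real_sqrt_mult algebra_simps)
  qed
  show "\<forall>\<^sub>F x in at_top. norm (gtail a x * k x) \<le> sqrt (?D * \<gamma> x) * (C * (1 + x) ^ 3)"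
  proof (rule eventually_at_top_linorderI[of 1])
    fix x :: real assume x: "1 \<le> x"
    have "(gtail a x)\<^sup>2 \<le> \<gamma> x / x * gtail (\<lambda>y. (a y)\<^sup>2) x"
      using x by (intro gtail_sq a2) auto
    also have "\<dots> \<le> \<gamma> x * ?D"
    proof (rule mult_mono)
      show "\<gamma> x / x \<le> \<gamma> x" using x gamma_pos[of x] by (simp add: field_simps)
      show "gtail (\<lambda>y. (a y)\<^sup>2) x \<le> ?D" unfolding gtail_def
        by (rule integral_mono[OF _ a2]) (use integrable_mult_indicator[of "{x<..}" \<nu> "\<lambda>y. (a y)\<^sup>2"] a2 in \<open>auto simp: indicator_def\<close>)
    qed (auto simp: gtail_def intro!: mult_nonneg_nonneg)
    finally have "\<bar>gtail a x\<bar> \<le> sqrt (?D * \<gamma> x)"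
      by (simp add: real_le_rsqrt mult.commute)
    moreover have "\<bar>k x\<bar> \<le> C * (1 + x) ^ 3" using k[of x] x by simp
    ultimately show "norm (gtail a x * k x) \<le> sqrt (?D * \<gamma> x) * (C * (1 + x) ^ 3)"
      by (simp add: abs_mult mult_mono)
  qed
qed

text \<open>The tail integral of \<open>a\<close> decays like \<open>sqrt \<gamma>\<close>, which absorbs the growth of \<open>k\<close>. The third power
  is what the test functions below need: cubes of a Lipschitz function, and functions of linear
  growth of a quadratic polynomial in it.\<close>

lemma gstein_by_parts:
  assumes cont: "continuous_on UNIV a" and a2: "integrable \<nu> (\<lambda>y. (a y)\<^sup>2)" and ai: "integrable \<nu> a"
    and a0: "(\<integral>y. a y \<partial>\<nu>) = 0"
    and k: "\<And>x. (k has_real_derivative k' x) (at x)" and k': "continuous_on UNIV k'"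
    and growth: "\<And>x. \<bar>k x\<bar> \<le> C * (1 + \<bar>x\<bar>) ^ 3"
    and i1: "integrable \<nu> (\<lambda>x. a x * k x)" and i2: "integrable \<nu> (\<lambda>x. gstein a x * k' x)"
  shows "(\<integral>x. a x * k x \<partial>\<nu>) = (\<integral>x. gstein a x * k' x \<partial>\<nu>)"
proof -
  have [measurable]: "a \<in> borel_measurable borel" by (rule borel_measurable_continuous_onI[OF cont])
  have [measurable]: "gstein a \<in> borel_measurable borel" by (rule gstein_measurable[OF cont ai])
  have [measurable]: "k' \<in> borel_measurable borel" by (rule borel_measurable_continuous_onI[OF k'])
  have kc: "continuous_on UNIV k" using k by (meson DERIV_isCont continuous_at_imp_continuous_on)
  have [measurable]: "k \<in> borel_measurable borel" by (rule borel_measurable_continuous_onI[OF kc])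
  let ?F = "\<lambda>x. gtail a x * k x" and ?f = "\<lambda>x. \<gamma> x * (gstein a x * k' x) - \<gamma> x * (a x * k x)"
  have top: "(?F \<longlongrightarrow> 0) at_top" by (rule gtail_mult_tendsto[OF _ a2 growth]) simp
  have bot: "(?F \<longlongrightarrow> 0) at_bot"
  proof -
    have "((\<lambda>x. gtail (\<lambda>y. a (- y)) x * k (- x)) \<longlongrightarrow> 0) at_top"
      by (rule gtail_mult_tendsto[where C = C])
        (use nu_reflect(2)[of "\<lambda>y. (a y)\<^sup>2"] a2 growth[of "- x" for x] in auto)
    then have "((\<lambda>x. - (gtail (\<lambda>y. a (- y)) x * k (- x))) \<longlongrightarrow> 0) at_top"
      using tendsto_minus by fastforce
    then show ?thesis
      unfolding filterlim_at_bot_mirror gtail_reflect[OF _ ai a0, simplified] by simp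
  qed
  have "(LBINT x=-\<infinity>..\<infinity>. ?f x) = 0 - 0"
  proof (rule interval_integral_FTC_integrable)
    show "(?F has_vector_derivative ?f x) (at x)" for x
      unfolding has_real_derivative_iff_has_vector_derivative[symmetric]
      by (rule derivative_eq_intros gtail_deriv[OF cont ai] k refl)+ (simp add: gtail_eq algebra_simps)
    have "continuous_on UNIV ?f"
      by (intro continuous_intros gamma_cont gstein_cont cont ai k' kc)
    then show "isCont ?f x" for x by (simp add: continuous_on_eq_continuous_within)
    have "integrable lborel ?f"
      using i1 i2 by (intro Bochner_Integration.integrable_diff) (auto simp: nu_integrable)
    then show "set_integrable lborel (einterval (-\<infinity>) \<infinity>) ?f"
      by (simp add: set_integrable_def)
    show "((?F \<circ> real_of_ereal) \<longlongrightarrow> 0) (at_right (-\<infinity>))" "((?F \<circ> real_of_ereal) \<longlongrightarrow> 0) (at_left \<infinity>)"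
      unfolding ereal_tendsto_simps by (fact bot top)+
  qed simp
  then have "(\<integral>x. ?f x \<partial>lborel) = 0"
    by (simp add: interval_lebesgue_integral_def set_lebesgue_integral_def)
  then show ?thesis using i1 i2 by (simp add: nu_integral nu_integrable)
qed

section \<open>Lipschitz functions of one Gaussian variable\<close>

text \<open>The difference \<open>D = c \<gamma> - gtail f\<close> has the derivative \<open>(f - c x) \<gamma>\<close>, whose sign changes at most once,
  from plus to minus, because \<open>f - c x\<close> is nonincreasing. As \<open>D\<close> vanishes at both ends, it is
  nonnegative.\<close>

lemma gtail_le_lipschitz:
  assumes deriv: "\<And>x. (f has_real_derivative f' x) (at x)" and bnd: "\<And>x. f' x \<le> c"
    and f2: "integrable \<nu> (\<lambda>x. (f x)\<^sup>2)" and fi: "integrable \<nu> f" and f0: "(\<integral>x. f x \<partial>\<nu>) = 0"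
  shows "gtail f x \<le> c * \<gamma> x"
proof (rule ccontr)
  have cont: "continuous_on UNIV f" using deriv by (meson DERIV_isCont continuous_at_imp_continuous_on)
  have [measurable]: "f \<in> borel_measurable borel" by (rule borel_measurable_continuous_onI[OF cont])
  define D where "D y = c * \<gamma> y - gtail f y" for y
  have D': "(D has_real_derivative (f y - c * y) * \<gamma> y) (at y)" for y
    unfolding D_def[abs_def]
    by (rule derivative_eq_intros gtail_deriv[OF cont fi] gamma_deriv refl)+ (simp add: algebra_simps)
  have anti: "f z - c * z \<le> f y - c * y" if "y \<le> z" for y z
    by (rule DERIV_nonpos_imp_nonincreasing[OF that])
      (use bnd in \<open>auto intro!: exI[of _ "f' _ - c"] derivative_eq_intros deriv\<close>)
  have top0: "(gtail g \<longlongrightarrow> 0) at_top"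
    if "g \<in> borel_measurable borel" "integrable \<nu> (\<lambda>y. (g y)\<^sup>2)" for g
    using gtail_mult_tendsto[OF that, of "\<lambda>_. 1" 1] by simp
  have top: "(D \<longlongrightarrow> 0) at_top"
    unfolding D_def[abs_def] using tendsto_diff[OF tendsto_mult_left[OF gamma_tendsto, of c] top0[OF _ f2]]
    by simp
  have "(gtail (\<lambda>y. f (- y)) \<longlongrightarrow> 0) at_top"
    by (rule top0) (use nu_reflect(2)[of "\<lambda>y. (f y)\<^sup>2"] f2 in auto)
  then have "((\<lambda>y. D (- y)) \<longlongrightarrow> 0) at_top"
    unfolding D_def[abs_def] gtail_reflect[OF _ fi f0, simplified]
    using tendsto_add[OF tendsto_mult_left[OF gamma_tendsto, of c]]
    by (fastforce simp: std_normal_density_def)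
  then have bot: "(D \<longlongrightarrow> 0) at_bot" unfolding filterlim_at_bot_mirror .
  assume "\<not> gtail f x \<le> c * \<gamma> x"
  then have neg: "D x < 0" unfolding D_def by simp
  show False
  proof (cases "f x \<le> c * x")
    case True
    have "D y \<le> D x" if "x \<le> y" for y
    proof (rule DERIV_nonpos_imp_nonincreasing[OF that])
      fix z assume "x \<le> z"
      then have "(f z - c * z) * \<gamma> z \<le> 0"
        using anti[of x z] True gamma_pos[of z] by (simp add: mult_le_0_iff)
      then show "\<exists>y. (D has_real_derivative y) (at z) \<and> y \<le> 0" using D' by blast
    qed
    then have "0 \<le> D x" by (intro tendsto_upperbound[OF top]) (auto simp: eventually_at_top_linorder)
    then show False using neg by simp
  next
    case False
    have "D y \<le> D x" if "y \<le> x" for y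
    proof (rule DERIV_nonneg_imp_nondecreasing[OF that])
      fix z assume "z \<le> x"
      then have "(f z - c * z) * \<gamma> z \<ge> 0"
        using anti[of z x] False gamma_pos[of z] by (simp add: zero_le_mult_iff)
      then show "\<exists>y. (D has_real_derivative y) (at z) \<and> y \<ge> 0" using D' by blast
    qed
    then have "0 \<le> D x" by (intro tendsto_upperbound[OF bot]) (auto simp: eventually_at_bot_linorder)
    then show False using neg by simp
  qed
qed

locale lipschitz_gauss =
  fixes \<psi> \<psi>' :: "real \<Rightarrow> real" and c :: real
  assumes deriv: "\<And>x. (\<psi> has_real_derivative \<psi>' x) (at x)"
    and cont': "continuous_on UNIV \<psi>'"
    and bnd: "\<And>x. \<bar>\<psi>' x\<bar> \<le> c"
    and mean: "(\<integral>x. \<psi> x \<partial>\<nu>) = 0" and var: "msq \<psi> = 1"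
begin

lemma c_nonneg: "0 \<le> c" using bnd[of 0] by linarith

lemma cont: "continuous_on S \<psi>"
  by (meson deriv DERIV_isCont continuous_at_imp_continuous_on)

lemma psi_measurable[measurable]: "\<psi> \<in> borel_measurable borel"
  by (rule borel_measurable_continuous_onI[OF cont])

lemma psi'_measurable[measurable]: "\<psi>' \<in> borel_measurable borel"
  by (rule borel_measurable_continuous_onI[OF cont'])

lemma lip: "\<bar>\<psi> x - \<psi> y\<bar> \<le> c * \<bar>x - y\<bar>"
  using field_differentiable_bound[of UNIV \<psi> \<psi>' c x y] deriv bnd
  by (auto simp: has_field_derivative_at_within)

lemma psi_growth0: "\<bar>\<psi> x\<bar> \<le> (\<bar>\<psi> 0\<bar> + c) * (1 + \<bar>x\<bar>)"
proof -
  have "\<bar>\<psi> x\<bar> \<le> \<bar>\<psi> 0\<bar> + c * \<bar>x\<bar>" using lip[of x 0] by simp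
  also have "\<dots> \<le> (\<bar>\<psi> 0\<bar> + c) * (1 + \<bar>x\<bar>)" using c_nonneg by (simp add: algebra_simps)
  finally show ?thesis .
qed

lemma psi_power_integrable: "integrable \<nu> (\<lambda>x. \<psi> x ^ k)"
  by (rule nu_poly[of _ "(\<bar>\<psi> 0\<bar> + c) ^ k" k])
    (use power_mono[OF psi_growth0] in \<open>auto simp: power_abs power_mult_distrib\<close>)

lemma psi_integrable: "integrable \<nu> \<psi>"
  using psi_power_integrable[of 1] by simp

lemma psi_zero: "\<bar>\<psi> 0\<bar> \<le> c"
proof -
  interpret prob_space \<nu> by (rule nu_prob)
  have m2: "integrable \<nu> (\<lambda>x. x\<^sup>2)" using nu_moment[of 2] by simp
  have E2: "(\<integral>x. x\<^sup>2 \<partial>\<nu>) = 1"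
    using integral_std_normal_moment_even[of 1] by (simp add: nu_integral fact_numeral)
  have m1: "integrable \<nu> (\<lambda>x. \<bar>x\<bar>)" using nu_moment[of 1] by simp
  have "(\<integral>x. \<bar>x\<bar> \<partial>\<nu>) \<le> (\<integral>x. (1 + x\<^sup>2) / 2 \<partial>\<nu>)"
    by (rule integral_mono[OF m1]) (use m2 sum_squares_bound[of 1 "\<bar>x\<bar>" for x] in \<open>auto simp: power2_abs field_simps\<close>)
  also have "\<dots> = 1" using m2 E2 prob_space by simp
  finally have E1: "(\<integral>x. \<bar>x\<bar> \<partial>\<nu>) \<le> 1" .
  have "\<psi> 0 = (\<integral>x. \<psi> 0 - \<psi> x \<partial>\<nu>)"
    using mean psi_integrable prob_space by simp
  then have "\<bar>\<psi> 0\<bar> \<le> (\<integral>x. \<bar>\<psi> 0 - \<psi> x\<bar> \<partial>\<nu>)" by (metis integral_abs_bound)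
  also have "\<dots> \<le> (\<integral>x. c * \<bar>x\<bar> \<partial>\<nu>)"
    by (rule integral_mono) (use psi_integrable m1 lip[of 0] in auto)
  also have "\<dots> \<le> c" using E1 c_nonneg by (simp add: mult_left_le)
  finally show ?thesis .
qed

lemma psi_growth: "\<bar>\<psi> x\<bar> \<le> c * (1 + \<bar>x\<bar>)"
  using lip[of x 0] psi_zero by (simp add: algebra_simps)

text \<open>The inverses \<open>u = gstein \<psi>\<close> and \<open>v = gstein h\<close> of the linear and of the quadratic part are the
  building blocks of the Stein kernel; \<open>\<delta>\<close> is the variance of \<open>\<psi>(N)\<^sup>2\<close> and \<open>m3\<close> the third moment
  of \<open>\<psi>(N)\<close>.\<close>

definition u :: "real \<Rightarrow> real" where "u = gstein \<psi>"
definition h :: "real \<Rightarrow> real" where "h x = (\<psi> x)\<^sup>2 - 1"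
definition v :: "real \<Rightarrow> real" where "v = gstein h"
definition \<delta> :: real where "\<delta> = msq h"
definition m3 :: real where "m3 = (\<integral>x. \<psi> x ^ 3 \<partial>\<nu>)"

lemma h_cont: "continuous_on S h"
  unfolding h_def by (intro continuous_intros cont)

lemma h_measurable[measurable]: "h \<in> borel_measurable borel"
  by (rule borel_measurable_continuous_onI[OF h_cont])

lemma h_integrable: "integrable \<nu> h"
  unfolding h_def using psi_power_integrable[of 2] prob_space.finite_measure[OF nu_prob]
  by (auto intro!: Bochner_Integration.integrable_diff finite_measure.integrable_const)

lemma h_sq: "(h x)\<^sup>2 = \<psi> x ^ 4 - 2 * \<psi> x ^ 2 + 1"
  unfolding h_def by (simp add: power2_eq_square power4_eq_xxxx algebra_simps)

lemma h_sq_integrable: "integrable \<nu> (\<lambda>x. (h x)\<^sup>2)"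
  unfolding h_sq using psi_power_integrable prob_space.finite_measure[OF nu_prob]
  by (auto intro!: Bochner_Integration.integrable_add Bochner_Integration.integrable_diff finite_measure.integrable_const)

lemma h_mean: "(\<integral>x. h x \<partial>\<nu>) = 0"
proof -
  interpret prob_space \<nu> by (rule nu_prob)
  show ?thesis unfolding h_def using psi_power_integrable[of 2] var prob_space by simp
qed

lemma delta_eq: "\<delta> = (\<integral>x. \<psi> x ^ 4 \<partial>\<nu>) - 1"
proof -
  interpret prob_space \<nu> by (rule nu_prob)
  show ?thesis unfolding \<delta>_def h_sq using psi_power_integrable var prob_space by simp
qed

lemma u_measurable[measurable]: "u \<in> borel_measurable borel"
  unfolding u_def by (rule gstein_measurable[OF cont psi_integrable])

lemma v_measurable[measurable]: "v \<in> borel_measurable borel"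
  unfolding v_def by (rule gstein_measurable[OF h_cont h_integrable])

lemma u_bound: "\<bar>u x\<bar> \<le> c"
proof -
  have "gtail \<psi> x \<le> c * \<gamma> x"
    by (rule gtail_le_lipschitz[OF deriv]) (use bnd abs_le_iff psi_power_integrable[of 2] psi_integrable mean in auto)
  moreover have "gtail (\<lambda>x. - \<psi> x) x \<le> c * \<gamma> x"
    by (rule gtail_le_lipschitz[of _ "\<lambda>x. - \<psi>' x"])
      (use bnd abs_le_iff psi_power_integrable[of 2] psi_integrable mean in \<open>auto intro!: derivative_eq_intros deriv\<close>)
  moreover have "gtail (\<lambda>x. - \<psi> x) x = - gtail \<psi> x" unfolding gtail_def by simp
  ultimately show ?thesis
    unfolding u_def gstein_def using gamma_pos[of x] by (auto simp: abs_le_iff field_simps)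
qed

text \<open>Since \<open>\<bar>\<psi> x\<bar> \<le> c (1 + \<bar>x\<bar>)\<close>, the product \<open>f \<psi>\<close> with \<open>f = gstein a\<close> is bounded by \<open>c\<close> times
  \<open>\<bar>f\<bar> + \<bar>x f\<bar> \<le> \<bar>f\<bar> + \<bar>x f - a\<bar> + \<bar>a\<bar>\<close>. The square of a sum of three terms costs a factor 3, and the
  energy bound applies twice.\<close>

lemma gstein_second_moments:
  assumes a: "continuous_on UNIV a" "integrable \<nu> (\<lambda>y. (a y)\<^sup>2)" "integrable \<nu> a" "(\<integral>y. a y \<partial>\<nu>) = 0"
  shows "integrable \<nu> (\<lambda>x. (gstein a x)\<^sup>2)" "msq (gstein a) \<le> msq a"
    and "integrable \<nu> (\<lambda>x. (gstein a x * \<psi> x)\<^sup>2)"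
    and "(\<integral>x. (gstein a x * \<psi> x)\<^sup>2 \<partial>\<nu>) \<le> 6 * c\<^sup>2 * msq a"
proof -
  have [measurable]: "a \<in> borel_measurable borel" by (rule borel_measurable_continuous_onI[OF a(1)])
  have [measurable]: "gstein a \<in> borel_measurable borel" by (rule gstein_measurable[OF a(1,3)])
  define e where "e x = (gstein a x)\<^sup>2 + (x * gstein a x - a x)\<^sup>2" for x
  have e: "integrable \<nu> e" and Ee: "(\<integral>x. e x \<partial>\<nu>) \<le> msq a"
    using gstein_energy[OF a] unfolding e_def by auto
  show 1: "integrable \<nu> (\<lambda>x. (gstein a x)\<^sup>2)"
    by (rule Bochner_Integration.integrable_bound[OF e]) (auto simp: e_def)
  have "msq (gstein a) \<le> (\<integral>x. e x \<partial>\<nu>)"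
    by (rule integral_mono[OF 1 e]) (simp add: e_def)
  then show "msq (gstein a) \<le> msq a" using Ee by simp
  have ptw: "(gstein a x * \<psi> x)\<^sup>2 \<le> c\<^sup>2 * (3 * (e x + (a x)\<^sup>2))" for x
  proof -
    define V Y A where "V = \<bar>gstein a x\<bar>" and "Y = \<bar>x * gstein a x - a x\<bar>" and "A = \<bar>a x\<bar>"
    have "\<bar>gstein a x * \<psi> x\<bar> \<le> \<bar>gstein a x\<bar> * (c * (1 + \<bar>x\<bar>))"
      unfolding abs_mult by (intro mult_left_mono psi_growth) simp
    also have "\<dots> = c * (V + \<bar>x * gstein a x\<bar>)" by (simp add: V_def abs_mult algebra_simps)
    also have "\<dots> \<le> c * (V + Y + A)"
      by (intro mult_left_mono c_nonneg) (simp add: Y_def A_def)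
    finally have "(gstein a x * \<psi> x)\<^sup>2 \<le> (c * (V + Y + A))\<^sup>2"
      by (metis abs_ge_zero power2_abs power_mono)
    also have "\<dots> \<le> c\<^sup>2 * (3 * (V\<^sup>2 + Y\<^sup>2 + A\<^sup>2))"
    proof -
      have "(V + Y + A)\<^sup>2 \<le> 3 * (V\<^sup>2 + Y\<^sup>2 + A\<^sup>2)"
        using sum_squares_bound[of V Y] sum_squares_bound[of V A] sum_squares_bound[of Y A]
        by (simp add: power2_eq_square algebra_simps)
      then show ?thesis by (simp add: power_mult_distrib mult_left_mono)
    qed
    finally show ?thesis by (simp add: V_def Y_def A_def e_def)
  qed
  have bi: "integrable \<nu> (\<lambda>x. c\<^sup>2 * (3 * (e x + (a x)\<^sup>2)))" using e a(2) by simp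
  show 2: "integrable \<nu> (\<lambda>x. (gstein a x * \<psi> x)\<^sup>2)"
    by (rule Bochner_Integration.integrable_bound[OF bi]) (use ptw in \<open>auto intro!: AE_I2 order_trans[OF ptw]\<close>)
  have "(\<integral>x. (gstein a x * \<psi> x)\<^sup>2 \<partial>\<nu>) \<le> (\<integral>x. c\<^sup>2 * (3 * (e x + (a x)\<^sup>2)) \<partial>\<nu>)"
    by (rule integral_mono[OF 2 bi ptw])
  also have "\<dots> = c\<^sup>2 * (3 * ((\<integral>x. e x \<partial>\<nu>) + msq a))" using e a(2) by simp
  also have "\<dots> \<le> c\<^sup>2 * (3 * (msq a + msq a))"
    using Ee by (intro mult_left_mono) auto
  finally show "(\<integral>x. (gstein a x * \<psi> x)\<^sup>2 \<partial>\<nu>) \<le> 6 * c\<^sup>2 * msq a" by simp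
qed

lemma bound_by_derivative:
  assumes f: "f \<in> borel_measurable borel" and f2: "integrable \<nu> (\<lambda>x. (f x)\<^sup>2)"
  shows "integrable \<nu> (\<lambda>x. (\<psi>' x * f x)\<^sup>2)"
    and "(\<integral>x. (\<psi>' x * f x)\<^sup>2 \<partial>\<nu>) \<le> c\<^sup>2 * msq f"
proof -
  have [measurable]: "f \<in> borel_measurable borel" by fact
  have ptw: "(\<psi>' x * f x)\<^sup>2 \<le> c\<^sup>2 * (f x)\<^sup>2" for x
    unfolding power_mult_distrib using bnd[of x]
    by (intro mult_right_mono) (auto simp: abs_le_square_iff[symmetric] c_nonneg)
  have bi: "integrable \<nu> (\<lambda>x. c\<^sup>2 * (f x)\<^sup>2)" using f2 by simp
  show 1: "integrable \<nu> (\<lambda>x. (\<psi>' x * f x)\<^sup>2)"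
    by (rule Bochner_Integration.integrable_bound[OF bi]) (use ptw in auto)
  show "(\<integral>x. (\<psi>' x * f x)\<^sup>2 \<partial>\<nu>) \<le> c\<^sup>2 * msq f"
    using integral_mono[OF 1 bi ptw] by simp
qed

text \<open>The four functions of one coordinate that occur in the Stein kernel of a quadratic form. The
  function \<open>\<alpha>\<close> is the Stein kernel of \<open>\<psi>(N)\<close> itself.\<close>

definition \<alpha> :: "real \<Rightarrow> real" where "\<alpha> x = \<psi>' x * u x"
definition \<beta> :: "real \<Rightarrow> real" where "\<beta> x = \<psi>' x * v x"
definition \<eta> :: "real \<Rightarrow> real" where "\<eta> x = \<psi>' x * (u x * \<psi> x)"
definition \<theta> :: "real \<Rightarrow> real" where "\<theta> x = \<psi>' x * (v x * \<psi> x)"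

lemma kernel_factors_measurable[measurable]:
  "\<alpha> \<in> borel_measurable borel" "\<beta> \<in> borel_measurable borel"
  "\<eta> \<in> borel_measurable borel" "\<theta> \<in> borel_measurable borel"
  unfolding \<alpha>_def \<beta>_def \<eta>_def \<theta>_def by measurable

lemma alpha_bound: "\<bar>\<alpha> x\<bar> \<le> c\<^sup>2"
  unfolding \<alpha>_def power2_eq_square abs_mult by (intro mult_mono bnd u_bound c_nonneg) simp

lemmas psi_gstein = gstein_second_moments[OF cont psi_power_integrable[of 2] psi_integrable mean]
lemmas h_gstein = gstein_second_moments[OF h_cont h_sq_integrable h_integrable h_mean]

lemma alpha_sq: "integrable \<nu> (\<lambda>x. (\<alpha> x)\<^sup>2)" "msq \<alpha> \<le> c\<^sup>2"
proof -
  have 1: "integrable \<nu> (\<lambda>x. (u x)\<^sup>2)" "msq u \<le> 1"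
    using psi_gstein(1,2) var unfolding u_def by auto
  show "integrable \<nu> (\<lambda>x. (\<alpha> x)\<^sup>2)" unfolding \<alpha>_def by (rule bound_by_derivative(1)) (use 1 in auto)
  have "msq \<alpha> \<le> c\<^sup>2 * msq u"
    unfolding \<alpha>_def by (rule bound_by_derivative(2)) (use 1 in auto)
  also have "\<dots> \<le> c\<^sup>2 * 1" by (intro mult_left_mono 1) simp
  finally show "msq \<alpha> \<le> c\<^sup>2" by simp
qed

lemma beta_sq: "integrable \<nu> (\<lambda>x. (\<beta> x)\<^sup>2)" "msq \<beta> \<le> c\<^sup>2 * \<delta>"
proof -
  have 1: "integrable \<nu> (\<lambda>x. (v x)\<^sup>2)" "msq v \<le> \<delta>"
    using h_gstein(1,2) unfolding v_def \<delta>_def by auto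
  show "integrable \<nu> (\<lambda>x. (\<beta> x)\<^sup>2)" unfolding \<beta>_def by (rule bound_by_derivative(1)) (use 1 in auto)
  have "msq \<beta> \<le> c\<^sup>2 * msq v"
    unfolding \<beta>_def by (rule bound_by_derivative(2)) (use 1 in auto)
  also have "\<dots> \<le> c\<^sup>2 * \<delta>" by (intro mult_left_mono 1) simp
  finally show "msq \<beta> \<le> c\<^sup>2 * \<delta>" .
qed

lemma eta_sq: "integrable \<nu> (\<lambda>x. (\<eta> x)\<^sup>2)" "msq \<eta> \<le> c ^ 4"
proof -
  have ptw: "(\<eta> x)\<^sup>2 \<le> c ^ 4 * (\<psi> x)\<^sup>2" for x
  proof -
    have "(\<eta> x)\<^sup>2 = (\<alpha> x)\<^sup>2 * (\<psi> x)\<^sup>2" by (simp add: \<eta>_def \<alpha>_def power_mult_distrib)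
    also have "\<dots> \<le> (c\<^sup>2)\<^sup>2 * (\<psi> x)\<^sup>2"
      by (intro mult_right_mono) (metis abs_ge_zero alpha_bound power2_abs power_mono, simp)
    finally show ?thesis by simp
  qed
  have bi: "integrable \<nu> (\<lambda>x. c ^ 4 * (\<psi> x)\<^sup>2)" using psi_power_integrable[of 2] by simp
  show 1: "integrable \<nu> (\<lambda>x. (\<eta> x)\<^sup>2)"
    by (rule Bochner_Integration.integrable_bound[OF bi]) (use ptw in \<open>auto intro!: AE_I2 order_trans[OF ptw]\<close>)
  show "msq \<eta> \<le> c ^ 4"
    using integral_mono[OF 1 bi ptw] var by simp
qed

lemma theta_sq: "integrable \<nu> (\<lambda>x. (\<theta> x)\<^sup>2)" "msq \<theta> \<le> 6 * c ^ 4 * \<delta>"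
proof -
  have 1: "integrable \<nu> (\<lambda>x. (v x * \<psi> x)\<^sup>2)" "(\<integral>x. (v x * \<psi> x)\<^sup>2 \<partial>\<nu>) \<le> 6 * c\<^sup>2 * \<delta>"
    using h_gstein(3,4) unfolding v_def \<delta>_def by auto
  show "integrable \<nu> (\<lambda>x. (\<theta> x)\<^sup>2)" unfolding \<theta>_def by (rule bound_by_derivative(1)) (use 1 in auto)
  have "msq \<theta> \<le> c\<^sup>2 * (\<integral>x. (v x * \<psi> x)\<^sup>2 \<partial>\<nu>)"
    unfolding \<theta>_def by (rule bound_by_derivative(2)) (use 1 in auto)
  also have "\<dots> \<le> c\<^sup>2 * (6 * c\<^sup>2 * \<delta>)" by (intro mult_left_mono 1) simp
  finally show "msq \<theta> \<le> 6 * c ^ 4 * \<delta>" by (simp add: power4_eq_xxxx power2_eq_square algebra_simps)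
qed

lemma sq_integrableD:
  fixes f :: "real \<Rightarrow> real"
  assumes "f \<in> borel_measurable borel" "integrable \<nu> (\<lambda>x. (f x)\<^sup>2)"
  shows "integrable \<nu> f"
  using integral_Cauchy_Schwarz(1)[of f \<nu> "\<lambda>_. 1"] assms
    finite_measure.integrable_const[OF prob_space.finite_measure[OF nu_prob], of "1::real"] by simp

lemma kernel_factors_integrable: "integrable \<nu> \<alpha>" "integrable \<nu> \<beta>" "integrable \<nu> \<eta>" "integrable \<nu> \<theta>"
  using alpha_sq beta_sq eta_sq theta_sq by (auto intro: sq_integrableD)

lemma psi_power_growth:
  assumes "k \<le> 3"
  shows "\<bar>\<psi> x ^ k\<bar> \<le> (c + 1) ^ 3 * (1 + \<bar>x\<bar>) ^ 3"
proof -
  have "\<bar>\<psi> x ^ k\<bar> \<le> ((c + 1) * (1 + \<bar>x\<bar>)) ^ k"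
    unfolding power_abs
    by (intro power_mono order_trans[OF psi_growth] mult_right_mono) auto
  also have "\<dots> \<le> ((c + 1) * (1 + \<bar>x\<bar>)) ^ 3"
    using c_nonneg assms by (intro power_increasing mult_ge1_I) auto
  finally show ?thesis by (simp add: power_mult_distrib)
qed

text \<open>All mixed moments below are instances of integration by parts against a power of \<open>\<psi>\<close>.\<close>

lemma by_parts_power:
  assumes a: "continuous_on UNIV a" "integrable \<nu> (\<lambda>y. (a y)\<^sup>2)" "integrable \<nu> a" "(\<integral>y. a y \<partial>\<nu>) = 0"
    and k: "k < 3" and i1: "integrable \<nu> (\<lambda>x. a x * \<psi> x ^ Suc k)"
    and i2: "integrable \<nu> (\<lambda>x. \<psi>' x * (gstein a x * \<psi> x ^ k))"
  shows "(\<integral>x. \<psi>' x * (gstein a x * \<psi> x ^ k) \<partial>\<nu>) = (\<integral>x. a x * \<psi> x ^ Suc k \<partial>\<nu>) / real (Suc k)"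
proof -
  have eq: "gstein a x * (real (Suc k) * \<psi> x ^ k * \<psi>' x)
      = real (Suc k) * (\<psi>' x * (gstein a x * \<psi> x ^ k))" for x
    by (simp add: mult_ac)
  have "(\<integral>x. a x * \<psi> x ^ Suc k \<partial>\<nu>) = (\<integral>x. gstein a x * (real (Suc k) * \<psi> x ^ k * \<psi>' x) \<partial>\<nu>)"
  proof (rule gstein_by_parts[OF a, where C = "(c + 1) ^ 3"])
    show "((\<lambda>x. \<psi> x ^ Suc k) has_real_derivative real (Suc k) * \<psi> x ^ k * \<psi>' x) (at x)" for x
      using DERIV_power[OF deriv[of x], of "Suc k"] by (simp add: mult_ac)
    show "continuous_on UNIV (\<lambda>x. real (Suc k) * \<psi> x ^ k * \<psi>' x)"
      by (intro continuous_intros cont cont')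
    show "\<bar>\<psi> x ^ Suc k\<bar> \<le> (c + 1) ^ 3 * (1 + \<bar>x\<bar>) ^ 3" for x
      by (rule psi_power_growth) (use k in simp)
    show "integrable \<nu> (\<lambda>x. gstein a x * (real (Suc k) * \<psi> x ^ k * \<psi>' x))"
      unfolding eq using i2 by (rule Bochner_Integration.integrable_mult_right)
  qed fact
  also have "\<dots> = real (Suc k) * (\<integral>x. \<psi>' x * (gstein a x * \<psi> x ^ k) \<partial>\<nu>)"
    unfolding eq by (rule Bochner_Integration.integral_mult_right_zero)
  finally show ?thesis by simp
qed

lemmas psi_by_parts = by_parts_power[OF cont psi_power_integrable[of 2] psi_integrable mean]
lemmas h_by_parts = by_parts_power[OF h_cont h_sq_integrable h_integrable h_mean]

lemma psi_mult_power: "\<psi> x * \<psi> x ^ k = \<psi> x ^ Suc k" by simp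

lemma alpha_mean: "(\<integral>x. \<alpha> x \<partial>\<nu>) = 1"
  using psi_by_parts[of 0, unfolded psi_mult_power] psi_power_integrable[of 2] kernel_factors_integrable(1) var
  by (simp add: \<alpha>_def[abs_def] u_def numeral_2_eq_2)

lemma eta_mean: "(\<integral>x. \<eta> x \<partial>\<nu>) = m3 / 2"
  using psi_by_parts[of 1, unfolded psi_mult_power] psi_power_integrable[of 3] kernel_factors_integrable(3)
  by (simp add: \<eta>_def[abs_def] u_def m3_def numeral_3_eq_3)

lemma beta_mean: "(\<integral>x. \<beta> x \<partial>\<nu>) = m3"
proof -
  have hp: "h x * \<psi> x = \<psi> x ^ 3 - \<psi> x" for x
    by (simp add: h_def power2_eq_square power3_eq_cube algebra_simps)
  show ?thesis
    using h_by_parts[of 0] psi_power_integrable[of 3] psi_integrable kernel_factors_integrable(2) mean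
    by (simp add: \<beta>_def[abs_def] v_def hp m3_def)
qed

lemma theta_mean: "(\<integral>x. \<theta> x \<partial>\<nu>) = \<delta> / 2"
proof -
  have hp: "h x * (\<psi> x)\<^sup>2 = (h x)\<^sup>2 + h x" for x
    by (simp add: h_def power2_eq_square algebra_simps)
  show ?thesis
    using h_by_parts[of 1] h_sq_integrable h_integrable kernel_factors_integrable(4) h_mean
    by (simp add: \<theta>_def[abs_def] v_def hp \<delta>_def flip: power2_eq_square)
qed

lemma alpha_psi_sq:
  "integrable \<nu> (\<lambda>x. \<alpha> x * (\<psi> x)\<^sup>2)" "(\<integral>x. \<alpha> x * (\<psi> x)\<^sup>2 \<partial>\<nu>) = (\<delta> + 1) / 3"
proof -
  show 1: "integrable \<nu> (\<lambda>x. \<alpha> x * (\<psi> x)\<^sup>2)"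
    by (rule integral_Cauchy_Schwarz(1)) (use alpha_sq psi_power_integrable[of 4] in auto)
  show "(\<integral>x. \<alpha> x * (\<psi> x)\<^sup>2 \<partial>\<nu>) = (\<delta> + 1) / 3"
    using psi_by_parts[of 2, unfolded psi_mult_power] psi_power_integrable[of 4] 1
    by (simp add: \<alpha>_def u_def delta_eq mult.assoc numeral_3_eq_3 eval_nat_numeral)
qed

text \<open>The fourth moment is \<open>3 E[\<alpha> \<psi>\<^sup>2]\<close>, and \<open>\<alpha> \<le> c\<^sup>2\<close>.\<close>

lemma delta_upper: "\<delta> \<le> 3 * c\<^sup>2 - 1"
proof -
  have "(\<integral>x. \<alpha> x * (\<psi> x)\<^sup>2 \<partial>\<nu>) \<le> (\<integral>x. c\<^sup>2 * (\<psi> x)\<^sup>2 \<partial>\<nu>)"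
    by (rule integral_mono[OF alpha_psi_sq(1)])
      (use alpha_bound psi_power_integrable[of 2] in \<open>auto simp: abs_le_iff intro!: mult_right_mono\<close>)
  then show ?thesis using alpha_psi_sq(2) var by simp
qed

lemma alpha_var: "integrable \<nu> (\<lambda>x. (\<alpha> x - 1)\<^sup>2)" "(\<integral>x. (\<alpha> x - 1)\<^sup>2 \<partial>\<nu>) \<le> c\<^sup>2 - 1"
proof -
  interpret prob_space \<nu> by (rule nu_prob)
  have eq: "(\<alpha> x - 1)\<^sup>2 = (\<alpha> x)\<^sup>2 - 2 * \<alpha> x + 1" for x by (simp add: power2_eq_square algebra_simps)
  show "integrable \<nu> (\<lambda>x. (\<alpha> x - 1)\<^sup>2)" unfolding eq using alpha_sq(1) kernel_factors_integrable(1) by simp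
  have "(\<integral>x. (\<alpha> x - 1)\<^sup>2 \<partial>\<nu>) = msq \<alpha> - 1"
    unfolding eq using alpha_sq(1) kernel_factors_integrable(1) alpha_mean prob_space by simp
  then show "(\<integral>x. (\<alpha> x - 1)\<^sup>2 \<partial>\<nu>) \<le> c\<^sup>2 - 1" using alpha_sq(2) by simp
qed

lemma c_ge_1: "c \<ge> 1"
proof -
  have "0 \<le> (\<integral>x. (\<alpha> x - 1)\<^sup>2 \<partial>\<nu>)" by simp
  then have "1 \<le> c\<^sup>2" using alpha_var(2) by linarith
  then show ?thesis using c_nonneg power2_le_imp_le[of 1 c] by simp
qed

lemma delta_nonneg: "0 \<le> \<delta>" unfolding \<delta>_def by simp

text \<open>The covariance of \<open>\<alpha>\<close> and \<open>\<psi>\<^sup>2\<close> is \<open>(\<delta> - 2) / 3\<close>, while Cauchy-Schwarz bounds its square by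
  \<open>(c\<^sup>2 - 1) \<delta>\<close>. Hence \<open>(\<delta> - 2)\<^sup>2 \<le> 9 (c\<^sup>2 - 1) \<delta>\<close>, and dropping \<open>\<delta>\<^sup>2\<close> gives the claim.\<close>

lemma delta_lower: "4 \<le> (9 * c\<^sup>2 - 5) * \<delta>"
proof -
  interpret prob_space \<nu> by (rule nu_prob)
  have eq: "(\<alpha> x - 1) * h x = \<alpha> x * (\<psi> x)\<^sup>2 - \<alpha> x - h x" for x by (simp add: h_def algebra_simps)
  have "(\<integral>x. (\<alpha> x - 1) * h x \<partial>\<nu>) = (\<delta> + 1) / 3 - 1"
    unfolding eq using alpha_psi_sq kernel_factors_integrable(1) h_integrable h_mean alpha_mean by simp
  moreover have "(\<integral>x. (\<alpha> x - 1) * h x \<partial>\<nu>)\<^sup>2 \<le> (\<integral>x. (\<alpha> x - 1)\<^sup>2 \<partial>\<nu>) * \<delta>"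
    unfolding \<delta>_def by (rule integral_Cauchy_Schwarz) (use alpha_var h_sq_integrable in auto)
  moreover have "(\<integral>x. (\<alpha> x - 1)\<^sup>2 \<partial>\<nu>) * \<delta> \<le> (c\<^sup>2 - 1) * \<delta>"
    by (rule mult_right_mono[OF alpha_var(2) delta_nonneg])
  ultimately have "((\<delta> + 1) / 3 - 1)\<^sup>2 \<le> (c\<^sup>2 - 1) * \<delta>" by simp
  then have "(\<delta> - 2)\<^sup>2 \<le> 9 * (c\<^sup>2 - 1) * \<delta>"
    by (simp add: power2_eq_square field_simps)
  then have "4 + 5 * \<delta> + \<delta> * \<delta> \<le> 9 * c\<^sup>2 * \<delta>"
    by (simp add: power2_eq_square algebra_simps)
  then show ?thesis using zero_le_square[of \<delta>] unfolding left_diff_distrib by linarith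
qed

lemma delta_pos: "0 < \<delta>"
  using delta_lower delta_nonneg by (cases "\<delta> = 0") auto

text \<open>The third moment is the covariance of \<open>h\<close> and \<open>\<psi>\<close>.\<close>

lemma m3_sq: "m3\<^sup>2 \<le> \<delta>"
proof -
  have hp: "h x * \<psi> x = \<psi> x ^ 3 - \<psi> x" for x
    by (simp add: h_def power2_eq_square power3_eq_cube algebra_simps)
  have "(\<integral>x. h x * \<psi> x \<partial>\<nu>)\<^sup>2 \<le> msq h * msq \<psi>"
    by (rule integral_Cauchy_Schwarz) (use h_sq_integrable psi_power_integrable[of 2] in auto)
  moreover have "(\<integral>x. h x * \<psi> x \<partial>\<nu>) = m3"
    unfolding hp m3_def using psi_power_integrable[of 3] psi_integrable mean by simp
  ultimately show ?thesis unfolding \<delta>_def var by simp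
qed

end

section \<open>Square-integrable functions on Gaussian space\<close>

abbreviation (input) gauss_space :: "('n::finite \<Rightarrow> real) measure" where
  "gauss_space \<equiv> Pi\<^sub>M UNIV (\<lambda>_. std_normal_distribution)"

lemma gauss_prob: "prob_space (gauss_space :: ('n::finite \<Rightarrow> real) measure)"
  by (rule prob_space_PiM) (rule nu_prob)

lemma gauss_coordinate:
  "f \<in> borel_measurable borel \<Longrightarrow> (\<lambda>x. f (x i)) \<in> borel_measurable (gauss_space :: ('n::finite \<Rightarrow> real) measure)"
  by (rule measurable_compose[OF measurable_component_singleton[of i UNIV "\<lambda>_. \<nu>"]]) auto

text \<open>Membership in \<open>L\<^sup>2\<close>. The products in the Stein identity are integrable by the closure properties below.\<close>

definition sqi :: "'a measure \<Rightarrow> ('a \<Rightarrow> real) \<Rightarrow> bool" where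
  "sqi M f \<longleftrightarrow> f \<in> borel_measurable M \<and> integrable M (\<lambda>x. (f x)\<^sup>2)"

lemma sqi_measurable: "sqi M f \<Longrightarrow> f \<in> borel_measurable M" by (simp add: sqi_def)

lemma sqi_mult_integrable: "sqi M f \<Longrightarrow> sqi M g \<Longrightarrow> integrable M (\<lambda>x. f x * g x)"
  unfolding sqi_def using integral_Cauchy_Schwarz(1)[of f M g] by blast

lemma sqi_const: "prob_space M \<Longrightarrow> sqi M (\<lambda>_. a)"
  unfolding sqi_def using finite_measure.integrable_const[OF prob_space.finite_measure, of M] by simp

lemma sqi_integrable: "prob_space M \<Longrightarrow> sqi M f \<Longrightarrow> integrable M f"
  using sqi_mult_integrable[OF _ sqi_const[of M 1], of f] by simp

lemma sqi_add:
  assumes "sqi M f" "sqi M g"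
  shows "sqi M (\<lambda>x. f x + g x)"
proof -
  have "(f x + g x)\<^sup>2 = (f x)\<^sup>2 + 2 * (f x * g x) + (g x)\<^sup>2" for x
    by (simp add: power2_eq_square algebra_simps)
  then show ?thesis using assms sqi_mult_integrable[OF assms] unfolding sqi_def by auto
qed

lemma sqi_cmult: "sqi M f \<Longrightarrow> sqi M (\<lambda>x. a * f x)"
  unfolding sqi_def by (auto simp: power_mult_distrib)

lemma sqi_sum: "prob_space M \<Longrightarrow> (\<And>i. i \<in> I \<Longrightarrow> sqi M (f i)) \<Longrightarrow> sqi M (\<lambda>x. \<Sum>i\<in>I. f i x)"
  by (induction I rule: infinite_finite_induct) (auto intro: sqi_add sqi_const)

lemma sqi_bound:
  assumes "sqi M g" "f \<in> borel_measurable M" "\<And>x. \<bar>f x\<bar> \<le> \<bar>g x\<bar>"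
  shows "sqi M f"
proof -
  have "integrable M (\<lambda>x. (f x)\<^sup>2)"
    by (rule Bochner_Integration.integrable_bound[of M "\<lambda>x. (g x)\<^sup>2"])
      (use assms in \<open>auto simp: sqi_def abs_le_square_iff[symmetric]\<close>)
  then show ?thesis using assms by (simp add: sqi_def)
qed

lemma sqi_abs: "sqi M f \<Longrightarrow> sqi M (\<lambda>x. \<bar>f x\<bar>)"
  unfolding sqi_def by auto

lemma sqi_prod:
  assumes F: "\<And>l. sqi \<nu> (F l)"
  shows "sqi (gauss_space :: ('n::finite \<Rightarrow> real) measure) (\<lambda>x. \<Prod>l\<in>UNIV. F l (x l))"
proof -
  interpret product_sigma_finite "\<lambda>_::'n. \<nu>" by (rule nu_product)
  have "integrable gauss_space (\<lambda>x. \<Prod>l\<in>(UNIV::'n set). (F l (x l))\<^sup>2)"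
    by (rule product_integrable_prod[of UNIV "\<lambda>l y. (F l y)\<^sup>2"]) (use F in \<open>auto simp: sqi_def\<close>)
  moreover have [measurable]: "F l \<in> borel_measurable borel" for l using F[of l] by (simp add: sqi_def)
  ultimately show ?thesis
    unfolding sqi_def by (auto simp: prod_power_distrib[symmetric])
qed

lemma sqi_coord:
  assumes "sqi \<nu> f" shows "sqi (gauss_space :: ('n::finite \<Rightarrow> real) measure) (\<lambda>x. f (x i))"
proof -
  have "sqi (gauss_space :: ('n \<Rightarrow> real) measure) (\<lambda>x. \<Prod>l\<in>UNIV. (if l = i then f else (\<lambda>_. 1)) (x l))"
    by (rule sqi_prod) (use assms sqi_const[OF nu_prob] in auto)
  then show ?thesis by (simp add: if_distrib[of "\<lambda>f. f _"] cong: if_cong)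
qed

text \<open>The coordinates \<open>j\<close> and \<open>m\<close> may coincide, which is why \<open>g k\<close> itself has to be square integrable.\<close>

lemma sqi_coord3:
  assumes f: "sqi \<nu> f" and g: "sqi \<nu> g" and k: "sqi \<nu> k" and gk: "sqi \<nu> (\<lambda>y. g y * k y)"
    and ij: "i \<noteq> j" "i \<noteq> m"
  shows "sqi (gauss_space :: ('n::finite \<Rightarrow> real) measure) (\<lambda>x. f (x i) * (g (x j) * k (x m)))"
proof -
  have "sqi (gauss_space :: ('n \<Rightarrow> real) measure) (\<lambda>x. \<Prod>l\<in>UNIV. (\<lambda>y. (if l = i then f y else 1) *
      ((if l = j then g y else 1) * (if l = m then k y else 1))) (x l))"
  proof (rule sqi_prod)
    fix l
    show "sqi \<nu> (\<lambda>y. (if l = i then f y else 1) *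
        ((if l = j then g y else 1) * (if l = m then k y else 1)))"
      by (cases "l = i"; cases "l = j"; cases "l = m") (use assms sqi_const[OF nu_prob] in auto)
  qed
  then show ?thesis by (simp add: prod.distrib)
qed

lemma gauss_fubini:
  fixes i :: "'n::finite" and f :: "('n \<Rightarrow> real) \<Rightarrow> real"
  assumes "integrable gauss_space f"
  shows "integral\<^sup>L gauss_space f = (\<integral>x. (\<integral>y. f (x(i := y)) \<partial>\<nu>) \<partial>(Pi\<^sub>M (UNIV - {i}) (\<lambda>_. \<nu>)))"
proof -
  interpret product_sigma_finite "\<lambda>_::'n. \<nu>" by (rule nu_product)
  have "insert i (UNIV - {i}) = UNIV" by auto
  then show ?thesis
    using product_integral_insert[of "UNIV - {i}" i f] assms by simp
qed

section \<open>Quadratic forms\<close>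

text \<open>The vector \<open>q\<close> is the diagonal and \<open>B\<close> the off-diagonal part of the matrix. They are kept apart
  because the diagonal terms carry the small factors \<open>\<delta>\<^sub>i\<close>, the off-diagonal ones do not.\<close>

locale gauss_quadratic =
  fixes \<psi> \<psi>' :: "'n::finite \<Rightarrow> real \<Rightarrow> real" and c :: real and q :: "'n \<Rightarrow> real" and B :: "'n \<Rightarrow> 'n \<Rightarrow> real"
  assumes lipschitz: "\<And>i. lipschitz_gauss (\<psi> i) (\<psi>' i) c"
    and sym: "\<And>i j. B i j = B j i" and diag: "\<And>i. B i i = 0"
begin

sublocale L: lipschitz_gauss "\<psi> i" "\<psi>' i" c for i by (rule lipschitz)

abbreviation "P \<equiv> (Pi\<^sub>M UNIV (\<lambda>_. std_normal_distribution) :: ('n \<Rightarrow> real) measure)"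

definition A :: "'n \<Rightarrow> ('n \<Rightarrow> real) \<Rightarrow> real" where "A i x = (\<Sum>j\<in>UNIV. B i j * \<psi> j (x j))"

definition W :: "('n \<Rightarrow> real) \<Rightarrow> real" where
  "W x = (\<Sum>i\<in>UNIV. q i * L.h i (x i) + A i x * \<psi> i (x i))"

text \<open>The Stein kernel of \<open>W\<close>: the last factor is the derivative of \<open>W\<close> in the \<open>i\<close>-th coordinate, and
  the first one is \<open>gstein\<close> applied in this coordinate to the \<open>i\<close>-th summand of \<open>W\<close>.\<close>

definition T :: "('n \<Rightarrow> real) \<Rightarrow> real" where
  "T x = (\<Sum>i\<in>UNIV. (q i * L.v i (x i) + A i x * L.u i (x i)) * (2 * \<psi>' i (x i) * (q i * \<psi> i (x i) + A i x)))"

text \<open>The part of \<open>W\<close> that is free of coordinate \<open>i\<close>, see \<open>W_split\<close>.\<close>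

definition rest :: "'n \<Rightarrow> ('n \<Rightarrow> real) \<Rightarrow> real" where
  "rest i x = (\<Sum>j\<in>UNIV - {i}. q j * L.h j (x j)) +
     (\<Sum>j\<in>UNIV - {i}. \<Sum>k\<in>UNIV - {i}. B j k * \<psi> k (x k) * \<psi> j (x j))"

lemma rest_upd: "rest i (x(i := y)) = rest i x"
  unfolding rest_def by (intro arg_cong2[of _ _ _ _ "(+)"] sum.cong refl) auto

lemma A_upd: "A i (x(i := y)) = A i x"
  unfolding A_def by (intro sum.cong refl) (auto simp: diag)

lemma W_split: "W x = q i * L.h i (x i) + 2 * A i x * \<psi> i (x i) + rest i x"
proof -
  let ?z = "\<lambda>k. \<psi> k (x k)"
  have d: "(\<Sum>k\<in>UNIV. f k) = f i + (\<Sum>k\<in>UNIV - {i}. f k)" for f :: "'n \<Rightarrow> real"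
    by (rule sum.remove) auto
  have "W x = (\<Sum>j\<in>UNIV. q j * L.h j (x j)) + (\<Sum>j\<in>UNIV. \<Sum>k\<in>UNIV. B j k * ?z k * ?z j)"
    by (simp add: W_def A_def sum.distrib sum_distrib_right)
  also have "(\<Sum>j\<in>UNIV. \<Sum>k\<in>UNIV. B j k * ?z k * ?z j)
      = (\<Sum>k\<in>UNIV. B i k * ?z k * ?z i) + (\<Sum>j\<in>UNIV - {i}. B j i * ?z i * ?z j
        + (\<Sum>k\<in>UNIV - {i}. B j k * ?z k * ?z j))"
    by (subst d) (simp add: d[of "\<lambda>k. B _ k * ?z k * ?z _"])
  also have "\<dots> = (\<Sum>k\<in>UNIV. B i k * ?z k * ?z i) + (\<Sum>j\<in>UNIV - {i}. B i j * ?z j * ?z i)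
        + (\<Sum>j\<in>UNIV - {i}. \<Sum>k\<in>UNIV - {i}. B j k * ?z k * ?z j)"
    unfolding sum.distrib by (simp add: sym[of _ i] mult_ac)
  also have "(\<Sum>j\<in>UNIV - {i}. B i j * ?z j * ?z i) = (\<Sum>k\<in>UNIV. B i k * ?z k * ?z i)"
    using d[of "\<lambda>j. B i j * ?z j * ?z i"] by (simp add: diag)
  also have "(\<Sum>k\<in>UNIV. B i k * ?z k * ?z i) = A i x * ?z i" by (simp add: A_def sum_distrib_right)
  finally show ?thesis using d[of "\<lambda>j. q j * L.h j (x j)"] by (simp add: rest_def)
qed

lemma sqi_1d:
  "sqi \<nu> (L.h i)" "sqi \<nu> (\<psi> i)" "sqi \<nu> (\<lambda>y. \<psi> i y * \<psi> i y)" "sqi \<nu> (L.\<alpha> i)" "sqi \<nu> (L.\<beta> i)"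
  "sqi \<nu> (L.\<eta> i)" "sqi \<nu> (L.\<theta> i)" "sqi \<nu> (L.u i)" "sqi \<nu> (L.v i)"
proof -
  have "(\<lambda>y. (\<psi> i y * \<psi> i y)\<^sup>2) = (\<lambda>y. \<psi> i y ^ 4)" by (simp add: power2_eq_square power4_eq_xxxx mult.assoc)
  then show "sqi \<nu> (\<lambda>y. \<psi> i y * \<psi> i y)" using L.psi_power_integrable[of i 4] by (simp add: sqi_def)
qed (auto simp: sqi_def L.h_sq_integrable L.psi_power_integrable L.alpha_sq L.beta_sq L.eta_sq
    L.theta_sq L.u_def L.v_def L.psi_gstein(1) L.h_gstein(1) L.u_measurable[unfolded L.u_def]
    L.v_measurable[unfolded L.v_def])

lemma sqi_A_mult:
  assumes f: "sqi \<nu> f"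
  shows "sqi P (\<lambda>x. A i x * f (x i))"
proof -
  have "sqi P (\<lambda>x. \<Sum>j\<in>UNIV. B i j * (f (x i) * (\<psi> j (x j) * 1)))"
  proof (rule sqi_sum[OF gauss_prob])
    fix j
    show "sqi P (\<lambda>x. B i j * (f (x i) * (\<psi> j (x j) * 1)))"
    proof (cases "i = j")
      case False
      show ?thesis
        by (rule sqi_cmult, rule sqi_coord3[of f "\<psi> j" "\<lambda>_. 1"])
          (use f sqi_1d sqi_const[OF nu_prob] False in auto)
    qed (simp add: diag sqi_const[OF gauss_prob])
  qed
  then show ?thesis by (simp add: A_def sum_distrib_left sum_distrib_right mult_ac)
qed

lemma sqi_A2_mult:
  assumes f: "sqi \<nu> f"
  shows "sqi P (\<lambda>x. A i x * A i x * f (x i))"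
proof -
  have "sqi P (\<lambda>x. \<Sum>j\<in>UNIV. \<Sum>k\<in>UNIV. (B i j * B i k) * (f (x i) * (\<psi> j (x j) * \<psi> k (x k))))"
  proof (intro sqi_sum[OF gauss_prob])
    fix j k
    show "sqi P (\<lambda>x. (B i j * B i k) * (f (x i) * (\<psi> j (x j) * \<psi> k (x k))))"
    proof (cases "i = j \<or> i = k")
      case False
      show ?thesis
      proof (cases "j = k")
        case True
        have "sqi P (\<lambda>x. (B i j * B i k) * (f (x i) * ((\<lambda>y. \<psi> j y * \<psi> j y) (x j) * (\<lambda>_. 1) (x j))))"
          by (rule sqi_cmult, rule sqi_coord3)
            (use f sqi_1d sqi_const[OF nu_prob] False in auto)
        then show ?thesis using True by simp
      next
        case jk: False
        have "sqi P (\<lambda>x. \<Prod>l\<in>UNIV. (\<lambda>y. (if l = i then f y else 1) *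
            ((if l = j then \<psi> j y else 1) * (if l = k then \<psi> k y else 1))) (x l))"
        proof (rule sqi_prod)
          fix l
          show "sqi \<nu> (\<lambda>y. (if l = i then f y else 1) *
              ((if l = j then \<psi> j y else 1) * (if l = k then \<psi> k y else 1)))"
            by (cases "l = i"; cases "l = j"; cases "l = k")
              (use f sqi_1d(2) sqi_const[OF nu_prob] False jk in auto)
        qed
        then show ?thesis by (intro sqi_cmult) (simp add: prod.distrib)
      qed
    qed (auto simp: diag sqi_const[OF gauss_prob])
  qed
  moreover have "A i x * A i x * f (x i)
      = (\<Sum>j\<in>UNIV. \<Sum>k\<in>UNIV. (B i j * B i k) * (f (x i) * (\<psi> j (x j) * \<psi> k (x k))))" for x
  proof -
    have "A i x * A i x = (\<Sum>j\<in>UNIV. \<Sum>k\<in>UNIV. B i j * \<psi> j (x j) * (B i k * \<psi> k (x k)))"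
      unfolding A_def sum_product ..
    then show ?thesis by (simp add: sum_distrib_right sum_distrib_left mult_ac)
  qed
  ultimately show ?thesis by simp
qed

lemma sqi_W: "sqi P W"
  unfolding W_def[abs_def]
  by (intro sqi_sum[OF gauss_prob] sqi_add sqi_cmult sqi_A_mult sqi_coord sqi_1d)

lemma A_measurable[measurable]: "A i \<in> borel_measurable P"
  unfolding A_def[abs_def] using L.psi_measurable by measurable

lemma W_measurable[measurable]: "W \<in> borel_measurable P"
  using sqi_W by (rule sqi_measurable)

text \<open>
  For fixed other coordinates \<open>W\<close> is a quadratic polynomial in \<open>\<psi>\<^sub>i\<close>, so \<open>\<phi>(W)\<close> has at most quadratic
  growth in coordinate \<open>i\<close> and the one-dimensional formula applies for every value of the others.
\<close>

lemma coordinate_by_parts: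
  assumes a: "continuous_on UNIV a" "sqi \<nu> a" "(\<integral>y. a y \<partial>\<nu>) = 0"
    and m: "\<And>x y. m (x(i := y)) = m x"
    and \<phi>: "\<And>w. (\<phi> has_real_derivative \<phi>' w) (at w)" "continuous_on UNIV \<phi>'" "\<And>w. \<bar>\<phi>' w\<bar> \<le> C"
    and int1: "integrable P (\<lambda>x. m x * a (x i) * \<phi> (W x))"
    and int2: "integrable P (\<lambda>x. m x * gstein a (x i) * (2 * \<psi>' i (x i) * (q i * \<psi> i (x i) + A i x)) * \<phi>' (W x))"
  shows "(\<integral>x. m x * a (x i) * \<phi> (W x) \<partial>P)
    = (\<integral>x. m x * gstein a (x i) * (2 * \<psi>' i (x i) * (q i * \<psi> i (x i) + A i x)) * \<phi>' (W x) \<partial>P)"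
proof -
  have C: "0 \<le> C" using \<phi>(3)[of 0] by linarith
  have ai: "integrable \<nu> a" using a(2) by (rule sqi_integrable[OF nu_prob])
  have growth\<phi>: "\<bar>\<phi> w\<bar> \<le> \<bar>\<phi> 0\<bar> + C * \<bar>w\<bar>" for w
    using field_differentiable_bound[of UNIV \<phi> \<phi>' C w 0] \<phi>(1,3)
    by (auto simp: has_field_derivative_at_within)
  have inner: "(\<integral>y. a y * \<phi> (W (x(i := y))) \<partial>\<nu>)
      = (\<integral>y. gstein a y * (\<phi>' (W (x(i := y))) * (2 * \<psi>' i y * (q i * \<psi> i y + A i x))) \<partial>\<nu>)" for x
  proof -
    define b r where "b = A i x" and "r = rest i x"
    have Wy: "W (x(i := y)) = q i * L.h i y + 2 * b * \<psi> i y + r" for y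
      by (simp add: W_split[of _ i] A_upd rest_upd b_def r_def)
    let ?F = "\<lambda>y. q i * L.h i y + 2 * b * \<psi> i y + r"
    have F': "(?F has_real_derivative 2 * \<psi>' i y * (q i * \<psi> i y + b)) (at y)" for y
      unfolding L.h_def by (rule derivative_eq_intros L.deriv refl)+ (simp add: algebra_simps)
    have Fc: "continuous_on S ?F" for S by (intro continuous_intros L.h_cont L.cont)
    \<comment> \<open>The factor 2 in front of \<open>q i\<close> covers the constant in \<open>h = \<psi>\<^sup>2 - 1\<close>.\<close>
    define K where "K = (\<bar>\<phi> 0\<bar> + C * (2 * \<bar>q i\<bar> + 2 * \<bar>b\<bar> + \<bar>r\<bar>)) * (c + 1) ^ 3"
    have kgrowth: "\<bar>\<phi> (?F y)\<bar> \<le> K * (1 + \<bar>y\<bar>) ^ 3" for y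
    proof -
      let ?p = "(c + 1) ^ 3 * (1 + \<bar>y\<bar>) ^ 3"
      have p0: "1 \<le> ?p" using L.psi_power_growth[of 0 i y] by simp
      have p1: "\<bar>\<psi> i y\<bar> \<le> ?p" using L.psi_power_growth[of 1 i y] by simp
      have p2: "\<bar>L.h i y\<bar> \<le> 2 * ?p"
      proof -
        have "(\<psi> i y)\<^sup>2 \<le> ?p" using L.psi_power_growth[of 2 i y] by simp
        then show ?thesis unfolding L.h_def using p0 zero_le_power2[of "\<psi> i y"]
          by (intro abs_leI) linarith+
      qed
      have "\<bar>?F y\<bar> \<le> \<bar>q i * L.h i y\<bar> + \<bar>2 * b * \<psi> i y\<bar> + \<bar>r\<bar> * 1"
        by linarith
      also have "\<dots> \<le> \<bar>q i\<bar> * (2 * ?p) + 2 * \<bar>b\<bar> * ?p + \<bar>r\<bar> * ?p"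
        unfolding abs_mult abs_numeral by (intro add_mono mult_left_mono p0 p1 p2) auto
      also have "\<dots> = (2 * \<bar>q i\<bar> + 2 * \<bar>b\<bar> + \<bar>r\<bar>) * ?p" by (simp add: algebra_simps)
      finally have "\<bar>\<phi> (?F y)\<bar> \<le> \<bar>\<phi> 0\<bar> * ?p + C * ((2 * \<bar>q i\<bar> + 2 * \<bar>b\<bar> + \<bar>r\<bar>) * ?p)"
        by (intro order_trans[OF growth\<phi>] add_mono mult_left_mono C) (use mult_left_mono[OF p0, of "\<bar>\<phi> 0\<bar>"] in simp)
      also have "\<dots> = K * (1 + \<bar>y\<bar>) ^ 3" by (simp add: K_def algebra_simps)
      finally show ?thesis .
    qed
    have kc: "continuous_on UNIV (\<lambda>y. \<phi> (?F y))"
    proof (rule continuous_on_compose2[of UNIV \<phi>, OF _ Fc])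
      show "continuous_on UNIV \<phi>" using \<phi>(1) by (meson DERIV_isCont continuous_at_imp_continuous_on)
    qed auto
    have k'c: "continuous_on UNIV (\<lambda>y. \<phi>' (?F y) * (2 * \<psi>' i y * (q i * \<psi> i y + b)))"
      by (intro continuous_intros continuous_on_compose2[OF \<phi>(2) Fc] L.cont L.cont') auto
    have sk: "sqi \<nu> (\<lambda>y. \<phi> (?F y))"
    proof -
      have "integrable \<nu> (\<lambda>y. (\<phi> (?F y))\<^sup>2)"
      proof (rule nu_poly[of _ "K\<^sup>2" 6])
        show "\<bar>(\<phi> (?F y))\<^sup>2\<bar> \<le> K\<^sup>2 * (1 + \<bar>y\<bar>) ^ 6" for y
          using power_mono[OF kgrowth[of y], of 2] by (simp add: power_mult_distrib flip: power_mult)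
      qed (use kc in \<open>auto intro!: borel_measurable_continuous_onI continuous_intros\<close>)
      then show ?thesis unfolding sqi_def using borel_measurable_continuous_onI[OF kc] by auto
    qed
    have sg: "sqi \<nu> (gstein a)"
      unfolding sqi_def using gstein_measurable[OF a(1) ai] L.gstein_second_moments(1)[OF a(1) _ ai a(3)] a(2)
      by (auto simp: sqi_def)
    have sk': "sqi \<nu> (\<lambda>y. \<phi>' (?F y) * (2 * \<psi>' i y * (q i * \<psi> i y + b)))"
    proof (rule sqi_bound)
      show "sqi \<nu> (\<lambda>y. (2 * C * c) * (q i * \<psi> i y + b))"
        by (intro sqi_cmult sqi_add sqi_1d sqi_const nu_prob)
      show "\<bar>\<phi>' (?F y) * (2 * \<psi>' i y * (q i * \<psi> i y + b))\<bar> \<le> \<bar>(2 * C * c) * (q i * \<psi> i y + b)\<bar>" for y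
      proof -
        define X where "X = q i * \<psi> i y + b"
        have "\<bar>\<phi>' (?F y) * (2 * \<psi>' i y * X)\<bar> = \<bar>\<phi>' (?F y)\<bar> * (2 * \<bar>\<psi>' i y\<bar> * \<bar>X\<bar>)"
          by (simp add: abs_mult)
        also have "\<dots> \<le> C * (2 * c * \<bar>X\<bar>)"
          by (intro mult_mono \<phi>(3) L.bnd C) (auto simp: L.c_nonneg)
        also have "\<dots> = \<bar>(2 * C * c) * X\<bar>" using C L.c_nonneg by (simp add: abs_mult)
        finally show ?thesis unfolding X_def .
      qed
    qed (use borel_measurable_continuous_onI[OF k'c] in auto)
    have "(\<integral>y. a y * \<phi> (?F y) \<partial>\<nu>) = (\<integral>y. gstein a y * (\<phi>' (?F y) * (2 * \<psi>' i y * (q i * \<psi> i y + b))) \<partial>\<nu>)"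
    proof (rule gstein_by_parts[OF a(1) _ ai a(3) _ k'c kgrowth])
      show "((\<lambda>y. \<phi> (?F y)) has_real_derivative \<phi>' (?F y) * (2 * \<psi>' i y * (q i * \<psi> i y + b))) (at y)" for y
        by (rule DERIV_chain2[OF \<phi>(1) F'])
    qed (use a(2) sqi_mult_integrable[OF a(2) sk] sqi_mult_integrable[OF sg sk'] in \<open>auto simp: sqi_def\<close>)
    then show ?thesis unfolding Wy b_def[symmetric] .
  qed
  have "(\<integral>x. m x * a (x i) * \<phi> (W x) \<partial>P)
      = (\<integral>x. (\<integral>y. m x * (a y * \<phi> (W (x(i := y)))) \<partial>\<nu>) \<partial>(Pi\<^sub>M (UNIV - {i}) (\<lambda>_. \<nu>)))"
    by (subst gauss_fubini[OF int1, of i]) (simp add: m mult.assoc)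
  also have "\<dots> = (\<integral>x. (\<integral>y. m x * (gstein a y * (\<phi>' (W (x(i := y))) * (2 * \<psi>' i y * (q i * \<psi> i y + A i x)))) \<partial>\<nu>)
      \<partial>(Pi\<^sub>M (UNIV - {i}) (\<lambda>_. \<nu>)))"
    unfolding Bochner_Integration.integral_mult_right_zero inner ..
  also have "\<dots> = (\<integral>x. m x * gstein a (x i) * (2 * \<psi>' i (x i) * (q i * \<psi> i (x i) + A i x)) * \<phi>' (W x) \<partial>P)"
    by (subst gauss_fubini[OF int2, of i]) (simp add: m A_upd mult_ac)
  finally show ?thesis .
qed

lemma T_summand:
  "q i * L.v i (x i) * (2 * \<psi>' i (x i) * (q i * \<psi> i (x i) + A i x))
     = 2 * (q i)\<^sup>2 * L.\<theta> i (x i) + 2 * q i * (A i x * L.\<beta> i (x i))"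
  "A i x * L.u i (x i) * (2 * \<psi>' i (x i) * (q i * \<psi> i (x i) + A i x))
     = 2 * q i * (A i x * L.\<eta> i (x i)) + 2 * (A i x * A i x * L.\<alpha> i (x i))"
  by (simp_all add: L.\<theta>_def L.\<beta>_def L.\<eta>_def L.\<alpha>_def power2_eq_square algebra_simps)

lemma sqi_T_summand:
  "sqi P (\<lambda>x. q i * L.v i (x i) * (2 * \<psi>' i (x i) * (q i * \<psi> i (x i) + A i x)))"
  "sqi P (\<lambda>x. A i x * L.u i (x i) * (2 * \<psi>' i (x i) * (q i * \<psi> i (x i) + A i x)))"
  unfolding T_summand by (intro sqi_add sqi_cmult sqi_A_mult sqi_A2_mult sqi_coord sqi_1d)+

lemma sqi_T: "sqi P T"
  unfolding T_def[abs_def] distrib_right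
  by (intro sqi_sum[OF gauss_prob] sqi_add sqi_T_summand)

text \<open>Each summand of \<open>W\<close> is a centred function of its own coordinate times a factor free of it.
  Bounded \<open>\<phi>'\<close> suffices, so \<open>\<phi>(w) = w\<close> is allowed and identifies the mean of \<open>T\<close> with the
  variance of \<open>W\<close>.\<close>

lemma stein_identity:
  assumes \<phi>: "\<And>w. (\<phi> has_real_derivative \<phi>' w) (at w)" "continuous_on UNIV \<phi>'" "\<And>w. \<bar>\<phi>' w\<bar> \<le> C"
  shows "(\<integral>x. W x * \<phi> (W x) \<partial>P) = (\<integral>x. T x * \<phi>' (W x) \<partial>P)"
    and "integrable P (\<lambda>x. W x * \<phi> (W x))" and "integrable P (\<lambda>x. T x * \<phi>' (W x))"
proof -
  have C: "0 \<le> C" using \<phi>(3)[of 0] by linarith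
  have \<phi>c: "continuous_on UNIV \<phi>" using \<phi>(1) by (meson DERIV_isCont continuous_at_imp_continuous_on)
  have [measurable]: "\<phi> \<in> borel_measurable borel" "\<phi>' \<in> borel_measurable borel"
    using \<phi>c \<phi>(2) by (auto intro: borel_measurable_continuous_onI)
  have growth\<phi>: "\<bar>\<phi> w\<bar> \<le> \<bar>\<phi> 0\<bar> + C * \<bar>w\<bar>" for w
    using field_differentiable_bound[of UNIV \<phi> \<phi>' C w 0] \<phi>(1,3)
    by (auto simp: has_field_derivative_at_within)
  have s\<phi>: "sqi P (\<lambda>x. \<phi> (W x))"
  proof (rule sqi_bound)
    show "sqi P (\<lambda>x. \<bar>\<phi> 0\<bar> + C * \<bar>W x\<bar>)"
      by (intro sqi_add sqi_cmult sqi_abs sqi_W sqi_const gauss_prob)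
  qed (use growth\<phi> C in \<open>auto intro!: order_trans[OF growth\<phi>]\<close>)
  have s\<phi>': "sqi P (\<lambda>x. \<phi>' (W x))"
    by (rule sqi_bound[OF sqi_const[OF gauss_prob, of C]]) (use \<phi>(3) C in auto)
  show i1: "integrable P (\<lambda>x. W x * \<phi> (W x))" by (rule sqi_mult_integrable[OF sqi_W s\<phi>])
  show i2: "integrable P (\<lambda>x. T x * \<phi>' (W x))" by (rule sqi_mult_integrable[OF sqi_T s\<phi>'])
  have ih: "integrable P (\<lambda>x. q i * L.h i (x i) * \<phi> (W x))"
    and ip: "integrable P (\<lambda>x. A i x * \<psi> i (x i) * \<phi> (W x))" for i
    by (intro sqi_mult_integrable s\<phi> sqi_cmult sqi_A_mult sqi_coord sqi_1d)+
  let ?d = "\<lambda>i x. 2 * \<psi>' i (x i) * (q i * \<psi> i (x i) + A i x)"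
  have iv: "integrable P (\<lambda>x. q i * L.v i (x i) * ?d i x * \<phi>' (W x))"
    and iu: "integrable P (\<lambda>x. A i x * L.u i (x i) * ?d i x * \<phi>' (W x))" for i
    by (intro sqi_mult_integrable s\<phi>' sqi_T_summand)+
  have h: "(\<integral>x. q i * L.h i (x i) * \<phi> (W x) \<partial>P) = (\<integral>x. q i * L.v i (x i) * ?d i x * \<phi>' (W x) \<partial>P)" for i
    using coordinate_by_parts[OF L.h_cont sqi_1d(1) L.h_mean _ \<phi> ih] iv unfolding L.v_def by blast
  have p: "(\<integral>x. A i x * \<psi> i (x i) * \<phi> (W x) \<partial>P) = (\<integral>x. A i x * L.u i (x i) * ?d i x * \<phi>' (W x) \<partial>P)" for i
    using coordinate_by_parts[OF L.cont sqi_1d(2) L.mean A_upd \<phi> ip] iu unfolding L.u_def by blast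
  have "(\<integral>x. W x * \<phi> (W x) \<partial>P)
      = (\<Sum>i\<in>UNIV. (\<integral>x. q i * L.h i (x i) * \<phi> (W x) \<partial>P) + (\<integral>x. A i x * \<psi> i (x i) * \<phi> (W x) \<partial>P))"
    using ih ip by (subst W_def) (simp add: sum_distrib_right distrib_right)
  also have "\<dots> = (\<integral>x. T x * \<phi>' (W x) \<partial>P)"
    unfolding h p T_def using iv iu by (simp add: sum_distrib_right distrib_right)
  finally show "(\<integral>x. W x * \<phi> (W x) \<partial>P) = (\<integral>x. T x * \<phi>' (W x) \<partial>P)" .
qed

end

section \<open>The variance of the Stein kernel\<close>

lemma prod_one:
  fixes g :: "'n::finite \<Rightarrow> real"
  assumes "\<And>l. l \<noteq> i \<Longrightarrow> g l = 1" shows "(\<Prod>l\<in>UNIV. g l) = g i"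
proof -
  have "(\<Prod>l\<in>UNIV. g l) = (\<Prod>l\<in>{i}. g l)" by (rule prod.mono_neutral_right) (use assms in auto)
  then show ?thesis by simp
qed

lemma prod_two:
  fixes g :: "'n::finite \<Rightarrow> real"
  assumes "i \<noteq> j" "\<And>l. l \<noteq> i \<Longrightarrow> l \<noteq> j \<Longrightarrow> g l = 1" shows "(\<Prod>l\<in>UNIV. g l) = g i * g j"
proof -
  have "(\<Prod>l\<in>UNIV. g l) = (\<Prod>l\<in>{i, j}. g l)" by (rule prod.mono_neutral_right) (use assms in auto)
  then show ?thesis using assms(1) by simp
qed

lemma prod_three:
  fixes g :: "'n::finite \<Rightarrow> real"
  assumes "i \<noteq> j" "i \<noteq> k" "j \<noteq> k" "\<And>l. l \<noteq> i \<Longrightarrow> l \<noteq> j \<Longrightarrow> l \<noteq> k \<Longrightarrow> g l = 1"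
  shows "(\<Prod>l\<in>UNIV. g l) = g i * g j * g k"
proof -
  have "(\<Prod>l\<in>UNIV. g l) = (\<Prod>l\<in>{i, j, k}. g l)" by (rule prod.mono_neutral_right) (use assms in auto)
  then show ?thesis using assms(1-3) by (simp add: mult.assoc)
qed

text \<open>Index set of the orthogonal expansion of \<open>T\<close>. The number is a kind of term (see \<open>coef\<close>); the three
  coordinates are equal for the kinds 0 to 3, of the form \<open>(i, j, j)\<close> with \<open>i \<noteq> j\<close> for the kinds 4 to 7,
  and distinct for the kind 8.\<close>

type_synonym 'n idx = "nat \<times> 'n \<times> 'n \<times> 'n"

definition idx1 :: "'n idx set" where "idx1 = (\<lambda>(n, i). (n, i, i, i)) ` ({..<4} \<times> UNIV)"
definition idx2 :: "'n idx set" where "idx2 = (\<lambda>(n, i, j). (n, i, j, j)) ` ({4..<8} \<times> {(i, j). i \<noteq> j})"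
definition idx3 :: "'n idx set" where "idx3 = (\<lambda>(i, j, k). (8, i, j, k)) ` {(i, j, k). i \<noteq> j \<and> i \<noteq> k \<and> j \<noteq> k}"

definition supp :: "'n idx \<Rightarrow> 'n set" where "supp t = (case t of (n, i, j, k) \<Rightarrow> {i, j, k})"

text \<open>A singleton is the coordinate set of one term of each of four kinds, a pair of two orderings for
  each of four kinds, and a triple of its six orderings.\<close>

definition mult_bound :: "'n idx \<Rightarrow> nat" where
  "mult_bound t = (if fst t < 4 then 4 else if fst t < 8 then 8 else 6)"

lemma finite_idx: "finite (idx1 \<union> idx2 \<union> idx3 :: 'n::finite idx set)"
  unfolding idx1_def idx2_def idx3_def by auto

lemma card_supp_class:
  fixes t :: "'n::finite idx"
  assumes t: "t \<in> idx1 \<union> idx2 \<union> idx3"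
  shows "card {t' \<in> idx1 \<union> idx2 \<union> idx3. supp t' = supp t} \<le> mult_bound t"
proof -
  consider n i where "t = (n, i, i, i)" "n < 4" | n i j where "t = (n, i, j, j)" "4 \<le> n" "n < 8" "i \<noteq> j"
    | i j k where "t = (8, i, j, k)" "i \<noteq> j" "i \<noteq> k" "j \<noteq> k"
    using t unfolding idx1_def idx2_def idx3_def by auto
  then show ?thesis
  proof cases
    case 1
    have "{t' \<in> idx1 \<union> idx2 \<union> idx3. supp t' = supp t} \<subseteq> (\<lambda>n. (n, i, i, i)) ` {..<4}"
      unfolding idx1_def idx2_def idx3_def supp_def 1(1) by auto
    from card_mono[OF _ this] have "card {t' \<in> idx1 \<union> idx2 \<union> idx3. supp t' = supp t} \<le> card {..<4::nat}"
      using card_image_le[of "{..<4::nat}" "\<lambda>n. (n, i, i, i)"] by (meson finite_imageI finite_lessThan le_trans)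
    then show ?thesis using 1 by (simp add: mult_bound_def)
  next
    case 2
    let ?U = "(\<lambda>(n, a, b). (n, a, b, b)) ` ({4..<8::nat} \<times> {(i, j), (j, i)})"
    have "{t' \<in> idx1 \<union> idx2 \<union> idx3. supp t' = supp t} \<subseteq> ?U"
    proof
      fix t' assume "t' \<in> {t' \<in> idx1 \<union> idx2 \<union> idx3. supp t' = supp t}"
      then have t': "t' \<in> idx1 \<union> idx2 \<union> idx3" "supp t' = {i, j}" unfolding 2(1) by (auto simp: supp_def)
      obtain n' a b d where eq: "t' = (n', a, b, d)" by (cases t')
      have abd: "{a, b, d} = {i, j}" using t'(2) by (simp add: eq supp_def)
      have mem: "a \<in> {i, j}" "b \<in> {i, j}" "d \<in> {i, j}" using abd by auto
      have c2: "card {a, b, d} = 2" unfolding abd using 2(4) by simp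
      have "a \<noteq> b \<and> b = d \<and> n' \<in> {4..<8}"
      proof -
        consider "t' \<in> idx1" | "t' \<in> idx2" | "t' \<in> idx3" using t'(1) by auto
        then show ?thesis
        proof cases
          case 1
          then have "a = b" "b = d" unfolding eq idx1_def by auto
          then show ?thesis using c2 by simp
        next
          case 2
          then show ?thesis unfolding eq idx2_def by auto
        next
          case 3
          then have "a \<noteq> b" "a \<noteq> d" "b \<noteq> d" unfolding eq idx3_def by auto
          then show ?thesis using c2 by simp
        qed
      qed
      then show "t' \<in> ?U"
        using mem unfolding eq by (intro image_eqI[where x = "(n', a, b)"]) auto
    qed
    then have "card {t' \<in> idx1 \<union> idx2 \<union> idx3. supp t' = supp t} \<le> card ?U" by (rule card_mono[rotated]) simp
    also have "\<dots> \<le> card ({4..<8::nat} \<times> {(i, j), (j, i)})" by (rule card_image_le) simp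
    also have "\<dots> = 8" using 2(4) by (simp add: card_cartesian_product)
    finally show ?thesis using 2 by (simp add: mult_bound_def)
  next
    case 3
    let ?U = "{(8::nat, i, j, k), (8, i, k, j), (8, j, i, k), (8, j, k, i), (8, k, i, j), (8, k, j, i)}"
    have "{t' \<in> idx1 \<union> idx2 \<union> idx3. supp t' = supp t} \<subseteq> ?U"
    proof
      fix t' assume "t' \<in> {t' \<in> idx1 \<union> idx2 \<union> idx3. supp t' = supp t}"
      then have t': "t' \<in> idx1 \<union> idx2 \<union> idx3" "supp t' = {i, j, k}" unfolding 3(1) by (auto simp: supp_def)
      obtain n' a b d where eq: "t' = (n', a, b, d)" by (cases t')
      have abd: "{a, b, d} = {i, j, k}" using t'(2) by (simp add: eq supp_def)
      have mem: "a \<in> {i, j, k}" "b \<in> {i, j, k}" "d \<in> {i, j, k}" using abd by auto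
      have ne: "a \<noteq> b \<and> a \<noteq> d \<and> b \<noteq> d"
      proof -
        have "card {a, b, d} = 3" unfolding abd using 3 by simp
        moreover have "card {b, d} \<le> 2" "card {a, d} \<le> 2" using card_insert_le_m1[of 2] by (auto simp: card_insert_if)
        moreover have "{a, b, a} = {b, a}" by auto
        ultimately show ?thesis by auto
      qed
      then have "n' = 8" using t'(1) unfolding eq idx1_def idx2_def idx3_def by auto
      moreover have "b \<in> {i, j, k} - {a}" "d \<in> {i, j, k} - {a, b}" using mem ne by auto
      ultimately show "t' \<in> ?U" using mem(1) 3(2-4) unfolding eq by (elim insertE DiffE emptyE) simp_all
    qed
    then have "card {t' \<in> idx1 \<union> idx2 \<union> idx3. supp t' = supp t} \<le> card ?U" by (rule card_mono[rotated]) simp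
    also have "\<dots> = 6" using 3(2-4) by simp
    finally show ?thesis using 3 by (simp add: mult_bound_def)
  qed
qed

lemma sum_idx:
  fixes w :: "'n::finite idx \<Rightarrow> real"
  shows "(\<Sum>t\<in>idx1 \<union> idx2 \<union> idx3. w t) = (\<Sum>n<4. \<Sum>i\<in>UNIV. w (n, i, i, i))
    + (\<Sum>n\<in>{4..<8}. \<Sum>(i, j)\<in>{(i, j). i \<noteq> j}. w (n, i, j, j))
    + (\<Sum>(i, j, k)\<in>{(i, j, k). i \<noteq> j \<and> i \<noteq> k \<and> j \<noteq> k}. w (8, i, j, k))"
proof -
  have "(\<Sum>t\<in>idx1 \<union> idx2 \<union> idx3. w t) = sum w idx1 + sum w idx2 + sum w idx3"
  proof -
    have "(idx1 \<union> idx2) \<inter> idx3 = ({} :: 'n idx set)" "idx1 \<inter> idx2 = ({} :: 'n idx set)"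
      unfolding idx1_def idx2_def idx3_def by auto
    moreover have "finite (idx1 :: 'n idx set)" "finite (idx2 :: 'n idx set)" "finite (idx3 :: 'n idx set)"
      using finite_idx by auto
    ultimately show ?thesis by (simp add: sum.union_disjoint)
  qed
  moreover have "sum w idx1 = (\<Sum>n<4. \<Sum>i\<in>UNIV. w (n, i, i, i))"
    unfolding idx1_def by (subst sum.reindex) (auto simp: inj_on_def sum.cartesian_product case_prod_unfold)
  moreover have "sum w idx2 = (\<Sum>n\<in>{4..<8}. \<Sum>(i, j)\<in>{(i, j). i \<noteq> j}. w (n, i, j, j))"
    unfolding idx2_def by (subst sum.reindex) (auto simp: inj_on_def sum.cartesian_product case_prod_unfold)
  moreover have "sum w idx3 = (\<Sum>(i, j, k)\<in>{(i, j, k). i \<noteq> j \<and> i \<noteq> k \<and> j \<noteq> k}. w (8, i, j, k))"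
    unfolding idx3_def by (subst sum.reindex) (auto simp: inj_on_def case_prod_unfold)
  ultimately show ?thesis by simp
qed

lemma sum_offdiag:
  fixes w :: "'n::finite \<Rightarrow> 'n \<Rightarrow> real"
  assumes "\<And>i. w i i = 0"
  shows "(\<Sum>(i, j)\<in>{(i, j). i \<noteq> j}. w i j) = (\<Sum>i\<in>UNIV. \<Sum>j\<in>UNIV. w i j)"
proof -
  have "(\<Sum>(i, j)\<in>UNIV. w i j) = (\<Sum>(i, j)\<in>{(i, j). i \<noteq> j}. w i j)"
    by (rule sum.mono_neutral_right) (use assms in auto)
  then show ?thesis by (simp add: sum.cartesian_product)
qed

lemma sum_distinct3:
  fixes w :: "'n::finite \<Rightarrow> 'n \<Rightarrow> 'n \<Rightarrow> real"
  assumes "\<And>i j k. i = j \<or> i = k \<or> j = k \<Longrightarrow> w i j k = 0"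
  shows "(\<Sum>(i, j, k)\<in>{(i, j, k). i \<noteq> j \<and> i \<noteq> k \<and> j \<noteq> k}. w i j k) = (\<Sum>i\<in>UNIV. \<Sum>j\<in>UNIV. \<Sum>k\<in>UNIV. w i j k)"
proof -
  have "(\<Sum>(i, j, k)\<in>UNIV. w i j k) = (\<Sum>(i, j, k)\<in>{(i, j, k). i \<noteq> j \<and> i \<noteq> k \<and> j \<noteq> k}. w i j k)"
    by (rule sum.mono_neutral_right) (use assms in auto)
  moreover have "(\<Sum>(i, j, k)\<in>UNIV. w i j k) = (\<Sum>i\<in>UNIV. \<Sum>j\<in>UNIV. \<Sum>k\<in>UNIV. w i j k)"
    by (simp add: sum.cartesian_product)
  ultimately show ?thesis by simp
qed

context gauss_quadratic begin

text \<open>The constant term and the coefficients that arise from collecting the products in \<open>T\<close>. The matrix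
  \<open>H\<close> is the off-diagonal part of the square of \<open>B\<close>, and \<open>p\<close> is \<open>B\<close> applied to the means of the
  linear coefficients.\<close>

definition r2 :: "'n \<Rightarrow> real" where "r2 i = (\<Sum>j\<in>UNIV. (B i j)\<^sup>2)"
definition sigma2 :: real where "sigma2 = (\<Sum>i\<in>UNIV. 2 * r2 i + (q i)\<^sup>2 * L.\<delta> i)"
definition p :: "'n \<Rightarrow> real" where "p j = (\<Sum>i\<in>UNIV. B i j * (q i * (3 / 2 * L.m3 i)))"
definition H :: "'n \<Rightarrow> 'n \<Rightarrow> real" where "H j k = (if j = k then 0 else \<Sum>i\<in>UNIV. B i j * B i k)"

text \<open>The term of kind \<open>n\<close> at \<open>(i, j, k)\<close> is \<open>coef (n, i, j, k)\<close> times the product of the factors \<open>e n i\<close>,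
  \<open>f n j\<close> and \<open>\<psi> k\<close> taken over the distinct coordinates among \<open>i, j, k\<close>. Thus, up to the coefficients,
  the kinds 0 to 3 are \<open>\<alpha> - 1\<close>, \<open>h\<close>, the centred \<open>\<theta>\<close> and \<open>\<psi>\<close>; the kinds 4 to 7 are \<open>(\<alpha> - 1) h\<close>,
  \<open>\<psi> \<psi>\<close>, and \<open>\<psi>\<close> times the centred \<open>\<beta>\<close> or \<open>\<eta>\<close>; the kind 8 is \<open>(\<alpha> - 1) \<psi> \<psi>\<close>.\<close>

definition e :: "nat \<Rightarrow> 'n \<Rightarrow> real \<Rightarrow> real" where
  "e n i = (if n \<in> {0, 4, 8} then (\<lambda>y. L.\<alpha> i y - 1) else if n = 1 then L.h i
    else if n = 2 then (\<lambda>y. L.\<theta> i y - L.\<delta> i / 2) else if n = 6 then (\<lambda>y. L.\<beta> i y - L.m3 i)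
    else if n = 7 then (\<lambda>y. L.\<eta> i y - L.m3 i / 2) else \<psi> i)"

definition f :: "nat \<Rightarrow> 'n \<Rightarrow> real \<Rightarrow> real" where
  "f n j = (if n = 4 then L.h j else \<psi> j)"

definition F :: "'n idx \<Rightarrow> 'n \<Rightarrow> real \<Rightarrow> real" where
  "F t l = (case t of (n, i, j, k) \<Rightarrow>
     if l = i then e n i else if l = j then f n j else if l = k then \<psi> k else (\<lambda>_. 1))"

definition coef :: "'n idx \<Rightarrow> real" where
  "coef t = (case t of (n, i, j, k) \<Rightarrow>
     if n \<le> 1 then r2 i else if n = 2 then (q i)\<^sup>2 else if n = 3 then p i
     else if n = 4 then (B i j)\<^sup>2 else if n = 5 then H i j else if n \<le> 7 then q i * B i j
     else if j = k then 0 else B i j * B i k)"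

lemma centred_sqi:
  assumes "sqi \<nu> k" "(\<integral>y. k y \<partial>\<nu>) = m"
  shows "sqi \<nu> (\<lambda>y. k y - m)" "(\<integral>y. k y - m \<partial>\<nu>) = 0" "(\<integral>y. (k y - m)\<^sup>2 \<partial>\<nu>) \<le> msq k"
proof -
  interpret prob_space \<nu> by (rule nu_prob)
  have i: "integrable \<nu> k" by (rule sqi_integrable[OF nu_prob assms(1)])
  show "sqi \<nu> (\<lambda>y. k y - m)"
    using sqi_add[OF assms(1) sqi_const[OF nu_prob, of "- m"]] by simp
  show "(\<integral>y. k y - m \<partial>\<nu>) = 0" using i assms(2) prob_space by simp
  have eq: "(k y - m)\<^sup>2 = (k y)\<^sup>2 - 2 * m * k y + m\<^sup>2" for y by (simp add: power2_eq_square algebra_simps)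
  have "(\<integral>y. (k y - m)\<^sup>2 \<partial>\<nu>) = msq k - m\<^sup>2"
    unfolding eq using i assms prob_space by (simp add: sqi_def power2_eq_square)
  then show "(\<integral>y. (k y - m)\<^sup>2 \<partial>\<nu>) \<le> msq k" by simp
qed

lemma e_sqi: "sqi \<nu> (e n i)" and e_mean: "(\<integral>y. e n i y \<partial>\<nu>) = 0"
  unfolding e_def
  using centred_sqi(1,2)[OF sqi_1d(4) L.alpha_mean, of i] centred_sqi(1,2)[OF sqi_1d(7) L.theta_mean, of i]
    centred_sqi(1,2)[OF sqi_1d(5) L.beta_mean, of i] centred_sqi(1,2)[OF sqi_1d(6) L.eta_mean, of i]
    sqi_1d(1,2)[of i] L.h_mean[of i] L.mean[of i]
  by auto

lemma f_sqi: "sqi \<nu> (f n i)" and f_mean: "(\<integral>y. f n i y \<partial>\<nu>) = 0"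
  unfolding f_def using sqi_1d(1,2)[of i] L.h_mean[of i] L.mean[of i] by auto

lemma F_sqi: "sqi \<nu> (F t l)"
  unfolding F_def using e_sqi f_sqi sqi_1d(2) sqi_const[OF nu_prob] by (auto split: prod.split)

lemma F_mean: "l \<in> supp t \<Longrightarrow> (\<integral>y. F t l y \<partial>\<nu>) = 0"
  unfolding F_def supp_def using e_mean f_mean L.mean by (auto split: prod.splits)

lemma F_triv: "l \<notin> supp t \<Longrightarrow> F t l = (\<lambda>_. 1)"
  unfolding F_def supp_def by (auto split: prod.splits)

lemma prodF:
  "(\<Prod>l\<in>UNIV. F (n, i, i, i) l (x l)) = e n i (x i)"
  "i \<noteq> j \<Longrightarrow> (\<Prod>l\<in>UNIV. F (n, i, j, j) l (x l)) = e n i (x i) * f n j (x j)"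
  "i \<noteq> j \<Longrightarrow> i \<noteq> k \<Longrightarrow> j \<noteq> k \<Longrightarrow> (\<Prod>l\<in>UNIV. F (n, i, j, k) l (x l)) = e n i (x i) * f n j (x j) * \<psi> k (x k)"
  by (subst prod_one[of i] prod_two[of i j] prod_three[of i j k]; simp add: F_def)+

lemma prodE:
  "(\<Prod>l\<in>UNIV. msq (F (n, i, i, i) l)) = msq (e n i)"
  "i \<noteq> j \<Longrightarrow> (\<Prod>l\<in>UNIV. msq (F (n, i, j, j) l)) = msq (e n i) * msq (f n j)"
  "i \<noteq> j \<Longrightarrow> i \<noteq> k \<Longrightarrow> j \<noteq> k \<Longrightarrow> (\<Prod>l\<in>UNIV. msq (F (n, i, j, k) l))
      = msq (e n i) * msq (f n j)"
proof -
  interpret prob_space \<nu> by (rule nu_prob)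
  have [simp]: "prob UNIV = 1" using prob_space by simp
  show "(\<Prod>l\<in>UNIV. msq (F (n, i, i, i) l)) = msq (e n i)"
    by (subst prod_one[of i]) (simp_all add: F_def)
  show "i \<noteq> j \<Longrightarrow> (\<Prod>l\<in>UNIV. msq (F (n, i, j, j) l)) = msq (e n i) * msq (f n j)"
    by (subst prod_two[of i j]) (simp_all add: F_def)
  show "i \<noteq> j \<Longrightarrow> i \<noteq> k \<Longrightarrow> j \<noteq> k \<Longrightarrow> (\<Prod>l\<in>UNIV. msq (F (n, i, j, k) l))
      = msq (e n i) * msq (f n j)"
    by (subst prod_three[of i j k]) (simp_all add: F_def L.var)
qed

abbreviation "Idx \<equiv> (idx1 \<union> idx2 \<union> idx3 :: 'n idx set)"

definition R :: "('n \<Rightarrow> real) \<Rightarrow> real" where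
  "R x = (\<Sum>t\<in>Idx. coef t * (\<Prod>l\<in>UNIV. F t l (x l)))"

lemma R_expand:
  "R x = (\<Sum>i\<in>UNIV. r2 i * (L.\<alpha> i (x i) - 1)) + (\<Sum>i\<in>UNIV. r2 i * L.h i (x i))
    + (\<Sum>i\<in>UNIV. (q i)\<^sup>2 * (L.\<theta> i (x i) - L.\<delta> i / 2)) + (\<Sum>i\<in>UNIV. p i * \<psi> i (x i))
    + (\<Sum>i\<in>UNIV. \<Sum>j\<in>UNIV. (B i j)\<^sup>2 * ((L.\<alpha> i (x i) - 1) * L.h j (x j)))
    + (\<Sum>i\<in>UNIV. \<Sum>j\<in>UNIV. H i j * (\<psi> i (x i) * \<psi> j (x j)))
    + (\<Sum>i\<in>UNIV. \<Sum>j\<in>UNIV. q i * B i j * ((L.\<beta> i (x i) - L.m3 i) * \<psi> j (x j)))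
    + (\<Sum>i\<in>UNIV. \<Sum>j\<in>UNIV. q i * B i j * ((L.\<eta> i (x i) - L.m3 i / 2) * \<psi> j (x j)))
    + (\<Sum>i\<in>UNIV. \<Sum>j\<in>UNIV. \<Sum>k\<in>UNIV. (if j = k then 0 else B i j * B i k) * ((L.\<alpha> i (x i) - 1) * \<psi> j (x j) * \<psi> k (x k)))"
proof -
  have two: "(\<Sum>(i, j)\<in>{(i, j). i \<noteq> j}. coef (n, i, j, j) * (\<Prod>l\<in>UNIV. F (n, i, j, j) l (x l)))
      = (\<Sum>i\<in>UNIV. \<Sum>j\<in>UNIV. coef (n, i, j, j) * (e n i (x i) * f n j (x j)))" if "n \<in> {4..<8}" for n
    by (subst sum_offdiag[symmetric])
      (use that in \<open>auto simp: coef_def diag H_def prodF intro!: sum.cong\<close>)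
  have three: "(\<Sum>(i, j, k)\<in>{(i, j, k). i \<noteq> j \<and> i \<noteq> k \<and> j \<noteq> k}. coef (8, i, j, k) * (\<Prod>l\<in>UNIV. F (8, i, j, k) l (x l)))
      = (\<Sum>i\<in>UNIV. \<Sum>j\<in>UNIV. \<Sum>k\<in>UNIV. coef (8, i, j, k) * (e 8 i (x i) * f 8 j (x j) * \<psi> k (x k)))"
    by (subst sum_distinct3[symmetric]) (auto simp: coef_def diag prodF intro!: sum.cong)
  have two': "(\<Sum>n\<in>{4..<8}. \<Sum>(i, j)\<in>{(i, j). i \<noteq> j}. coef (n, i, j, j) * (\<Prod>l\<in>UNIV. F (n, i, j, j) l (x l)))
      = (\<Sum>n\<in>{4..<8}. \<Sum>i\<in>UNIV. \<Sum>j\<in>UNIV. coef (n, i, j, j) * (e n i (x i) * f n j (x j)))"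
    by (rule sum.cong[OF refl two])
  have s4: "{..<4::nat} = {0, 1, 2, 3}" and s8: "{4..<8::nat} = {4, 5, 6, 7}" by auto
  show ?thesis
    unfolding R_def sum_idx three two' prodF(1) unfolding s4 s8
    by (simp add: coef_def e_def f_def)
qed

text \<open>Write \<open>\<alpha> = 1 + (\<alpha> - 1)\<close> and \<open>\<psi>\<^sup>2 = 1 + h\<close>, split every other coefficient into its mean and its centred
  part, and collect the sums of equal shape using the symmetry of \<open>B\<close>.\<close>

lemma T_expand: "T x = sigma2 + 2 * R x"
proof -
  let ?z = "\<lambda>i. \<psi> i (x i)" and ?h = "\<lambda>i. L.h i (x i)" and ?a = "\<lambda>i. L.\<alpha> i (x i) - 1"
  let ?D = "\<lambda>i j k. if j = k then 0 else B i j * B i k"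
  have z2: "?z j * ?z j = 1 + ?h j" for j by (simp add: L.h_def power2_eq_square)
  define Q where "Q i = (\<Sum>j\<in>UNIV. \<Sum>k\<in>UNIV. ?D i j k * (?z j * ?z k))" for i
  have A2: "A i x * A i x = r2 i + (\<Sum>j\<in>UNIV. (B i j)\<^sup>2 * ?h j) + Q i" for i
  proof -
    have "A i x * A i x = (\<Sum>j\<in>UNIV. \<Sum>k\<in>UNIV. (if j = k then (B i j)\<^sup>2 * (1 + ?h j) else 0) + ?D i j k * (?z j * ?z k))"
      unfolding A_def sum_product by (intro sum.cong refl) (auto simp: power2_eq_square z2[symmetric])
    also have "\<dots> = (\<Sum>j\<in>UNIV. (B i j)\<^sup>2 * (1 + ?h j)) + Q i"
      by (simp add: sum.distrib Q_def)
    finally show ?thesis by (simp add: r2_def sum.distrib distrib_left)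
  qed
  have sum_h: "(\<Sum>i\<in>UNIV. \<Sum>j\<in>UNIV. (B i j)\<^sup>2 * ?h j) = (\<Sum>j\<in>UNIV. r2 j * ?h j)"
    by (subst sum.swap) (simp add: r2_def sum_distrib_right sym)
  have sum_Q: "(\<Sum>i\<in>UNIV. Q i) = (\<Sum>j\<in>UNIV. \<Sum>k\<in>UNIV. H j k * (?z j * ?z k))"
  proof -
    have "(\<Sum>i\<in>UNIV. Q i) = (\<Sum>j\<in>UNIV. \<Sum>i\<in>UNIV. \<Sum>k\<in>UNIV. ?D i j k * (?z j * ?z k))"
      unfolding Q_def by (rule sum.swap)
    also have "\<dots> = (\<Sum>j\<in>UNIV. \<Sum>k\<in>UNIV. \<Sum>i\<in>UNIV. ?D i j k * (?z j * ?z k))"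
      by (intro sum.cong refl sum.swap)
    also have "\<dots> = (\<Sum>j\<in>UNIV. \<Sum>k\<in>UNIV. H j k * (?z j * ?z k))"
      by (intro sum.cong refl) (auto simp: H_def sum_distrib_right)
    finally show ?thesis .
  qed
  have sum_p: "(\<Sum>i\<in>UNIV. q i * (3 / 2 * L.m3 i) * A i x) = (\<Sum>j\<in>UNIV. p j * ?z j)"
    unfolding A_def p_def sum_distrib_left sum_distrib_right
    by (subst sum.swap) (intro sum.cong refl, simp add: mult_ac)
  have Ti: "(q i * L.v i (x i) + A i x * L.u i (x i)) * (2 * \<psi>' i (x i) * (q i * \<psi> i (x i) + A i x))
     = 2 * r2 i + (q i)\<^sup>2 * L.\<delta> i + 2 * (r2 i * ?a i + (\<Sum>j\<in>UNIV. (B i j)\<^sup>2 * ?h j) + (q i)\<^sup>2 * (L.\<theta> i (x i) - L.\<delta> i / 2)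
       + q i * (3 / 2 * L.m3 i) * A i x + (\<Sum>j\<in>UNIV. (B i j)\<^sup>2 * (?a i * ?h j)) + Q i
       + (\<Sum>j\<in>UNIV. q i * B i j * ((L.\<beta> i (x i) - L.m3 i) * ?z j))
       + (\<Sum>j\<in>UNIV. q i * B i j * ((L.\<eta> i (x i) - L.m3 i / 2) * ?z j)) + ?a i * Q i)" for i
  proof -
    have s1: "(\<Sum>j\<in>UNIV. (B i j)\<^sup>2 * (?a i * ?h j)) = ?a i * (\<Sum>j\<in>UNIV. (B i j)\<^sup>2 * ?h j)"
      by (simp add: sum_distrib_left mult_ac)
    have s2: "(\<Sum>j\<in>UNIV. q i * B i j * (y * ?z j)) = q i * y * A i x" for y
      unfolding A_def by (simp add: sum_distrib_left mult_ac)
    show ?thesis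
      unfolding distrib_right T_summand A2 s1 s2 by (simp add: algebra_simps)
  qed
  have Q3: "(\<Sum>i\<in>UNIV. ?a i * Q i) = (\<Sum>i\<in>UNIV. \<Sum>j\<in>UNIV. \<Sum>k\<in>UNIV. ?D i j k * (?a i * ?z j * ?z k))"
    unfolding Q_def sum_distrib_left by (intro sum.cong refl) simp
  show ?thesis
    unfolding T_def Ti R_expand sigma2_def
    by (simp only: sum.distrib sum_distrib_left[symmetric] sum_h sum_Q sum_p Q3)
qed

lemma R_sqi: "sqi P R"
  unfolding R_def[abs_def]
  by (intro sqi_sum[OF gauss_prob] sqi_cmult sqi_prod F_sqi)

lemma R_mean: "(\<integral>x. R x \<partial>P) = 0"
proof -
  interpret product_sigma_finite "\<lambda>_::'n. \<nu>" by (rule nu_product)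
  have "(\<integral>x. (\<Prod>l\<in>UNIV. F t l (x l)) \<partial>P) = 0" for t
  proof -
    have "(\<integral>x. (\<Prod>l\<in>UNIV. F t l (x l)) \<partial>P) = (\<Prod>l\<in>UNIV. (\<integral>y. F t l y \<partial>\<nu>))"
      by (rule product_integral_prod[of UNIV "F t"]) (auto intro: sqi_integrable[OF nu_prob F_sqi])
    also have "\<dots> = 0"
    proof (rule prod_zero)
      obtain n i j k where "t = (n, i, j, k)" by (cases t)
      then have "i \<in> supp t" by (simp add: supp_def)
      then show "\<exists>l\<in>UNIV. (\<integral>y. F t l y \<partial>\<nu>) = 0" using F_mean by blast
    qed simp
    finally show ?thesis .
  qed
  moreover have "integrable P (\<lambda>x. \<Prod>l\<in>UNIV. F t l (x l))" for t
    by (intro sqi_integrable[OF gauss_prob] sqi_prod F_sqi)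
  ultimately show ?thesis unfolding R_def by simp
qed

lemma T_mean: "(\<integral>x. T x \<partial>P) = sigma2"
proof -
  interpret prob_space P by (rule gauss_prob)
  show ?thesis unfolding T_expand
    using sqi_integrable[OF gauss_prob R_sqi] R_mean prob_space by simp
qed

lemma R_second_moment:
  "(\<integral>x. (R x)\<^sup>2 \<partial>P) \<le>
    (\<Sum>t\<in>Idx. real (mult_bound t) * ((coef t)\<^sup>2 * (\<Prod>l\<in>UNIV. msq (F t l))))"
  unfolding R_def
proof (rule degenerate_sum(2)[where s = supp])
  show "F t l \<in> borel_measurable \<nu>" "integrable \<nu> (\<lambda>y. (F t l y)\<^sup>2)" for t l
    using F_sqi[of t l] unfolding sqi_def by blast+
  show "card {t' \<in> Idx. supp t' = supp t} \<le> mult_bound t" if "t \<in> Idx" for t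
    by (rule card_supp_class[OF that])
qed (fact nu_prob finite_idx | erule F_mean F_triv)+

end

text \<open>Here \<open>g\<close> stands for the operator norm of the whole matrix; it bounds the rows, and the operator
  norm of the off-diagonal part is at most \<open>2 g\<close>.\<close>

locale gauss_quadratic_bounded = gauss_quadratic +
  fixes g :: real
  assumes g_nonneg: "0 \<le> g"
    and row: "\<And>i. r2 i + (q i)\<^sup>2 \<le> g\<^sup>2"
    and opB: "\<And>y. (\<Sum>j\<in>UNIV. (\<Sum>i\<in>UNIV. B i j * y i)\<^sup>2) \<le> 4 * g\<^sup>2 * (\<Sum>i\<in>UNIV. (y i)\<^sup>2)"
begin

lemma r2_nonneg: "0 \<le> r2 i" unfolding r2_def by (simp add: sum_nonneg)
lemma r2_le: "r2 i \<le> g\<^sup>2" using row[of i] zero_le_power2[of "q i"] by linarith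
lemma q2_le: "(q i)\<^sup>2 \<le> g\<^sup>2" using row[of i] r2_nonneg[of i] by linarith
lemma B2_le: "(B i j)\<^sup>2 \<le> g\<^sup>2"
proof -
  have "(B i j)\<^sup>2 \<le> r2 i" unfolding r2_def by (rule member_le_sum) auto
  then show ?thesis using r2_le[of i] by linarith
qed

definition RR :: real where "RR = (\<Sum>i\<in>UNIV. r2 i)"
definition DD :: real where "DD = (\<Sum>i\<in>UNIV. (q i)\<^sup>2 * L.\<delta> i)"

lemma sigma2_eq: "sigma2 = 2 * RR + DD"
  by (simp add: sigma2_def RR_def DD_def sum.distrib sum_distrib_left)

lemma RR_nonneg: "0 \<le> RR" unfolding RR_def by (simp add: sum_nonneg r2_nonneg)

lemma c_ge_1: "1 \<le> c" using L.c_ge_1 by blast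

abbreviation "\<kappa> \<equiv> c\<^sup>2 - 1"
abbreviation "\<Delta> \<equiv> 3 * c\<^sup>2 - 1"

lemma kappa_nonneg: "0 \<le> \<kappa>" using c_ge_1 by simp

lemma delta_bounds: "0 \<le> L.\<delta> i" "L.\<delta> i \<le> \<Delta>" "0 \<le> \<Delta>"
  using L.delta_nonneg[of i] L.delta_upper[of i] by auto

lemma e2:
  "msq (e 0 i) \<le> \<kappa>" "msq (e (Suc 0) i) = L.\<delta> i" "msq (e 2 i) \<le> 6 * c ^ 4 * L.\<delta> i"
  "msq (e 3 i) = 1" "msq (e 4 i) \<le> \<kappa>" "msq (e 5 i) = 1"
  "msq (e 6 i) \<le> c\<^sup>2 * L.\<delta> i" "msq (e 7 i) \<le> c ^ 4" "msq (e 8 i) \<le> \<kappa>"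
  using L.alpha_var(2)[of i] order_trans[OF centred_sqi(3)[OF sqi_1d(7) L.theta_mean] L.theta_sq(2), of i]
    order_trans[OF centred_sqi(3)[OF sqi_1d(5) L.beta_mean] L.beta_sq(2), of i]
    order_trans[OF centred_sqi(3)[OF sqi_1d(6) L.eta_mean] L.eta_sq(2), of i] L.var[of i]
  by (simp_all add: e_def L.\<delta>_def)

lemma f2: "msq (f n j) = (if n = 4 then L.\<delta> j else 1)"
  by (simp add: f_def L.\<delta>_def L.var)

lemma sum_p2: "(\<Sum>i\<in>UNIV. (p i)\<^sup>2) \<le> 9 * g\<^sup>2 * DD"
proof -
  have "(\<Sum>i\<in>UNIV. (p i)\<^sup>2) \<le> 4 * g\<^sup>2 * (\<Sum>i\<in>UNIV. (q i * (3 / 2 * L.m3 i))\<^sup>2)"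
    unfolding p_def by (rule opB)
  also have "\<dots> \<le> 4 * g\<^sup>2 * (\<Sum>i\<in>UNIV. 9 / 4 * ((q i)\<^sup>2 * L.\<delta> i))"
  proof (intro mult_left_mono sum_mono)
    fix i
    have "(q i * (3 / 2 * L.m3 i))\<^sup>2 = 9 / 4 * ((q i)\<^sup>2 * (L.m3 i)\<^sup>2)"
      by (simp add: power2_eq_square)
    also have "\<dots> \<le> 9 / 4 * ((q i)\<^sup>2 * L.\<delta> i)" by (intro mult_left_mono L.m3_sq) auto
    finally show "(q i * (3 / 2 * L.m3 i))\<^sup>2 \<le> 9 / 4 * ((q i)\<^sup>2 * L.\<delta> i)" .
  qed simp
  also have "\<dots> = 9 * g\<^sup>2 * DD"
    unfolding DD_def sum_distrib_left by (intro sum.cong refl) simp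
  finally show ?thesis .
qed

lemma sum_H2: "(\<Sum>i\<in>UNIV. \<Sum>j\<in>UNIV. (H i j)\<^sup>2) \<le> 4 * g\<^sup>2 * RR"
proof -
  have "(\<Sum>i\<in>UNIV. \<Sum>j\<in>UNIV. (H i j)\<^sup>2) \<le> (\<Sum>i\<in>UNIV. \<Sum>j\<in>UNIV. (\<Sum>k\<in>UNIV. B k j * B k i)\<^sup>2)"
    by (intro sum_mono) (auto simp: H_def mult.commute)
  also have "\<dots> \<le> (\<Sum>i\<in>UNIV. 4 * g\<^sup>2 * (\<Sum>k\<in>UNIV. (B k i)\<^sup>2))"
    by (intro sum_mono opB)
  also have "\<dots> = 4 * g\<^sup>2 * RR" by (simp add: RR_def r2_def sym sum_distrib_left[symmetric])
  finally show ?thesis .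
qed

text \<open>The nine sums belong to the kinds 0 to 8. In each of them one factor \<open>g\<^sup>2\<close> is split off through
  the bounds on rows and entries. The kinds 2, 3 and 6 are charged to \<open>DD\<close>: their squared terms are
  at most multiples of \<open>\<delta>\<^sub>i\<close> (for kind 3 by \<open>m3_sq\<close>), which is essential when \<open>\<delta>\<^sub>i\<close> is small.\<close>

lemma R_bound:
  "(\<integral>x. (R x)\<^sup>2 \<partial>P) \<le> g\<^sup>2 * ((10 * \<kappa> + 4 * \<Delta> + 8 * \<kappa> * \<Delta> + 32 + 8 * c ^ 4) * RR
     + (24 * c ^ 4 + 36 + 8 * c\<^sup>2) * DD)"
proof -
  let ?E = "\<lambda>n i. msq (e n i)" and ?F = "\<lambda>n i. msq (f n i)"
  let ?V = "\<lambda>t. real (mult_bound t) * ((coef t)\<^sup>2 * (\<Prod>l\<in>UNIV. msq (F t l)))"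
  have two: "(\<Sum>n\<in>{4..<8}. \<Sum>(i, j)\<in>{(i, j). i \<noteq> j}. ?V (n, i, j, j))
      = (\<Sum>n\<in>{4..<8}. \<Sum>i\<in>UNIV. \<Sum>j\<in>UNIV. 8 * ((coef (n, i, j, j))\<^sup>2 * (?E n i * ?F n j)))"
    by (rule sum.cong[OF refl], subst sum_offdiag[symmetric])
      (auto simp: coef_def diag H_def prodE mult_bound_def intro!: sum.cong)
  have three: "(\<Sum>(i, j, k)\<in>{(i, j, k). i \<noteq> j \<and> i \<noteq> k \<and> j \<noteq> k}. ?V (8, i, j, k))
      = (\<Sum>i\<in>UNIV. \<Sum>j\<in>UNIV. \<Sum>k\<in>UNIV. 6 * ((coef (8, i, j, k))\<^sup>2 * (?E 8 i * ?F 8 j)))"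
    by (subst sum_distinct3[symmetric]) (auto simp: coef_def diag prodE mult_bound_def intro!: sum.cong)
  have s4: "{..<4::nat} = {0, 1, 2, 3}" and s8: "{4..<8::nat} = {4, 5, 6, 7}" by auto
  have "(\<integral>x. (R x)\<^sup>2 \<partial>P) \<le> (\<Sum>t\<in>Idx. ?V t)" by (rule R_second_moment)
  also have "\<dots> = (\<Sum>i\<in>UNIV. 4 * ((r2 i)\<^sup>2 * ?E 0 i)) + (\<Sum>i\<in>UNIV. 4 * ((r2 i)\<^sup>2 * L.\<delta> i))
      + (\<Sum>i\<in>UNIV. 4 * (((q i)\<^sup>2)\<^sup>2 * ?E 2 i)) + (\<Sum>i\<in>UNIV. 4 * (p i)\<^sup>2)
      + (\<Sum>i\<in>UNIV. \<Sum>j\<in>UNIV. 8 * (((B i j)\<^sup>2)\<^sup>2 * (?E 4 i * L.\<delta> j)))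
      + (\<Sum>i\<in>UNIV. \<Sum>j\<in>UNIV. 8 * (H i j)\<^sup>2)
      + (\<Sum>i\<in>UNIV. \<Sum>j\<in>UNIV. 8 * ((q i * B i j)\<^sup>2 * ?E 6 i))
      + (\<Sum>i\<in>UNIV. \<Sum>j\<in>UNIV. 8 * ((q i * B i j)\<^sup>2 * ?E 7 i))
      + (\<Sum>i\<in>UNIV. \<Sum>j\<in>UNIV. \<Sum>k\<in>UNIV. 6 * ((if j = k then 0 else B i j * B i k)\<^sup>2 * ?E 8 i))"
    unfolding sum_idx two three prodE(1) unfolding s4 s8
    by (simp add: coef_def mult_bound_def f2 e2(2,4,6))
  also have "\<dots> \<le> 4 * \<kappa> * g\<^sup>2 * RR + 4 * \<Delta> * g\<^sup>2 * RR + 24 * c ^ 4 * g\<^sup>2 * DD + 36 * g\<^sup>2 * DD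
      + 8 * \<kappa> * \<Delta> * g\<^sup>2 * RR + 32 * g\<^sup>2 * RR + 8 * c\<^sup>2 * g\<^sup>2 * DD + 8 * c ^ 4 * g\<^sup>2 * RR + 6 * \<kappa> * g\<^sup>2 * RR"
  proof (intro add_mono)
    have r4: "(r2 i)\<^sup>2 * z \<le> y * g\<^sup>2 * r2 i" if "0 \<le> z" "z \<le> y" for i z y
    proof -
      have "(r2 i * r2 i) * z \<le> (g\<^sup>2 * r2 i) * y"
        using that by (intro mult_mono r2_le r2_nonneg) (auto intro!: mult_nonneg_nonneg r2_nonneg)
      then show ?thesis by (simp add: power2_eq_square mult_ac)
    qed
    have q4: "((q i)\<^sup>2)\<^sup>2 * z \<le> y * g\<^sup>2 * (q i)\<^sup>2" if "0 \<le> z" "z \<le> y" for i z y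
    proof -
      have "((q i)\<^sup>2 * (q i)\<^sup>2) * z \<le> (g\<^sup>2 * (q i)\<^sup>2) * y"
        using that by (intro mult_mono q2_le) auto
      then show ?thesis by (simp add: power2_eq_square mult_ac)
    qed
    show "(\<Sum>i\<in>UNIV. 4 * ((r2 i)\<^sup>2 * ?E 0 i)) \<le> 4 * \<kappa> * g\<^sup>2 * RR"
    proof -
      have "(\<Sum>i\<in>UNIV. 4 * ((r2 i)\<^sup>2 * ?E 0 i)) \<le> (\<Sum>i\<in>UNIV. 4 * (\<kappa> * g\<^sup>2 * r2 i))"
        by (intro sum_mono mult_left_mono r4 e2) auto
      also have "\<dots> = 4 * \<kappa> * g\<^sup>2 * RR"
        unfolding RR_def sum_distrib_left by (intro sum.cong refl) (simp only: mult_ac)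
      finally show ?thesis .
    qed
    show "(\<Sum>i\<in>UNIV. 4 * ((r2 i)\<^sup>2 * L.\<delta> i)) \<le> 4 * \<Delta> * g\<^sup>2 * RR"
    proof -
      have "(\<Sum>i\<in>UNIV. 4 * ((r2 i)\<^sup>2 * L.\<delta> i)) \<le> (\<Sum>i\<in>UNIV. 4 * (\<Delta> * g\<^sup>2 * r2 i))"
        by (intro sum_mono mult_left_mono r4 delta_bounds) auto
      also have "\<dots> = 4 * \<Delta> * g\<^sup>2 * RR"
        unfolding RR_def sum_distrib_left by (intro sum.cong refl) (simp only: mult_ac)
      finally show ?thesis .
    qed
    show "(\<Sum>i\<in>UNIV. 4 * (((q i)\<^sup>2)\<^sup>2 * ?E 2 i)) \<le> 24 * c ^ 4 * g\<^sup>2 * DD"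
    proof -
      have "(\<Sum>i\<in>UNIV. 4 * (((q i)\<^sup>2)\<^sup>2 * ?E 2 i)) \<le> (\<Sum>i\<in>UNIV. 4 * (6 * c ^ 4 * L.\<delta> i * g\<^sup>2 * (q i)\<^sup>2))"
        by (intro sum_mono mult_left_mono q4 e2) auto
      also have "\<dots> = (\<Sum>i\<in>UNIV. 24 * c ^ 4 * g\<^sup>2 * ((q i)\<^sup>2 * L.\<delta> i))" by (simp add: mult_ac)
      finally show ?thesis by (simp add: DD_def sum_distrib_left[symmetric])
    qed
    show "(\<Sum>i\<in>UNIV. 4 * (p i)\<^sup>2) \<le> 36 * g\<^sup>2 * DD"
      unfolding sum_distrib_left[symmetric] using sum_p2 by linarith
    show "(\<Sum>i\<in>UNIV. \<Sum>j\<in>UNIV. 8 * (((B i j)\<^sup>2)\<^sup>2 * (?E 4 i * L.\<delta> j))) \<le> 8 * \<kappa> * \<Delta> * g\<^sup>2 * RR"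
    proof -
      have "(\<Sum>i\<in>UNIV. \<Sum>j\<in>UNIV. 8 * (((B i j)\<^sup>2)\<^sup>2 * (?E 4 i * L.\<delta> j)))
          \<le> (\<Sum>i\<in>UNIV. \<Sum>j\<in>UNIV. 8 * ((g\<^sup>2 * (B i j)\<^sup>2) * (\<kappa> * \<Delta>)))"
        unfolding power2_eq_square[of "(B _ _)\<^sup>2"]
        by (intro sum_mono mult_left_mono mult_mono e2 B2_le delta_bounds kappa_nonneg mult_nonneg_nonneg) auto
      also have "\<dots> = 8 * \<kappa> * \<Delta> * g\<^sup>2 * RR"
        unfolding RR_def r2_def sum_distrib_left by (intro sum.cong refl) (simp only: mult_ac)
      finally show ?thesis .
    qed
    show "(\<Sum>i\<in>UNIV. \<Sum>j\<in>UNIV. 8 * (H i j)\<^sup>2) \<le> 32 * g\<^sup>2 * RR"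
      unfolding sum_distrib_left[symmetric] using sum_H2 by linarith
    have qB: "(\<Sum>j\<in>UNIV. 8 * ((q i * B i j)\<^sup>2 * z)) = 8 * ((q i)\<^sup>2 * r2 i) * z" for i z
      by (simp add: r2_def power_mult_distrib sum_distrib_left sum_distrib_right mult_ac)
    show "(\<Sum>i\<in>UNIV. \<Sum>j\<in>UNIV. 8 * ((q i * B i j)\<^sup>2 * ?E 6 i)) \<le> 8 * c\<^sup>2 * g\<^sup>2 * DD"
    proof -
      have "(\<Sum>i\<in>UNIV. \<Sum>j\<in>UNIV. 8 * ((q i * B i j)\<^sup>2 * ?E 6 i)) \<le> (\<Sum>i\<in>UNIV. 8 * ((q i)\<^sup>2 * g\<^sup>2) * (c\<^sup>2 * L.\<delta> i))"
        unfolding qB by (intro sum_mono mult_mono mult_left_mono e2 r2_le mult_nonneg_nonneg) auto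
      also have "\<dots> = (\<Sum>i\<in>UNIV. 8 * c\<^sup>2 * g\<^sup>2 * ((q i)\<^sup>2 * L.\<delta> i))" by (simp add: mult_ac)
      finally show ?thesis by (simp add: DD_def sum_distrib_left[symmetric])
    qed
    show "(\<Sum>i\<in>UNIV. \<Sum>j\<in>UNIV. 8 * ((q i * B i j)\<^sup>2 * ?E 7 i)) \<le> 8 * c ^ 4 * g\<^sup>2 * RR"
    proof -
      have "(\<Sum>i\<in>UNIV. \<Sum>j\<in>UNIV. 8 * ((q i * B i j)\<^sup>2 * ?E 7 i)) \<le> (\<Sum>i\<in>UNIV. 8 * (g\<^sup>2 * r2 i) * c ^ 4)"
        unfolding qB by (intro sum_mono mult_mono mult_left_mono e2 q2_le mult_right_mono r2_nonneg mult_nonneg_nonneg) (auto simp: r2_nonneg)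
      also have "\<dots> = (\<Sum>i\<in>UNIV. 8 * c ^ 4 * g\<^sup>2 * r2 i)" by (simp add: mult_ac)
      finally show ?thesis by (simp add: RR_def sum_distrib_left[symmetric])
    qed
    show "(\<Sum>i\<in>UNIV. \<Sum>j\<in>UNIV. \<Sum>k\<in>UNIV. 6 * ((if j = k then 0 else B i j * B i k)\<^sup>2 * ?E 8 i)) \<le> 6 * \<kappa> * g\<^sup>2 * RR"
    proof -
      have "(\<Sum>i\<in>UNIV. \<Sum>j\<in>UNIV. \<Sum>k\<in>UNIV. 6 * ((if j = k then 0 else B i j * B i k)\<^sup>2 * ?E 8 i))
          \<le> (\<Sum>i\<in>UNIV. \<Sum>j\<in>UNIV. \<Sum>k\<in>UNIV. 6 * (((B i j)\<^sup>2 * (B i k)\<^sup>2) * ?E 8 i))"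
        by (intro sum_mono mult_left_mono mult_right_mono) (auto simp: power_mult_distrib)
      also have "\<dots> = (\<Sum>i\<in>UNIV. 6 * ((r2 i)\<^sup>2 * ?E 8 i))"
      proof (rule sum.cong[OF refl])
        fix i
        have rr: "(r2 i)\<^sup>2 = (\<Sum>j\<in>UNIV. \<Sum>k\<in>UNIV. (B i j)\<^sup>2 * (B i k)\<^sup>2)"
          unfolding r2_def power2_eq_square[of "\<Sum>j\<in>UNIV. (B i j)\<^sup>2"] sum_product ..
        show "(\<Sum>j\<in>UNIV. \<Sum>k\<in>UNIV. 6 * (((B i j)\<^sup>2 * (B i k)\<^sup>2) * ?E 8 i)) = 6 * ((r2 i)\<^sup>2 * ?E 8 i)"
          unfolding rr by (simp only: sum_distrib_left sum_distrib_right)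
      qed
      also have "\<dots> \<le> (\<Sum>i\<in>UNIV. 6 * (\<kappa> * g\<^sup>2 * r2 i))"
        by (intro sum_mono mult_left_mono r4 e2) auto
      also have "\<dots> = 6 * \<kappa> * g\<^sup>2 * RR"
        unfolding RR_def sum_distrib_left by (intro sum.cong refl) (simp only: mult_ac)
      finally show ?thesis .
    qed
  qed
  also have "\<dots> = g\<^sup>2 * ((10 * \<kappa> + 4 * \<Delta> + 8 * \<kappa> * \<Delta> + 32 + 8 * c ^ 4) * RR + (24 * c ^ 4 + 36 + 8 * c\<^sup>2) * DD)"
    by algebra
  finally show ?thesis .
qed

lemma T_variance:
  "sqi P (\<lambda>x. T x - sigma2)"
  "(\<integral>x. (T x - sigma2)\<^sup>2 \<partial>P) \<le> (96 * c ^ 4 + 32 * c\<^sup>2 + 144) * g\<^sup>2 * sigma2"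
proof -
  have eq: "T x - sigma2 = 2 * R x" for x by (simp add: T_expand)
  show "sqi P (\<lambda>x. T x - sigma2)" unfolding eq by (intro sqi_cmult R_sqi)
  have num: "4 * (10 * \<kappa> + 4 * \<Delta> + 8 * \<kappa> * \<Delta> + 32 + 8 * c ^ 4) \<le> 2 * (96 * c ^ 4 + 32 * c\<^sup>2 + 144)"
  proof -
    have "2 * (96 * c ^ 4 + 32 * c\<^sup>2 + 144) - 4 * (10 * \<kappa> + 4 * \<Delta> + 8 * \<kappa> * \<Delta> + 32 + 8 * c ^ 4)
        = 64 * c ^ 4 + 104 * c\<^sup>2 + 184"
      by (simp add: algebra_simps power2_eq_square power4_eq_xxxx)
    moreover have "0 \<le> c ^ 4" "0 \<le> c\<^sup>2" by simp_all
    ultimately show ?thesis by linarith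
  qed
  have "(\<integral>x. (T x - sigma2)\<^sup>2 \<partial>P) = 4 * (\<integral>x. (R x)\<^sup>2 \<partial>P)"
    unfolding eq power_mult_distrib by simp
  also have "\<dots> \<le> 4 * (g\<^sup>2 * ((10 * \<kappa> + 4 * \<Delta> + 8 * \<kappa> * \<Delta> + 32 + 8 * c ^ 4) * RR
     + (24 * c ^ 4 + 36 + 8 * c\<^sup>2) * DD))"
    by (intro mult_left_mono R_bound) simp
  also have "\<dots> = g\<^sup>2 * (4 * (10 * \<kappa> + 4 * \<Delta> + 8 * \<kappa> * \<Delta> + 32 + 8 * c ^ 4) * RR
     + (96 * c ^ 4 + 32 * c\<^sup>2 + 144) * DD)" by algebra
  also have "\<dots> \<le> g\<^sup>2 * (2 * (96 * c ^ 4 + 32 * c\<^sup>2 + 144) * RR + (96 * c ^ 4 + 32 * c\<^sup>2 + 144) * DD)"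
    by (intro mult_left_mono add_mono mult_right_mono num RR_nonneg) auto
  also have "\<dots> = (96 * c ^ 4 + 32 * c\<^sup>2 + 144) * g\<^sup>2 * sigma2"
    unfolding sigma2_eq by algebra
  finally show "(\<integral>x. (T x - sigma2)\<^sup>2 \<partial>P) \<le> (96 * c ^ 4 + 32 * c\<^sup>2 + 144) * g\<^sup>2 * sigma2" .
qed

lemma sigma2_lower: "4 * (RR + (\<Sum>i\<in>UNIV. (q i)\<^sup>2)) \<le> (9 * c\<^sup>2 - 5) * sigma2"
proof -
  have c2: "1 \<le> c\<^sup>2" using c_ge_1 by simp
  have "4 * RR \<le> (9 * c\<^sup>2 - 5) * (2 * RR)"
    using mult_right_mono[of 2 "9 * c\<^sup>2 - 5" "2 * RR"] c2 RR_nonneg by simp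
  moreover have "4 * (\<Sum>i\<in>UNIV. (q i)\<^sup>2) \<le> (9 * c\<^sup>2 - 5) * DD"
  proof -
    have "4 * (\<Sum>i\<in>UNIV. (q i)\<^sup>2) = (\<Sum>i\<in>UNIV. (q i)\<^sup>2 * 4)" by (simp add: sum_distrib_left mult.commute)
    also have "\<dots> \<le> (\<Sum>i\<in>UNIV. (q i)\<^sup>2 * ((9 * c\<^sup>2 - 5) * L.\<delta> i))"
      by (intro sum_mono mult_left_mono L.delta_lower) auto
    also have "\<dots> = (9 * c\<^sup>2 - 5) * DD"
      unfolding DD_def sum_distrib_left by (intro sum.cong refl) (simp only: mult_ac)
    finally show ?thesis .
  qed
  ultimately show ?thesis unfolding sigma2_eq distrib_left by linarith
qed

end

section \<open>Stein's equation and the total variation distance\<close>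

text \<open>Mills' inequality turns bounds on \<open>a\<close> into the same bounds on \<open>w\<close> times the solution, because the
  interval contains 0.\<close>

lemma mills_interval:
  assumes a: "\<And>y. - m \<le> a y" "\<And>y. a y \<le> 1 - m" and m: "0 \<le> m" "m \<le> 1"
    and ai: "integrable \<nu> a" and w: "w > 0"
  shows "- m \<le> w * (gtail a w / \<gamma> w)" "w * (gtail a w / \<gamma> w) \<le> 1 - m"
proof -
  let ?t = "(\<integral>y. indicator {w<..} y \<partial>\<nu>) :: real"
  have i1: "integrable \<nu> (indicator {w<..} :: real \<Rightarrow> real)"
    by (auto intro!: integrable_real_indicator nu_emeasure_finite)
  have ia: "integrable \<nu> (\<lambda>y. indicator {w<..} y * a y)"
    using integrable_mult_indicator[of "{w<..}" \<nu> a] ai by simp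
  have t0: "0 \<le> ?t" by (intro Bochner_Integration.integral_nonneg_AE) simp
  have "w * (?t / \<gamma> w) \<le> w * ((\<gamma> w / w) / \<gamma> w)"
    using mills[OF w] w gamma_pos[of w] by (intro mult_left_mono divide_right_mono) (auto simp: less_imp_le)
  also have "\<dots> = 1" using w gamma_pos[of w] by simp
  finally have t: "0 \<le> ?t" "w * (?t / \<gamma> w) \<le> 1" using t0 by auto
  have t': "0 \<le> w * (?t / \<gamma> w)" using t(1) w gamma_pos[of w] by simp
  have "gtail a w \<le> (\<integral>y. (1 - m) * indicator {w<..} y \<partial>\<nu>)"
    unfolding gtail_def
    by (rule integral_mono[OF ia Bochner_Integration.integrable_mult_right[OF i1]])
      (use a(2) in \<open>auto simp: indicator_def\<close>)
  then have "w * (gtail a w / \<gamma> w) \<le> w * ((1 - m) * ?t / \<gamma> w)"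
    using w gamma_pos[of w] by (intro mult_left_mono divide_right_mono) (auto simp: less_imp_le)
  also have "\<dots> = (1 - m) * (w * (?t / \<gamma> w))" by simp
  also have "\<dots> \<le> (1 - m) * 1" using t(2) m by (intro mult_left_mono) auto
  finally show "w * (gtail a w / \<gamma> w) \<le> 1 - m" by simp
  have "(\<integral>y. (- m) * indicator {w<..} y \<partial>\<nu>) \<le> gtail a w"
    unfolding gtail_def
    by (rule integral_mono[OF Bochner_Integration.integrable_mult_right[OF i1] ia])
      (use a(1) in \<open>auto simp: indicator_def\<close>)
  then have "w * ((- m) * ?t / \<gamma> w) \<le> w * (gtail a w / \<gamma> w)"
    using w gamma_pos[of w] by (intro mult_left_mono divide_right_mono) (auto simp: less_imp_le)
  moreover have "w * ((- m) * ?t / \<gamma> w) = - (m * (w * (?t / \<gamma> w)))" by simp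
  moreover have "m * (w * (?t / \<gamma> w)) \<le> m * 1" using t(2) m by (intro mult_left_mono) auto
  ultimately show "- m \<le> w * (gtail a w / \<gamma> w)" by linarith
qed

text \<open>With \<open>m\<close> the Gaussian mean of \<open>h\<close>, both \<open>h - m\<close> and \<open>w gstein (h - m) w\<close> lie in \<open>[-m, 1 - m]\<close>, so their
  difference \<open>\<phi>'\<close> lies in \<open>[-1, 1]\<close>.\<close>

lemma stein_solution:
  fixes h :: "real \<Rightarrow> real"
  assumes cont: "continuous_on UNIV h" and h: "\<And>x. 0 \<le> h x" "\<And>x. h x \<le> 1"
  obtains \<phi> \<phi>' where "\<And>w. (\<phi> has_real_derivative \<phi>' w) (at w)" "continuous_on UNIV \<phi>'"
    "\<And>w. \<bar>\<phi>' w\<bar> \<le> 1" "\<And>w. \<phi>' w - w * \<phi> w = h w - (\<integral>x. h x \<partial>\<nu>)"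
proof -
  interpret prob_space \<nu> by (rule nu_prob)
  have [measurable]: "h \<in> borel_measurable borel" by (rule borel_measurable_continuous_onI[OF cont])
  have hi: "integrable \<nu> h"
    by (rule integrable_const_bound[of _ 1]) (use h in auto)
  define m where "m = (\<integral>x. h x \<partial>\<nu>)"
  have m0: "0 \<le> m" unfolding m_def using h(1) by simp
  have m1: "m \<le> 1" unfolding m_def
    using integral_mono[OF hi, of "\<lambda>_. 1"] h(2) prob_space by simp
  define a where "a x = h x - m" for x
  have ac: "continuous_on UNIV a" unfolding a_def by (intro continuous_intros cont)
  have ai: "integrable \<nu> a" unfolding a_def using hi by simp
  have [measurable]: "a \<in> borel_measurable borel" by (rule borel_measurable_continuous_onI[OF ac])
  have a0: "(\<integral>x. a x \<partial>\<nu>) = 0" unfolding a_def using hi prob_space by (simp add: m_def)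
  have ab: "- m \<le> a x" "a x \<le> 1 - m" for x using h[of x] by (simp_all add: a_def)
  define \<phi> where "\<phi> w = - gstein a w" for w
  define \<phi>' where "\<phi>' w = a w - w * gstein a w" for w
  have bnd: "- m \<le> w * gstein a w" "w * gstein a w \<le> 1 - m" for w
  proof -
    have "- m \<le> w * gstein a w \<and> w * gstein a w \<le> 1 - m"
    proof (cases w "0 :: real" rule: linorder_cases)
      case greater
      then show ?thesis using mills_interval[OF ab m0 m1 ai] unfolding gstein_def by blast
    next
      case equal
      then show ?thesis using m0 m1 by simp
    next
      case less
      have "integrable \<nu> (\<lambda>y. a (- y))" using nu_reflect(2)[of a] ai by simp
      then have "- m \<le> (- w) * (gtail (\<lambda>y. a (- y)) (- w) / \<gamma> (- w)) \<and>
          (- w) * (gtail (\<lambda>y. a (- y)) (- w) / \<gamma> (- w)) \<le> 1 - m"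
        using mills_interval[of m "\<lambda>y. a (- y)" "- w"] ab m0 m1 less by auto
      moreover have "gtail a w = - gtail (\<lambda>y. a (- y)) (- w)"
        using gtail_reflect[OF _ ai a0, of "- w"] by simp
      ultimately show ?thesis by (simp add: gstein_def std_normal_density_def)
    qed
    then show "- m \<le> w * gstein a w" "w * gstein a w \<le> 1 - m" by auto
  qed
  show thesis
  proof
    show "(\<phi> has_real_derivative \<phi>' w) (at w)" for w
      unfolding \<phi>_def[abs_def] \<phi>'_def
      by (rule derivative_eq_intros gstein_deriv[OF ac ai] refl)+ simp
    show "continuous_on UNIV \<phi>'"
      unfolding \<phi>'_def[abs_def] by (intro continuous_intros ac gstein_cont ai)
    show "\<bar>\<phi>' w\<bar> \<le> 1" for w
      unfolding \<phi>'_def using ab[of w] bnd[of w] by (intro abs_leI) linarith+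
    show "\<phi>' w - w * \<phi> w = h w - (\<integral>x. h x \<partial>\<nu>)" for w
      by (simp add: \<phi>_def \<phi>'_def a_def m_def)
  qed
qed

text \<open>
  The indicator of a compact set is a decreasing limit of continuous functions, and inner regularity
  passes from compact to Borel sets.
\<close>

lemma measure_le_of_continuous:
  fixes \<mu> \<mu>' :: "real measure"
  assumes \<mu>: "prob_space \<mu>" "sets \<mu> = sets borel" and \<mu>': "prob_space \<mu>'" "sets \<mu>' = sets borel"
    and le: "\<And>h. continuous_on UNIV h \<Longrightarrow> (\<And>x. 0 \<le> h x) \<Longrightarrow> (\<And>x. h x \<le> 1) \<Longrightarrow>
      (\<integral>x. h x \<partial>\<mu>) \<le> (\<integral>x. h x \<partial>\<mu>') + b"
    and A: "A \<in> sets borel"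
  shows "measure \<mu> A \<le> measure \<mu>' A + b"
proof -
  interpret m: prob_space \<mu> by fact
  interpret m': prob_space \<mu>' by fact
  have cm[measurable_cong]: "sets \<mu> = sets borel" "sets \<mu>' = sets borel" by fact+
  have compact: "measure \<mu> K \<le> measure \<mu>' K + b" if K: "compact K" for K
  proof (cases "K = {}")
    case True
    then show ?thesis using le[of "\<lambda>_. 0"] by simp
  next
    case False
    define h where "h n x = max 0 (1 - real n * infdist x K)" for n :: nat and x :: real
    have hc: "continuous_on UNIV (h n)" for n
      unfolding h_def by (intro continuous_intros)
    have [measurable]: "h n \<in> borel_measurable borel" for n
      by (rule borel_measurable_continuous_onI[OF hc])
    have [measurable]: "K \<in> sets borel" using K by (simp add: borel_compact)
    have h01: "0 \<le> h n x" "h n x \<le> 1" for n x unfolding h_def by (auto simp: infdist_nonneg)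
    have lim: "(\<lambda>n. h n x) \<longlonglongrightarrow> indicator K x" for x
    proof (cases "x \<in> K")
      case True
      then show ?thesis by (simp add: h_def)
    next
      case nK: False
      have pos: "0 < infdist x K"
        using nK False K by (simp add: infdist_pos_not_in_closed compact_imp_closed)
      then obtain n0 :: nat where n0: "1 / infdist x K < real n0" using reals_Archimedean2 by blast
      have "\<forall>\<^sub>F n in sequentially. h n x = indicator K x"
      proof (rule eventually_sequentiallyI[of n0])
        fix n assume "n0 \<le> n"
        then have "1 / infdist x K \<le> real n" using n0 by linarith
        then have "1 \<le> real n * infdist x K" using pos by (simp add: field_simps)
        then show "h n x = indicator K x" using nK by (simp add: h_def)
      qed
      then show ?thesis by (rule tendsto_eventually)
    qed
    have "(\<lambda>n. \<integral>x. h n x \<partial>\<mu>) \<longlonglongrightarrow> (\<integral>x. indicator K x \<partial>\<mu>)"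
      by (rule integral_dominated_convergence[where w = "\<lambda>_. 1"]) (use lim h01 in auto)
    moreover have "(\<lambda>n. (\<integral>x. h n x \<partial>\<mu>') + b) \<longlonglongrightarrow> (\<integral>x. indicator K x \<partial>\<mu>') + b"
      by (intro tendsto_intros integral_dominated_convergence[where w = "\<lambda>_. 1"]) (use lim h01 in auto)
    ultimately have "(\<integral>x. indicator K x \<partial>\<mu>) \<le> (\<integral>x. indicator K x \<partial>\<mu>') + b"
      by (rule LIMSEQ_le) (use le[OF hc h01] in auto)
    then show ?thesis by simp
  qed
  show ?thesis
  proof (rule field_le_epsilon)
    fix \<epsilon> :: real assume \<epsilon>: "0 < \<epsilon>"
    have "emeasure \<mu> A = (SUP K\<in>{K. K \<subseteq> A \<and> compact K}. emeasure \<mu> K)"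
      by (rule inner_regular[OF cm(1) _ A]) simp
    have "\<exists>K. K \<subseteq> A \<and> compact K \<and> measure \<mu> A < measure \<mu> K + \<epsilon>"
    proof (rule ccontr)
      assume no: "\<not> ?thesis"
      have bd: "measure \<mu> K \<le> measure \<mu> A - \<epsilon>" if "K \<subseteq> A" "compact K" for K
      proof -
        have "\<not> measure \<mu> A < measure \<mu> K + \<epsilon>" using no that by blast
        then show ?thesis by linarith
      qed
      have nn: "0 \<le> measure \<mu> A - \<epsilon>" using bd[of "{}"] by simp
      have "emeasure \<mu> A \<le> ennreal (measure \<mu> A - \<epsilon>)"
        unfolding \<open>emeasure \<mu> A = _\<close>
        by (rule SUP_least) (use bd in \<open>auto simp: m.emeasure_eq_measure intro!: ennreal_leI\<close>)
      then show False using \<epsilon> nn by (simp add: m.emeasure_eq_measure)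
    qed
    then obtain K where K: "K \<subseteq> A" "compact K" "measure \<mu> A < measure \<mu> K + \<epsilon>" by blast
    have "measure \<mu> K \<le> measure \<mu>' K + b" by (rule compact[OF K(2)])
    moreover have "measure \<mu>' K \<le> measure \<mu>' A"
      by (rule m'.finite_measure_mono[OF K(1)]) (use A cm in simp)
    ultimately show "measure \<mu> A \<le> measure \<mu>' A + b + \<epsilon>" using K(3) by simp
  qed
qed

lemma tv_dist_le:
  fixes \<mu> \<mu>' :: "real measure"
  assumes \<mu>: "prob_space \<mu>" "sets \<mu> = sets borel" and \<mu>': "prob_space \<mu>'" "sets \<mu>' = sets borel"
    and le: "\<And>h. continuous_on UNIV h \<Longrightarrow> (\<And>x. 0 \<le> h x) \<Longrightarrow> (\<And>x. h x \<le> 1) \<Longrightarrow>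
      \<bar>(\<integral>x. h x \<partial>\<mu>) - (\<integral>x. h x \<partial>\<mu>')\<bar> \<le> b"
  shows "tv_dist \<mu> \<mu>' \<le> b"
  unfolding tv_dist_def
proof (rule cSUP_least)
  fix A assume "A \<in> sets \<mu>"
  then have A: "A \<in> sets borel" using \<mu> by simp
  have "measure \<mu> A \<le> measure \<mu>' A + b"
  proof (rule measure_le_of_continuous[OF \<mu> \<mu>' _ A])
    fix h :: "real \<Rightarrow> real" assume "continuous_on UNIV h" "\<And>x. 0 \<le> h x" "\<And>x. h x \<le> 1"
    from le[OF this] show "(\<integral>x. h x \<partial>\<mu>) \<le> (\<integral>x. h x \<partial>\<mu>') + b" by linarith
  qed
  moreover have "measure \<mu>' A \<le> measure \<mu> A + b"
  proof (rule measure_le_of_continuous[OF \<mu>' \<mu> _ A])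
    fix h :: "real \<Rightarrow> real" assume "continuous_on UNIV h" "\<And>x. 0 \<le> h x" "\<And>x. h x \<le> 1"
    from le[OF this] show "(\<integral>x. h x \<partial>\<mu>') \<le> (\<integral>x. h x \<partial>\<mu>) + b" by linarith
  qed
  ultimately show "\<bar>measure \<mu> A - measure \<mu>' A\<bar> \<le> b" by (intro abs_leI) linarith+
qed auto

context gauss_quadratic_bounded begin

lemma W_mean: "(\<integral>x. W x \<partial>P) = 0"
  using stein_identity(1)[of "\<lambda>_. 1" "\<lambda>_. 0" 0] by simp

lemma W_variance: "(\<integral>x. (W x)\<^sup>2 \<partial>P) = sigma2"
  using stein_identity(1)[of "\<lambda>w. w" "\<lambda>_. 1" 1] T_mean by (simp add: power2_eq_square)

text \<open>By Stein's equation, the error at a test function is \<open>E[\<phi>'(W / s) (\<sigma>\<^sup>2 - T)] / \<sigma>\<^sup>2\<close> with \<open>s\<^sup>2 = \<sigma>\<^sup>2\<close>; the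
  claim follows from \<open>\<bar>\<phi>'\<bar> \<le> 1\<close> and Cauchy-Schwarz.\<close>

lemma tv_bound:
  assumes pos: "0 < sigma2"
  shows "tv_dist (distr P borel (\<lambda>x. W x / sqrt sigma2)) \<nu>
    \<le> sqrt (96 * c ^ 4 + 32 * c\<^sup>2 + 144) * g / sqrt sigma2"
proof (rule tv_dist_le)
  interpret prob_space P by (rule gauss_prob)
  show "prob_space (distr P borel (\<lambda>x. W x / sqrt sigma2))"
    by (rule prob_space_distr) simp
  show "prob_space \<nu>" by (rule nu_prob)
  fix h :: "real \<Rightarrow> real"
  assume cont: "continuous_on UNIV h" and h: "\<And>x. 0 \<le> h x" "\<And>x. h x \<le> 1"
  obtain \<phi> \<phi>' where \<phi>: "\<And>w. (\<phi> has_real_derivative \<phi>' w) (at w)" "continuous_on UNIV \<phi>'"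
    "\<And>w. \<bar>\<phi>' w\<bar> \<le> 1" "\<And>w. \<phi>' w - w * \<phi> w = h w - (\<integral>x. h x \<partial>\<nu>)"
    using stein_solution[OF cont h] by blast
  define s where "s = sqrt sigma2"
  have s: "0 < s" "s\<^sup>2 = sigma2" using pos by (simp_all add: s_def)
  have [measurable]: "h \<in> borel_measurable borel" by (rule borel_measurable_continuous_onI[OF cont])
  have [measurable]: "\<phi>' \<in> borel_measurable borel" by (rule borel_measurable_continuous_onI[OF \<phi>(2)])
  have \<phi>s: "((\<lambda>w. \<phi> (w / s)) has_real_derivative \<phi>' (w / s) / s) (at w)" for w
  proof -
    have d: "((\<lambda>w. w / s) has_real_derivative 1 / s) (at w)"
      using s(1) by (auto intro!: derivative_eq_intros)
    show ?thesis using DERIV_chain2[OF \<phi>(1) d] by simp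
  qed
  have \<phi>'s: "continuous_on UNIV (\<lambda>w. \<phi>' (w / s) / s)"
    by (intro continuous_intros continuous_on_compose2[OF \<phi>(2)]) (use s in auto)
  have b: "\<bar>\<phi>' (w / s) / s\<bar> \<le> 1 / s" for w
    using \<phi>(3)[of "w / s"] s by (simp add: abs_divide divide_right_mono)
  note si = stein_identity[OF \<phi>s \<phi>'s b]
  have iphi: "integrable P (\<lambda>x. \<phi>' (W x / s))"
    by (rule integrable_const_bound[of _ 1]) (use \<phi>(3) in auto)
  have iT: "integrable P (\<lambda>x. T x * \<phi>' (W x / s))"
    using Bochner_Integration.integrable_mult_right[OF si(3), of s] s by simp
  have iW: "integrable P (\<lambda>x. W x / s * \<phi> (W x / s))"
    using Bochner_Integration.integrable_mult_right[OF si(2), of "1 / s"] by simp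
  have idW: "(\<integral>x. W x / s * \<phi> (W x / s) \<partial>P) = (\<integral>x. T x * \<phi>' (W x / s) \<partial>P) / sigma2"
  proof -
    have "(\<integral>x. W x / s * \<phi> (W x / s) \<partial>P) = (\<integral>x. W x * \<phi> (W x / s) \<partial>P) / s" by simp
    also have "\<dots> = (\<integral>x. T x * \<phi>' (W x / s) \<partial>P) / (s * s)" unfolding si(1) by simp
    finally show ?thesis using s by (simp add: power2_eq_square)
  qed
  have iTs: "integrable P (\<lambda>x. T x - sigma2)" by (rule sqi_integrable[OF gauss_prob T_variance(1)])
  have "(\<integral>x. h x \<partial>distr P borel (\<lambda>x. W x / s)) - (\<integral>x. h x \<partial>\<nu>) = (\<integral>x. h (W x / s) - (\<integral>x. h x \<partial>\<nu>) \<partial>P)"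
  proof -
    have "integrable P (\<lambda>x. h (W x / s))"
      by (rule integrable_const_bound[of _ 1]) (use h in auto)
    then show ?thesis using prob_space by (simp add: integral_distr)
  qed
  also have "\<dots> = (\<integral>x. \<phi>' (W x / s) - W x / s * \<phi> (W x / s) \<partial>P)" unfolding \<phi>(4) ..
  also have "\<dots> = (\<integral>x. \<phi>' (W x / s) \<partial>P) - (\<integral>x. T x * \<phi>' (W x / s) \<partial>P) / sigma2"
    using iphi iW idW by simp
  also have "\<dots> = - ((\<integral>x. (T x - sigma2) * \<phi>' (W x / s) \<partial>P) / sigma2)"
    using iphi iT pos by (simp add: left_diff_distrib diff_divide_distrib)
  finally have "\<bar>(\<integral>x. h x \<partial>distr P borel (\<lambda>x. W x / s)) - (\<integral>x. h x \<partial>\<nu>)\<bar>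
      = \<bar>\<integral>x. (T x - sigma2) * \<phi>' (W x / s) \<partial>P\<bar> / sigma2"
    using pos by (simp add: abs_divide)
  also have "\<dots> \<le> (\<integral>x. \<bar>T x - sigma2\<bar> \<partial>P) / sigma2"
  proof (rule divide_right_mono)
    have "\<bar>\<integral>x. (T x - sigma2) * \<phi>' (W x / s) \<partial>P\<bar> \<le> (\<integral>x. \<bar>(T x - sigma2) * \<phi>' (W x / s)\<bar> \<partial>P)"
      by (rule integral_abs_bound)
    also have "\<dots> \<le> (\<integral>x. \<bar>T x - sigma2\<bar> \<partial>P)"
    proof (rule integral_mono)
      have "integrable P (\<lambda>x. (T x - sigma2) * \<phi>' (W x / s))"
        unfolding left_diff_distrib using iT iphi by simp
      then show "integrable P (\<lambda>x. \<bar>(T x - sigma2) * \<phi>' (W x / s)\<bar>)" by simp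
      show "\<bar>(T x - sigma2) * \<phi>' (W x / s)\<bar> \<le> \<bar>T x - sigma2\<bar>" for x
        using mult_left_mono[OF \<phi>(3)[of "W x / s"], of "\<bar>T x - sigma2\<bar>"] by (simp add: abs_mult)
    qed (use iTs in simp)
    finally show "\<bar>\<integral>x. (T x - sigma2) * \<phi>' (W x / s) \<partial>P\<bar> \<le> (\<integral>x. \<bar>T x - sigma2\<bar> \<partial>P)" .
  qed (use pos in simp)
  also have "\<dots> \<le> sqrt ((96 * c ^ 4 + 32 * c\<^sup>2 + 144) * g\<^sup>2 * sigma2) / sigma2"
  proof (rule divide_right_mono)
    have "(\<integral>x. \<bar>T x - sigma2\<bar> * 1 \<partial>P)\<^sup>2 \<le> (\<integral>x. \<bar>T x - sigma2\<bar>\<^sup>2 \<partial>P) * (\<integral>x. 1\<^sup>2 \<partial>P)"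
      by (rule integral_Cauchy_Schwarz) (use T_variance(1) in \<open>auto simp: sqi_def\<close>)
    then have "(\<integral>x. \<bar>T x - sigma2\<bar> \<partial>P)\<^sup>2 \<le> (96 * c ^ 4 + 32 * c\<^sup>2 + 144) * g\<^sup>2 * sigma2"
      using T_variance(2) prob_space by simp
    then show "(\<integral>x. \<bar>T x - sigma2\<bar> \<partial>P) \<le> sqrt ((96 * c ^ 4 + 32 * c\<^sup>2 + 144) * g\<^sup>2 * sigma2)"
      by (rule real_le_rsqrt)
  qed (use pos in simp)
  also have "\<dots> = sqrt (96 * c ^ 4 + 32 * c\<^sup>2 + 144) * g / sqrt sigma2"
  proof -
    have "sqrt sigma2 / sigma2 = 1 / sqrt sigma2"
      using pos by (simp add: field_simps)
    moreover have "sqrt (K * g\<^sup>2 * sigma2) / sigma2 = sqrt K * g * (sqrt sigma2 / sigma2)" for K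
      using g_nonneg by (simp add: real_sqrt_mult)
    ultimately show ?thesis by simp
  qed
  finally show "\<bar>(\<integral>x. h x \<partial>distr P borel (\<lambda>x. W x / sqrt sigma2)) - (\<integral>x. h x \<partial>\<nu>)\<bar>
      \<le> sqrt (96 * c ^ 4 + 32 * c\<^sup>2 + 144) * g / sqrt sigma2" unfolding s_def .
qed simp_all

text \<open>The variance bound is at most \<open>299 c\<^sup>6\<close> after division by the lower bound \<open>4 / (9 c\<^sup>2 - 5)\<close> for the
  \<open>\<delta>\<^sub>i\<close>, because \<open>c \<ge> 1\<close>: the difference of the two sides is a polynomial in \<open>c\<^sup>2 - 1\<close> with
  nonnegative coefficients.\<close>

lemma tv_bound_ratio:
  assumes Fr: "0 < Fr" "Fr\<^sup>2 = RR + (\<Sum>i\<in>UNIV. (q i)\<^sup>2)"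
  shows "0 < sigma2"
    and "tv_dist (distr P borel (\<lambda>x. W x / sqrt sigma2)) \<nu> \<le> sqrt 299 * c ^ 3 * (g / Fr)"
proof -
  have c2: "1 \<le> c\<^sup>2" using c_ge_1 by simp
  have F2: "0 < Fr\<^sup>2" by (rule zero_less_power[OF Fr(1)])
  have low: "4 * Fr\<^sup>2 \<le> (9 * c\<^sup>2 - 5) * sigma2" using sigma2_lower Fr by simp
  have "0 < (9 * c\<^sup>2 - 5) * sigma2" using low F2 by linarith
  then show pos: "0 < sigma2" using c2 by (simp add: zero_less_mult_iff)
  let ?K = "96 * c ^ 4 + 32 * c\<^sup>2 + 144"
  have num: "?K * (9 * c\<^sup>2 - 5) \<le> 4 * 299 * c ^ 6"
  proof -
    define y where "y = c\<^sup>2 - 1"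
    have y: "0 \<le> y" "c\<^sup>2 = y + 1" using c2 by (simp_all add: y_def)
    have c4: "c ^ 4 = (y + 1)\<^sup>2" and c6: "c ^ 6 = (y + 1) ^ 3"
      unfolding y(2)[symmetric] by (simp_all flip: power_mult)
    have "4 * 299 * c ^ 6 - ?K * (9 * c\<^sup>2 - 5) = 332 * y ^ 3 + 1188 * y\<^sup>2 + 244 * y + 108"
      unfolding c4 c6 y(2) by (simp add: power2_eq_square power3_eq_cube algebra_simps)
    moreover have "0 \<le> y ^ 3" "0 \<le> y\<^sup>2" using y by simp_all
    ultimately show ?thesis using y by linarith
  qed
  have "?K / sigma2 \<le> 299 * c ^ 6 / Fr\<^sup>2"
  proof -
    have "4 * (?K * Fr\<^sup>2) \<le> ?K * ((9 * c\<^sup>2 - 5) * sigma2)"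
      using mult_left_mono[OF low, of ?K] by (simp add: mult_ac)
    also have "\<dots> \<le> (4 * 299 * c ^ 6) * sigma2"
      using mult_right_mono[OF num, of sigma2] pos by (simp add: mult_ac)
    finally show ?thesis using pos F2 by (simp add: field_simps)
  qed
  then have "sqrt (?K / sigma2) \<le> sqrt (299 * c ^ 6 / Fr\<^sup>2)" by (rule real_sqrt_le_mono)
  moreover have "sqrt (c ^ 6) = c ^ 3"
    using c_ge_1 by (intro real_sqrt_unique) (auto simp flip: power_mult)
  ultimately have "sqrt ?K / sqrt sigma2 \<le> sqrt 299 * c ^ 3 / Fr"
    using Fr(1) by (simp add: real_sqrt_divide real_sqrt_mult)
  from mult_right_mono[OF this g_nonneg]
  show "tv_dist (distr P borel (\<lambda>x. W x / sqrt sigma2)) \<nu> \<le> sqrt 299 * c ^ 3 * (g / Fr)"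
    by (intro order_trans[OF tv_bound[OF pos]]) (simp add: mult_ac)
qed

end

section \<open>Gaussian vectors\<close>

lemma norm_vec_squared: "(norm (v :: real ^ 'n))\<^sup>2 = (\<Sum>i\<in>UNIV. (v $ i)\<^sup>2)"
  unfolding power2_norm_eq_inner inner_vec_def by (simp add: power2_eq_square)

lemma measurable_vec_nth: "(\<lambda>x :: real ^ 'n. x $ i) \<in> borel_measurable borel"
  by (intro borel_measurable_continuous_onI continuous_intros)

lemma std_normal_vec_density_prod:
  "std_normal_vec_density (x :: real ^ 'n) = (\<Prod>i\<in>UNIV. \<gamma> (x $ i))"
proof -
  have "(\<Prod>i\<in>UNIV. \<gamma> (x $ i)) = (\<Prod>i\<in>(UNIV::'n set). 1 / sqrt (2 * pi)) * (\<Prod>i\<in>UNIV. exp (- (x $ i)\<^sup>2 / 2))"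
    unfolding std_normal_density_def prod.distrib ..
  also have "(\<Prod>i\<in>(UNIV::'n set). 1 / sqrt (2 * pi)) = (2 * pi) powr (- real CARD('n) / 2)"
  proof -
    have "(1 / sqrt (2 * pi)) = (2 * pi) powr (- 1 / 2)"
      by (simp add: powr_minus_divide powr_half_sqrt)
    then show ?thesis by (simp add: powr_power powr_realpow[symmetric] powr_powr)
  qed
  also have "(\<Prod>i\<in>UNIV. exp (- (x $ i)\<^sup>2 / 2)) = exp (- (norm x)\<^sup>2 / 2)"
    by (simp add: exp_sum[symmetric] norm_vec_squared sum_negf sum_divide_distrib[symmetric])
  finally show ?thesis by (simp add: std_normal_vec_density_def)
qed

text \<open>The joint density factorises, so the coordinates are independent standard normal variables.\<close>

lemma std_normal_vec_law:
  fixes N :: "'a \<Rightarrow> real ^ 'n"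
  assumes N: "distributed M lborel N (\<lambda>x. ennreal (std_normal_vec_density x))"
  shows "(\<lambda>\<omega> i. N \<omega> $ i) \<in> measurable M (gauss_space :: ('n \<Rightarrow> real) measure)"
    and "distr M gauss_space (\<lambda>\<omega> i. N \<omega> $ i) = (gauss_space :: ('n \<Rightarrow> real) measure)"
proof -
  have [measurable]: "N \<in> borel_measurable M" using distributed_measurable[OF N] by simp
  show meas: "(\<lambda>\<omega> i. N \<omega> $ i) \<in> measurable M (gauss_space :: ('n \<Rightarrow> real) measure)"
    by (rule measurable_PiM_single')
      (auto simp: PiE_def extensional_def intro: measurable_compose[OF _ measurable_vec_nth])
  interpret product_sigma_finite "\<lambda>_::'n. \<nu>" by (rule nu_product)
  show "distr M gauss_space (\<lambda>\<omega> i. N \<omega> $ i) = (gauss_space :: ('n \<Rightarrow> real) measure)"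
  proof (rule PiM_eqI)
    fix A :: "'n \<Rightarrow> real set" assume A: "\<And>i. i \<in> UNIV \<Longrightarrow> A i \<in> sets \<nu>"
    then have [measurable]: "A i \<in> sets borel" for i by simp
    define idx :: "real ^ 'n \<Rightarrow> 'n" where "idx b = (SOME i. axis i 1 = b)" for b
    have idx: "idx (axis i 1) = i" for i
      unfolding idx_def by (simp add: axis_eq_axis)
    have bas: "(\<Prod>b\<in>(Basis :: (real ^ 'n) set). k b) = (\<Prod>i\<in>UNIV. k (axis i 1))" for k :: "real ^ 'n \<Rightarrow> ennreal"
    proof -
      have range: "(Basis :: (real ^ 'n) set) = (\<lambda>i. axis i 1) ` UNIV" unfolding Basis_vec_def by auto
      have inj: "inj (\<lambda>i :: 'n. axis i (1 :: real))" by (simp add: inj_on_def axis_eq_axis)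
      show ?thesis unfolding range prod.reindex[OF inj] by simp
    qed
    define S where "S = {x :: real ^ 'n. \<forall>i. x $ i \<in> A i}"
    have S[measurable]: "S \<in> sets borel" 
      unfolding S_def using measurable_vec_nth by measurable
    have "emeasure (distr M gauss_space (\<lambda>\<omega> i. N \<omega> $ i)) (Pi\<^sub>E UNIV A) = emeasure (distr M lborel N) S"
    proof -
      have "Pi\<^sub>E UNIV A \<in> sets (gauss_space :: ('n \<Rightarrow> real) measure)" using A by (intro sets_PiM_I_finite) auto
      then show ?thesis using meas
        by (auto simp: emeasure_distr S_def PiE_def extensional_def intro!: arg_cong[where f = "emeasure M"])
    qed
    also have "\<dots> = (\<integral>\<^sup>+x. ennreal (std_normal_vec_density x) * indicator S x \<partial>lborel)"
      unfolding distributed_distr_eq_density[OF N]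
      by (rule emeasure_density) (use distributed_borel_measurable[OF N] in auto)
    also have "\<dots> = (\<integral>\<^sup>+x. (\<Prod>b\<in>Basis. ennreal (\<gamma> (x \<bullet> b) * indicator (A (idx b)) (x \<bullet> b))) \<partial>lborel)"
    proof (rule nn_integral_cong)
      fix x :: "real ^ 'n"
      have "ennreal (std_normal_vec_density x) * indicator S x = ennreal (\<Prod>i\<in>UNIV. \<gamma> (x $ i) * indicator (A i) (x $ i))"
      proof -
        have "indicator S x = ennreal (\<Prod>i\<in>UNIV. indicator (A i) (x $ i))"
        proof (cases "x \<in> S")
          case True
          then show ?thesis by (simp add: S_def)
        next
          case False
          then obtain i where "x $ i \<notin> A i" by (auto simp: S_def)
          then have "(\<Prod>i\<in>UNIV. indicator (A i) (x $ i) :: real) = 0" by (intro prod_zero bexI[of _ i]) auto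
          then have "ennreal (\<Prod>i\<in>UNIV. indicator (A i) (x $ i)) = 0" by (simp only: ennreal_0)
          then show ?thesis using False by (metis indicator_simps(2))
        qed
        then show ?thesis unfolding std_normal_vec_density_prod prod.distrib
          by (simp add: ennreal_mult[symmetric] prod_nonneg)
      qed
      also have "\<dots> = (\<Prod>i\<in>UNIV. ennreal (\<gamma> (x $ i) * indicator (A i) (x $ i)))"
        by (simp add: prod_ennreal)
      also have "\<dots> = (\<Prod>b\<in>Basis. ennreal (\<gamma> (x \<bullet> b) * indicator (A (idx b)) (x \<bullet> b)))"
        unfolding bas idx by (simp add: inner_axis)
      finally show "ennreal (std_normal_vec_density x) * indicator S x
        = (\<Prod>b\<in>Basis. ennreal (\<gamma> (x \<bullet> b) * indicator (A (idx b)) (x \<bullet> b)))" .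
    qed
    also have "\<dots> = (\<Prod>b\<in>(Basis :: (real ^ 'n) set). \<integral>\<^sup>+y. ennreal (\<gamma> y * indicator (A (idx b)) y) \<partial>lborel)"
      using nn_integral_lborel_prod[of "\<lambda>b y. \<gamma> y * indicator (A (idx b)) y"] by simp
    also have "\<dots> = (\<Prod>i\<in>UNIV. \<integral>\<^sup>+y. ennreal (\<gamma> y * indicator (A i) y) \<partial>lborel)"
      unfolding bas idx ..
    also have "\<dots> = (\<Prod>i\<in>UNIV. emeasure \<nu> (A i))"
      by (intro prod.cong refl) (simp add: emeasure_density ennreal_mult' ennreal_indicator)
    finally show "emeasure (distr M gauss_space (\<lambda>\<omega> i. N \<omega> $ i)) (Pi\<^sub>E UNIV A) = (\<Prod>i\<in>UNIV. emeasure \<nu> (A i))" .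
  qed simp_all
qed

section \<open>The matrices of the linear model\<close>

lemma matrix_inv_invertible:
  assumes "invertible (A :: real ^ 'n ^ 'n)"
  shows "A ** matrix_inv A = mat 1" "matrix_inv A ** A = mat 1"
proof -
  have "A ** matrix_inv A = mat 1 \<and> matrix_inv A ** A = mat 1"
    unfolding matrix_inv_def by (rule someI_ex) (use assms in \<open>auto simp: invertible_def\<close>)
  then show "A ** matrix_inv A = mat 1" "matrix_inv A ** A = mat 1" by auto
qed

lemma diag_mat_mult_left: "(diag_mat v ** A) $ i $ j = v $ i * A $ i $ j"
  by (simp add: matrix_matrix_mult_def diag_mat_def if_distrib[of "\<lambda>a. a * _"] cong: if_cong)

lemma diag_mat_mult_right: "(A ** diag_mat v) $ i $ j = A $ i $ j * v $ j"
  by (simp add: matrix_matrix_mult_def diag_mat_def if_distrib[of "\<lambda>a. _ * a"] cong: if_cong)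

lemma ols_left_inverse:
  assumes "invertible (transpose X ** X)"
  shows "ols_mat X ** X = mat 1"
  unfolding ols_mat_def using matrix_inv_invertible(2)[OF assms] by (simp add: matrix_mul_assoc[symmetric])

lemma resid_mat_symmetric:
  assumes "invertible (transpose X ** X)"
  shows "transpose (resid_mat X) = resid_mat X"
proof -
  let ?K = "transpose X ** X" and ?J = "matrix_inv (transpose X ** X)"
  have K: "transpose ?K = ?K" by (simp add: matrix_transpose_mul)
  have "transpose ?J ** ?K = transpose (?K ** ?J)" by (simp add: matrix_transpose_mul K)
  also have "\<dots> = mat 1" using matrix_inv_invertible(1)[OF assms] by simp
  finally have left: "transpose ?J ** ?K = mat 1" .
  have "transpose ?J = transpose ?J ** (?K ** ?J)" using matrix_inv_invertible(1)[OF assms] by simp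
  also have "\<dots> = transpose ?J ** ?K ** ?J" by (rule matrix_mul_assoc)
  also have "\<dots> = ?J" unfolding left by simp
  finally have J: "transpose ?J = ?J" .
  have "transpose (A - B) = transpose A - transpose B" for A B :: "real ^ 'b ^ 'b"
    by (simp add: transpose_def vec_eq_iff)
  then show ?thesis unfolding resid_mat_def
    by (simp add: matrix_transpose_mul J matrix_mul_assoc)
qed

lemma resid_mat_symmetric_entry:
  assumes "invertible (transpose X ** X)"
  shows "resid_mat X $ a $ b = resid_mat X $ b $ a"
  using arg_cong[OF resid_mat_symmetric[OF assms], of "\<lambda>A. A $ b $ a"] by (simp add: transpose_def)

lemma resid_mat_annihilates:
  assumes "invertible (transpose X ** X)"
  shows "resid_mat X *v (X *v b) = 0"
proof -
  have "X ** matrix_inv (transpose X ** X) ** transpose X ** X = X"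
    using matrix_inv_invertible(2)[OF assms] by (simp add: matrix_mul_assoc[symmetric])
  then show ?thesis
    unfolding resid_mat_def matrix_vector_mult_diff_rdistrib by (simp add: matrix_vector_mul_assoc)
qed

lemma eps_hat_resid: "eps_hat X y = resid_mat X *v y"
  unfolding eps_hat_def beta_hat_def ols_mat_def resid_mat_def
  by (simp add: matrix_vector_mult_diff_rdistrib matrix_vector_mul_assoc matrix_mul_assoc)

text \<open>The estimator is the sum of the squared residuals with these weights.\<close>

definition weight :: "real ^ 'p ^ 'n \<Rightarrow> real ^ 'p \<Rightarrow> real ^ 'n" where
  "weight X w = ((w v* ols_mat X) \<odot>\<^sub>v (w v* ols_mat X)) v* matrix_inv (resid_mat X \<odot>\<^sub>m resid_mat X)"

lemma sandwich_diag_mat: "sandwich X w (diag_mat s) = ((w v* ols_mat X) \<odot>\<^sub>v (w v* ols_mat X)) \<bullet> s"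
proof -
  let ?a = "w v* ols_mat X"
  have "sandwich X w (diag_mat s) = w \<bullet> (ols_mat X *v (diag_mat s *v ?a))"
    unfolding sandwich_def by (simp add: matrix_vector_mul_assoc[symmetric])
  also have "\<dots> = ?a \<bullet> (diag_mat s *v ?a)" by (simp add: dot_lmul_matrix)
  also have "\<dots> = (?a \<odot>\<^sub>v ?a) \<bullet> s"
    by (simp add: inner_vec_def diag_mat_mult_vec mult_ac)
  finally show ?thesis .
qed

lemma sandwich_Sigma_hat:
  "sandwich X w (diag_mat (Sigma_hat X y)) = (\<Sum>k\<in>UNIV. weight X w $ k * (eps_hat X y $ k)\<^sup>2)"
  unfolding sandwich_diag_mat Sigma_hat_def dot_lmul_matrix[symmetric] weight_def[symmetric]
  by (simp add: inner_vec_def power2_eq_square)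

lemma G_mat_entry:
  assumes \<Sigma>: "is_diagonal \<Sigma>" "\<And>i. \<Sigma> $ i $ i > 0"
  shows "G_mat X \<Sigma> w $ i $ j = sqrt (\<Sigma> $ i $ i) * sqrt (\<Sigma> $ j $ j)
    * (\<Sum>k\<in>UNIV. resid_mat X $ i $ k * weight X w $ k * resid_mat X $ k $ j)"
    and "mat_sqrt \<Sigma> = diag_mat (\<chi> i. sqrt (\<Sigma> $ i $ i))"
proof -
  have S: "\<Sigma> = diag_mat (\<chi> i. \<Sigma> $ i $ i)"
    using \<Sigma>(1) by (auto simp: vec_eq_iff diag_mat_def is_diagonal_def)
  show root: "mat_sqrt \<Sigma> = diag_mat (\<chi> i. sqrt (\<Sigma> $ i $ i))"
    by (subst S) (use \<Sigma>(2) in \<open>simp add: mat_sqrt_diag_mat\<close>)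
  have "G_mat X \<Sigma> w = diag_mat (\<chi> i. sqrt (\<Sigma> $ i $ i))
      ** (resid_mat X ** diag_mat (weight X w) ** resid_mat X) ** diag_mat (\<chi> i. sqrt (\<Sigma> $ i $ i))"
    unfolding G_mat_def root weight_def by (simp add: matrix_mul_assoc)
  moreover have "(resid_mat X ** diag_mat (weight X w) ** resid_mat X) $ i $ j
      = (\<Sum>k\<in>UNIV. resid_mat X $ i $ k * weight X w $ k * resid_mat X $ k $ j)"
    by (subst matrix_matrix_mult_def) (simp add: diag_mat_mult_right)
  ultimately show "G_mat X \<Sigma> w $ i $ j = sqrt (\<Sigma> $ i $ i) * sqrt (\<Sigma> $ j $ j)
    * (\<Sum>k\<in>UNIV. resid_mat X $ i $ k * weight X w $ k * resid_mat X $ k $ j)"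
    by (simp add: diag_mat_mult_left diag_mat_mult_right)
qed

lemma G_mat_symmetric:
  assumes "is_diagonal \<Sigma>" "\<And>i. \<Sigma> $ i $ i > 0" "invertible (transpose X ** X)"
  shows "G_mat X \<Sigma> w $ i $ j = G_mat X \<Sigma> w $ j $ i"
proof -
  note Q = resid_mat_symmetric_entry[OF assms(3)]
  show ?thesis unfolding G_mat_entry(1)[OF assms(1,2)] using Q by (simp add: mult_ac)
qed

text \<open>The weights are defined by inverting \<open>Q \<odot> Q\<close>, and the diagonal of \<open>Q (diag weight) Q\<close> is
  \<open>Q \<odot> Q\<close> applied to the weights, so the inverse cancels. In the same way the estimator is unbiased.\<close>

lemma G_mat_diagonal:
  assumes "is_diagonal \<Sigma>" "\<And>i. \<Sigma> $ i $ i > 0" "invertible (transpose X ** X)"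
    and inv: "invertible (resid_mat X \<odot>\<^sub>m resid_mat X)"
  shows "G_mat X \<Sigma> w $ i $ i = \<Sigma> $ i $ i * ((w v* ols_mat X) $ i)\<^sup>2"
proof -
  note Q = resid_mat_symmetric_entry[OF assms(3)]
  have "(\<Sum>k\<in>UNIV. resid_mat X $ i $ k * weight X w $ k * resid_mat X $ k $ i)
      = (weight X w v* (resid_mat X \<odot>\<^sub>m resid_mat X)) $ i"
    unfolding vector_matrix_mult_def by (simp add: Q[of i] mult_ac)
  also have "\<dots> = ((w v* ols_mat X) \<odot>\<^sub>v (w v* ols_mat X)) $ i"
    unfolding weight_def vector_matrix_mul_assoc matrix_inv_invertible(2)[OF inv] by simp
  finally show ?thesis unfolding G_mat_entry(1)[OF assms(1,2)]
    using assms(2)[of i] by (simp add: power2_eq_square)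
qed

lemma sandwich_quadratic_form:
  assumes "is_diagonal \<Sigma>" "\<And>i. \<Sigma> $ i $ i > 0" "invertible (transpose X ** X)"
  shows "sandwich X w (diag_mat (Sigma_hat X (X *v b + mat_sqrt \<Sigma> *v z)))
    = (\<Sum>i\<in>UNIV. \<Sum>j\<in>UNIV. G_mat X \<Sigma> w $ i $ j * z $ i * z $ j)"
proof -
  let ?Q = "resid_mat X" and ?e = "weight X w" and ?d = "\<lambda>i. sqrt (\<Sigma> $ i $ i)"
  note Q = resid_mat_symmetric_entry[OF assms(3)]
  have eps: "eps_hat X (X *v b + mat_sqrt \<Sigma> *v z) $ k = (\<Sum>i\<in>UNIV. ?Q $ k $ i * (?d i * z $ i))" for k
  proof -
    have "eps_hat X (X *v b + mat_sqrt \<Sigma> *v z) = ?Q *v (diag_mat (\<chi> i. ?d i) *v z)"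
      unfolding eps_hat_resid G_mat_entry(2)[OF assms(1,2)]
      by (simp add: matrix_vector_right_distrib resid_mat_annihilates[OF assms(3)])
    then show ?thesis by (simp add: matrix_vector_mult_def[of ?Q] diag_mat_mult_vec)
  qed
  have "sandwich X w (diag_mat (Sigma_hat X (X *v b + mat_sqrt \<Sigma> *v z)))
      = (\<Sum>k\<in>UNIV. \<Sum>i\<in>UNIV. \<Sum>j\<in>UNIV. ?d i * ?d j * (?Q $ i $ k * ?e $ k * ?Q $ k $ j) * z $ i * z $ j)"
    unfolding sandwich_Sigma_hat eps power2_eq_square
  proof (rule sum.cong[OF refl])
    fix k
    have "(\<Sum>i\<in>UNIV. ?Q $ k $ i * (?d i * z $ i)) * (\<Sum>i\<in>UNIV. ?Q $ k $ i * (?d i * z $ i))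
        = (\<Sum>i\<in>UNIV. \<Sum>j\<in>UNIV. ?Q $ k $ i * (?d i * z $ i) * (?Q $ k $ j * (?d j * z $ j)))"
      by (rule sum_product)
    then show "?e $ k * ((\<Sum>i\<in>UNIV. ?Q $ k $ i * (?d i * z $ i)) * (\<Sum>i\<in>UNIV. ?Q $ k $ i * (?d i * z $ i)))
        = (\<Sum>i\<in>UNIV. \<Sum>j\<in>UNIV. ?d i * ?d j * (?Q $ i $ k * ?e $ k * ?Q $ k $ j) * z $ i * z $ j)"
      by (simp only: sum_distrib_left Q[of _ k]) (simp add: mult_ac)
  qed
  also have "\<dots> = (\<Sum>i\<in>UNIV. \<Sum>k\<in>UNIV. \<Sum>j\<in>UNIV. ?d i * ?d j * (?Q $ i $ k * ?e $ k * ?Q $ k $ j) * z $ i * z $ j)"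
    by (rule sum.swap)
  also have "\<dots> = (\<Sum>i\<in>UNIV. \<Sum>j\<in>UNIV. \<Sum>k\<in>UNIV. ?d i * ?d j * (?Q $ i $ k * ?e $ k * ?Q $ k $ j) * z $ i * z $ j)"
    by (intro sum.cong refl sum.swap)
  also have "\<dots> = (\<Sum>i\<in>UNIV. \<Sum>j\<in>UNIV. G_mat X \<Sigma> w $ i $ j * z $ i * z $ j)"
    unfolding G_mat_entry(1)[OF assms(1,2)]
    by (intro sum.cong refl) (simp add: sum_distrib_left sum_distrib_right mult_ac)
  finally show ?thesis .
qed

lemma sandwich_trace:
  assumes "is_diagonal \<Sigma>" "\<And>i. \<Sigma> $ i $ i > 0" "invertible (transpose X ** X)"
    and inv: "invertible (resid_mat X \<odot>\<^sub>m resid_mat X)"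
  shows "sandwich X w \<Sigma> = (\<Sum>i\<in>UNIV. G_mat X \<Sigma> w $ i $ i)"
proof -
  have S: "\<Sigma> = diag_mat (\<chi> i. \<Sigma> $ i $ i)"
    using assms(1) by (auto simp: vec_eq_iff diag_mat_def is_diagonal_def)
  have "sandwich X w \<Sigma> = ((w v* ols_mat X) \<odot>\<^sub>v (w v* ols_mat X)) \<bullet> (\<chi> i. \<Sigma> $ i $ i)"
    by (subst S) (rule sandwich_diag_mat)
  then show ?thesis unfolding G_mat_diagonal[OF assms]
    by (simp add: inner_vec_def power2_eq_square mult_ac)
qed

text \<open>If the diagonal of \<open>G\<close> vanishes, so does \<open>w\<^sup>T S\<close>, and then \<open>w\<close>, because \<open>S X = 1\<close>.\<close>

lemma G_mat_nonzero:
  assumes "is_diagonal \<Sigma>" "\<And>i. \<Sigma> $ i $ i > 0" and X: "invertible (transpose X ** X)"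
    and inv: "invertible (resid_mat X \<odot>\<^sub>m resid_mat X)" and w: "norm w = 1"
  shows "0 < frob_norm (G_mat X \<Sigma> w)"
proof -
  let ?G = "G_mat X \<Sigma> w"
  obtain i where i: "(w v* ols_mat X) $ i \<noteq> 0"
  proof (rule ccontr)
    assume "\<not> thesis"
    then have "w v* ols_mat X = 0" using that by (auto simp: vec_eq_iff)
    then have "w v* (ols_mat X ** X) = 0" by (simp add: vector_matrix_mul_assoc[symmetric])
    then show False using w by (simp add: ols_left_inverse[OF X])
  qed
  have "?G $ i $ i \<noteq> 0" unfolding G_mat_diagonal[OF assms(1-4)] using i assms(2)[of i] by simp
  then have "0 < (?G $ i $ i)\<^sup>2" by simp
  also have "\<dots> \<le> (\<Sum>j\<in>UNIV. (?G $ i $ j)\<^sup>2)" by (rule member_le_sum) auto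
  also have "\<dots> \<le> (\<Sum>i\<in>UNIV. \<Sum>j\<in>UNIV. (?G $ i $ j)\<^sup>2)"
    by (rule member_le_sum[of i UNIV "\<lambda>i. \<Sum>j\<in>UNIV. (?G $ i $ j)\<^sup>2"]) (auto intro: sum_nonneg)
  finally show ?thesis unfolding frob_norm_def by simp
qed

lemma op_norm_bound: "norm (A *v y) \<le> op_norm A * norm y"
  unfolding op_norm_def by (rule onorm) simp

lemma op_norm_nonneg: "0 \<le> op_norm A"
  unfolding op_norm_def by (rule onorm_pos_le) simp

lemma op_norm_row:
  fixes A :: "real ^ 'n ^ 'n"
  assumes "\<And>i j. A $ i $ j = A $ j $ i"
  shows "(\<Sum>j\<in>UNIV. (A $ i $ j)\<^sup>2) \<le> (op_norm A)\<^sup>2"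
proof -
  have "(\<Sum>j\<in>UNIV. (A $ i $ j)\<^sup>2) = (norm (A *v axis i 1))\<^sup>2"
    unfolding matrix_vector_mult_basis power2_norm_eq_inner inner_vec_def column_def
    using assms by (simp add: power2_eq_square)
  also have "\<dots> \<le> (op_norm A * norm (axis i 1 :: real ^ 'n))\<^sup>2"
    by (intro power_mono op_norm_bound) simp
  finally show ?thesis by simp
qed

text \<open>Removing the diagonal costs a factor 2, as the diagonal part has operator norm at most that of \<open>A\<close>.\<close>

lemma op_norm_offdiagonal:
  fixes A :: "real ^ 'n ^ 'n"
  assumes sym: "\<And>i j. A $ i $ j = A $ j $ i"
  shows "(\<Sum>j\<in>UNIV. (\<Sum>i\<in>UNIV. (if i = j then 0 else A $ i $ j) * y i)\<^sup>2) \<le> 4 * (op_norm A)\<^sup>2 * (\<Sum>i\<in>UNIV. (y i)\<^sup>2)"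
proof -
  let ?y = "\<chi> i. y i"
  have off: "(\<Sum>i\<in>UNIV. (if i = j then 0 else A $ i $ j) * y i) = (A *v ?y) $ j - A $ j $ j * y j" for j
  proof -
    have "(A *v ?y) $ j = (\<Sum>i\<in>UNIV. A $ i $ j * y i)"
      unfolding matrix_vector_mult_def using sym by simp
    also have "\<dots> = (\<Sum>i\<in>UNIV. (if i = j then 0 else A $ i $ j) * y i + (if i = j then A $ j $ j * y j else 0))"
      by (intro sum.cong refl) auto
    finally show ?thesis by (simp add: sum.distrib)
  qed
  note n = norm_vec_squared
  have diag: "(A $ j $ j)\<^sup>2 \<le> (op_norm A)\<^sup>2" for j
    by (rule order_trans[OF member_le_sum op_norm_row[OF sym, of j]]) auto
  have "(\<Sum>j\<in>UNIV. ((A *v ?y) $ j - A $ j $ j * y j)\<^sup>2)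
      \<le> (\<Sum>j\<in>UNIV. 2 * ((A *v ?y) $ j)\<^sup>2 + 2 * ((op_norm A)\<^sup>2 * (y j)\<^sup>2))"
  proof (rule sum_mono)
    fix j
    have "(a - b)\<^sup>2 \<le> 2 * a\<^sup>2 + 2 * b\<^sup>2" for a b :: real
      using zero_le_power2[of "a + b"] by (simp add: power2_eq_square algebra_simps)
    then have "((A *v ?y) $ j - A $ j $ j * y j)\<^sup>2 \<le> 2 * ((A *v ?y) $ j)\<^sup>2 + 2 * (A $ j $ j * y j)\<^sup>2" .
    also have "\<dots> \<le> 2 * ((A *v ?y) $ j)\<^sup>2 + 2 * ((op_norm A)\<^sup>2 * (y j)\<^sup>2)"
      unfolding power_mult_distrib using diag[of j] by (intro add_left_mono mult_left_mono mult_right_mono) auto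
    finally show "((A *v ?y) $ j - A $ j $ j * y j)\<^sup>2 \<le> 2 * ((A *v ?y) $ j)\<^sup>2 + 2 * ((op_norm A)\<^sup>2 * (y j)\<^sup>2)" .
  qed
  also have "\<dots> = 2 * (norm (A *v ?y))\<^sup>2 + 2 * (op_norm A)\<^sup>2 * (norm ?y)\<^sup>2"
    unfolding n by (simp add: sum.distrib sum_distrib_left mult.assoc)
  also have "\<dots> \<le> 2 * (op_norm A * norm ?y)\<^sup>2 + 2 * (op_norm A)\<^sup>2 * (norm ?y)\<^sup>2"
    by (intro add_right_mono mult_left_mono power_mono op_norm_bound) auto
  also have "\<dots> = 4 * (op_norm A)\<^sup>2 * (\<Sum>i\<in>UNIV. (y i)\<^sup>2)"
    unfolding n[symmetric] using n[of ?y] by (simp add: power_mult_distrib)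
  finally show ?thesis unfolding off .
qed

text \<open>The factor \<open>(4 C4 + 2)\<^sup>1\<^sup>/\<^sup>4 / min (C4 - 1) 2\<close> is smallest at \<open>C4 = 3\<close>, where its fourth power is
  \<open>14 / 16\<close>; and \<open>(8 sqrt 5)\<^sup>4 14 / 16 = 89600\<close> exceeds \<open>299\<^sup>2 = 89401\<close>.\<close>

lemma C0_lower:
  assumes "1 < C4" "0 < c1" "0 < c2"
  shows "sqrt 299 * c1 ^ 3 \<le> C0 C4 c1 c2"
proof -
  define m where "m = min (C4 - 1) 2"
  define K where "K = (4 * C4 + 2) powr (1/4)"
  have m: "0 < m" "m \<le> 2" "m + 1 \<le> C4" using assms by (auto simp: m_def)
  have K: "0 < K" "K ^ 4 = 4 * C4 + 2" using assms
    by (auto simp: K_def powr_power)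
  define y where "y = 8 * sqrt 5 * K / m"
  have y0: "0 < y" using K m by (simp add: y_def)
  have "299 * 299 \<le> y ^ 4"
  proof -
    have "m ^ 4 \<le> 8 * m"
    proof -
      have "m ^ 3 \<le> 2 ^ 3" using m by (intro power_mono) auto
      then have "m * m ^ 3 \<le> m * 8" using m by (intro mult_left_mono) auto
      then show ?thesis by (simp add: power3_eq_cube power4_eq_xxxx mult_ac)
    qed
    then have "14 * m ^ 4 \<le> 14 * (8 * m)" by simp
    also have "\<dots> \<le> 64 * m + 96" using m by simp
    also have "\<dots> \<le> 16 * (4 * C4 + 2)" using m by simp
    finally have "14 * m ^ 4 \<le> 16 * (4 * C4 + 2)" .
    then have "14 / 16 \<le> (4 * C4 + 2) / m ^ 4" using m by (simp add: field_simps)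
    moreover have "y ^ 4 = 102400 * ((4 * C4 + 2) / m ^ 4)"
    proof -
      have "(sqrt 5) ^ 4 = (25 :: real)" by (simp add: power4_eq_xxxx mult.assoc[symmetric])
      then show ?thesis unfolding y_def power_divide power_mult_distrib K by simp
    qed
    ultimately show ?thesis by linarith
  qed
  then have "299\<^sup>2 \<le> (y\<^sup>2)\<^sup>2" by simp
  then have "299 \<le> y\<^sup>2" by (rule power2_le_imp_le) simp
  then have "sqrt 299 \<le> y" using y0 by (intro real_le_lsqrt) auto
  then have "sqrt 299 * c1 ^ 3 \<le> y * c1 ^ 3" using assms by (intro mult_right_mono) auto
  also have "\<dots> \<le> C0 C4 c1 c2"
  proof -
    have "C0 C4 c1 c2 = y * c1 * (K * c2) + y * c1 ^ 3"
      unfolding C0_def K_def[symmetric] m_def[symmetric] y_def using m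
      by (simp add: field_simps power2_eq_square power3_eq_cube)
    moreover have "0 \<le> y * c1 * (K * c2)" using y0 assms K by simp
    ultimately show ?thesis by linarith
  qed
  finally show ?thesis .
qed

theorem mainTheorem8:
  fixes M :: "'a measure"
    and X :: "real ^ 'p ^ 'n" and \<beta> :: "real ^ 'p" and \<Sigma> :: "real ^ 'n ^ 'n"
    and Y \<epsilon> Z N :: "'a \<Rightarrow> real ^ 'n"
    and \<psi> :: "'n \<Rightarrow> real \<Rightarrow> real"
    and w :: "real ^ 'p"
    and C4 c1 c2 :: real
  defines "T \<equiv> (\<lambda>\<omega>. sandwich X w (diag_mat (Sigma_hat X (Y \<omega>))))"
  assumes "prob_space M"
    and "invertible (transpose X ** X)"
    and "invertible (resid_mat X \<odot>\<^sub>m resid_mat X)"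
    and "is_diagonal \<Sigma>" and "\<And>i. \<Sigma> $ i $ i > 0"
    and "\<And>\<omega>. \<omega> \<in> space M \<Longrightarrow> Y \<omega> = X *v \<beta> + \<epsilon> \<omega>"
    and "\<And>\<omega>. \<omega> \<in> space M \<Longrightarrow> \<epsilon> \<omega> = mat_sqrt \<Sigma> *v Z \<omega>"
    and "prob_space.indep_vars M (\<lambda>_. borel) (\<lambda>i \<omega>. Z \<omega> $ i) UNIV"
    and "\<And>i. integrable M (\<lambda>\<omega>. (Z \<omega> $ i) ^ 4)"
    and "\<And>i. prob_space.expectation M (\<lambda>\<omega>. Z \<omega> $ i) = 0"
    and "\<And>i. prob_space.variance M (\<lambda>\<omega>. Z \<omega> $ i) = 1"
    and "\<And>i. prob_space.expectation M (\<lambda>\<omega>. (Z \<omega> $ i) ^ 4) \<le> C4"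
    and "distributed M lborel N (\<lambda>x. ennreal (std_normal_vec_density x))"
    and "\<And>i \<omega>. \<omega> \<in> space M \<Longrightarrow> Z \<omega> $ i = \<psi> i (N \<omega> $ i)"
    and "\<And>i. twice_differentiable (\<psi> i)"
    and "c1 > 0" and "c2 > 0"
    and "\<And>i. sup_norm (deriv (\<psi> i)) < ereal c1"
    and "\<And>i. sup_norm (deriv (deriv (\<psi> i))) < ereal c2"
    and "norm w = 1"
  shows "tv_dist
           (distr M borel (\<lambda>\<omega>. (T \<omega> - sandwich X w \<Sigma>) / sqrt (prob_space.variance M T)))
           std_normal_distribution
         \<le> C0 C4 c1 c2 * (op_norm (G_mat X \<Sigma> w) / frob_norm (G_mat X \<Sigma> w))"
proof -
  note M = \<open>prob_space M\<close> and X = \<open>invertible (transpose X ** X)\<close>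
    and QQ = \<open>invertible (resid_mat X \<odot>\<^sub>m resid_mat X)\<close>
    and \<Sigma> = \<open>is_diagonal \<Sigma>\<close> \<open>\<And>i. \<Sigma> $ i $ i > 0\<close>
    and Y = \<open>\<And>\<omega>. \<omega> \<in> space M \<Longrightarrow> Y \<omega> = X *v \<beta> + \<epsilon> \<omega>\<close>
    and \<epsilon> = \<open>\<And>\<omega>. \<omega> \<in> space M \<Longrightarrow> \<epsilon> \<omega> = mat_sqrt \<Sigma> *v Z \<omega>\<close>
    and mean = \<open>\<And>i. prob_space.expectation M (\<lambda>\<omega>. Z \<omega> $ i) = 0\<close>
    and var = \<open>\<And>i. prob_space.variance M (\<lambda>\<omega>. Z \<omega> $ i) = 1\<close>
    and fourth = \<open>\<And>i. prob_space.expectation M (\<lambda>\<omega>. (Z \<omega> $ i) ^ 4) \<le> C4\<close>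
    and N = \<open>distributed M lborel N (\<lambda>x. ennreal (std_normal_vec_density x))\<close>
    and Z = \<open>\<And>i \<omega>. \<omega> \<in> space M \<Longrightarrow> Z \<omega> $ i = \<psi> i (N \<omega> $ i)\<close>
    and smooth = \<open>\<And>i. twice_differentiable (\<psi> i)\<close> and c = \<open>c1 > 0\<close> \<open>c2 > 0\<close>
    and sup = \<open>\<And>i. sup_norm (deriv (\<psi> i)) < ereal c1\<close> and w = \<open>norm w = 1\<close>
  interpret prob_space M by (rule M)
  let ?G = "G_mat X \<Sigma> w"
  let ?N = "\<lambda>\<omega> i. N \<omega> $ i"
  note law = std_normal_vec_law[OF N]
  have transfer: "(\<integral>\<omega>. k (?N \<omega>) \<partial>M) = (\<integral>x. k x \<partial>gauss_space)"
    if "k \<in> borel_measurable (gauss_space :: ('n \<Rightarrow> real) measure)" for k :: "('n \<Rightarrow> real) \<Rightarrow> real"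
    using integral_distr[OF law(1) that] unfolding law(2) by simp
  have transfer1: "(\<integral>\<omega>. k (N \<omega> $ i) \<partial>M) = (\<integral>y. k y \<partial>\<nu>)" if k: "k \<in> borel_measurable borel" for k :: "real \<Rightarrow> real" and i
  proof -
    have "(\<integral>\<omega>. k (N \<omega> $ i) \<partial>M) = (\<integral>x. k (x i) \<partial>(gauss_space :: ('n \<Rightarrow> real) measure))"
      by (rule transfer[OF gauss_coordinate[OF k]])
    also have "\<dots> = (\<integral>y. k y \<partial>distr (gauss_space :: ('n \<Rightarrow> real) measure) \<nu> (\<lambda>x. x i))"
      by (rule integral_distr[symmetric]) (use k in auto)
    also have "distr (gauss_space :: ('n \<Rightarrow> real) measure) \<nu> (\<lambda>x. x i) = \<nu>"
      by (rule distr_PiM_component) (use nu_prob in auto)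
    finally show ?thesis .
  qed
  have deriv: "(\<psi> i has_real_derivative deriv (\<psi> i) x) (at x)" for i x
    using smooth[of i] by (simp add: twice_differentiable_def DERIV_deriv_iff_real_differentiable)
  have cont: "continuous_on UNIV (\<psi> i)" for i
    using deriv by (meson DERIV_isCont continuous_at_imp_continuous_on)
  have cont': "continuous_on UNIV (deriv (\<psi> i))" for i
    using smooth[of i] by (intro differentiable_imp_continuous_on)
      (auto simp: twice_differentiable_def differentiable_on_def intro: differentiable_at_withinI)
  have [measurable]: "\<psi> i \<in> borel_measurable borel" for i by (rule borel_measurable_continuous_onI[OF cont])
  have bound: "\<bar>deriv (\<psi> i) x\<bar> \<le> c1" for i x
  proof -
    have "ereal \<bar>deriv (\<psi> i) x\<bar> \<le> sup_norm (deriv (\<psi> i))" unfolding sup_norm_def by (rule SUP_upper) simp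
    then show ?thesis using le_less_trans[OF _ sup[of i]] by force
  qed
  have mean': "(\<integral>y. \<psi> i y \<partial>\<nu>) = 0" for i
    using mean[of i] transfer1[of "\<psi> i" i] by (simp add: Z cong: Bochner_Integration.integral_cong)
  have var': "msq (\<psi> i) = 1" for i
    using var[of i] transfer1[of "\<lambda>y. (\<psi> i y)\<^sup>2" i] unfolding mean
    by (simp add: Z cong: Bochner_Integration.integral_cong)
  have fourth': "(\<integral>y. \<psi> i y ^ 4 \<partial>\<nu>) \<le> C4" for i
    using fourth[of i] transfer1[of "\<lambda>y. \<psi> i y ^ 4" i] by (simp add: Z cong: Bochner_Integration.integral_cong)
  have lip: "lipschitz_gauss (\<psi> i) (deriv (\<psi> i)) c1" for i
    by standard (use deriv cont' bound mean' var' in auto)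
  define q where "q i = ?G $ i $ i" for i
  define B where "B i j = (if i = j then 0 else ?G $ i $ j)" for i j
  have sym: "?G $ i $ j = ?G $ j $ i" for i j by (rule G_mat_symmetric[OF \<Sigma> X])
  interpret Q: gauss_quadratic \<psi> "\<lambda>i. deriv (\<psi> i)" c1 q B
    by (rule gauss_quadratic.intro) (use lip sym in \<open>auto simp: B_def\<close>)
  have rowsum: "Q.r2 i + (q i)\<^sup>2 = (\<Sum>j\<in>UNIV. (?G $ i $ j)\<^sup>2)" for i
  proof -
    have "(\<Sum>j\<in>UNIV. (?G $ i $ j)\<^sup>2) = (\<Sum>j\<in>UNIV. (B i j)\<^sup>2 + (if i = j then (q i)\<^sup>2 else 0))"
      by (intro sum.cong refl) (auto simp: B_def q_def)
    then show ?thesis by (simp add: Q.r2_def sum.distrib)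
  qed
  interpret Q: gauss_quadratic_bounded \<psi> "\<lambda>i. deriv (\<psi> i)" c1 q B "op_norm ?G"
  proof standard
    show "0 \<le> op_norm ?G" by (rule op_norm_nonneg)
    show "Q.r2 i + (q i)\<^sup>2 \<le> (op_norm ?G)\<^sup>2" for i
      unfolding rowsum by (rule op_norm_row[OF sym])
    show "(\<Sum>j\<in>UNIV. (\<Sum>i\<in>UNIV. B i j * y i)\<^sup>2) \<le> 4 * (op_norm ?G)\<^sup>2 * (\<Sum>i\<in>UNIV. (y i)\<^sup>2)" for y
      unfolding B_def by (rule op_norm_offdiagonal[OF sym])
  qed
  have T_eq: "T \<omega> = sandwich X w \<Sigma> + Q.W (?N \<omega>)" if \<omega>: "\<omega> \<in> space M" for \<omega>
  proof -
    have "T \<omega> = (\<Sum>i\<in>UNIV. \<Sum>j\<in>UNIV. ?G $ i $ j * Z \<omega> $ i * Z \<omega> $ j)"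
      unfolding T_def Y[OF \<omega>] \<epsilon>[OF \<omega>] by (rule sandwich_quadratic_form[OF \<Sigma> X])
    also have "\<dots> = (\<Sum>i\<in>UNIV. q i * (\<psi> i (N \<omega> $ i))\<^sup>2 + Q.A i (?N \<omega>) * \<psi> i (N \<omega> $ i))"
    proof (rule sum.cong[OF refl])
      fix i
      have "(\<Sum>j\<in>UNIV. ?G $ i $ j * Z \<omega> $ i * Z \<omega> $ j)
          = (\<Sum>j\<in>UNIV. (if i = j then q i * (\<psi> i (N \<omega> $ i))\<^sup>2 else 0) + B i j * \<psi> j (N \<omega> $ j) * \<psi> i (N \<omega> $ i))"
        by (intro sum.cong refl) (auto simp: Z[OF \<omega>] q_def B_def power2_eq_square)
      then show "(\<Sum>j\<in>UNIV. ?G $ i $ j * Z \<omega> $ i * Z \<omega> $ j)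
          = q i * (\<psi> i (N \<omega> $ i))\<^sup>2 + Q.A i (?N \<omega>) * \<psi> i (N \<omega> $ i)"
        by (simp add: sum.distrib Q.A_def sum_distrib_right)
    qed
    also have "\<dots> = (\<Sum>i\<in>UNIV. q i) + Q.W (?N \<omega>)"
      unfolding Q.W_def sum.distrib[symmetric]
      by (intro sum.cong refl) (simp add: Q.L.h_def algebra_simps)
    finally show ?thesis by (simp add: sandwich_trace[OF \<Sigma> X QQ] q_def)
  qed
  have Wi: "integrable M (\<lambda>\<omega>. Q.W (?N \<omega>))"
    using sqi_integrable[OF gauss_prob Q.sqi_W] integrable_distr_eq[OF law(1) Q.W_measurable] unfolding law(2) by simp
  \<comment> \<open>The kernel has the mean \<open>sigma2\<close>, and the Stein identity for \<open>\<phi>(w) = w\<close> makes this the variance.\<close>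
  have variance: "variance T = Q.sigma2"
  proof -
    have "expectation T = (\<integral>\<omega>. sandwich X w \<Sigma> + Q.W (?N \<omega>) \<partial>M)"
      by (intro Bochner_Integration.integral_cong refl T_eq)
    also have "\<dots> = sandwich X w \<Sigma>"
      using Wi transfer[OF Q.W_measurable] Q.W_mean prob_space by simp
    finally have "variance T = (\<integral>\<omega>. (Q.W (?N \<omega>))\<^sup>2 \<partial>M)"
      by (intro Bochner_Integration.integral_cong refl) (simp add: T_eq)
    also have "\<dots> = Q.sigma2"
      using transfer[of "\<lambda>x. (Q.W x)\<^sup>2"] Q.W_measurable Q.W_variance by simp
    finally show ?thesis .
  qed
  have "distr M borel (\<lambda>\<omega>. (T \<omega> - sandwich X w \<Sigma>) / sqrt (variance T))
      = distr M borel ((\<lambda>x. Q.W x / sqrt Q.sigma2) \<circ> ?N)"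
    unfolding variance by (intro distr_cong refl) (simp add: T_eq)
  also have "\<dots> = distr (distr M gauss_space ?N) borel (\<lambda>x. Q.W x / sqrt Q.sigma2)"
    by (rule distr_distr[symmetric, OF _ law(1)]) simp
  also have "distr M gauss_space ?N = gauss_space" by (rule law(2))
  finally have distr: "distr M borel (\<lambda>\<omega>. (T \<omega> - sandwich X w \<Sigma>) / sqrt (variance T))
      = distr gauss_space borel (\<lambda>x. Q.W x / sqrt Q.sigma2)" .
  have frob: "(frob_norm ?G)\<^sup>2 = Q.RR + (\<Sum>i\<in>UNIV. (q i)\<^sup>2)"
  proof -
    have "(frob_norm ?G)\<^sup>2 = (\<Sum>i\<in>UNIV. \<Sum>j\<in>UNIV. (?G $ i $ j)\<^sup>2)"
      unfolding frob_norm_def by (intro real_sqrt_pow2 sum_nonneg) simp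
    then show ?thesis unfolding rowsum[symmetric] by (simp add: Q.RR_def sum.distrib)
  qed
  have "1 < C4"
    using fourth'[of undefined] Q.L.delta_pos[of undefined] Q.L.delta_eq[of undefined] by simp
  from C0_lower[OF this c] have C0: "sqrt 299 * c1 ^ 3 \<le> C0 C4 c1 c2" .
  have pos: "0 < frob_norm ?G" by (rule G_mat_nonzero[OF \<Sigma> X QQ w])
  show ?thesis
    unfolding distr
    by (rule order_trans[OF Q.tv_bound_ratio(2)[OF pos frob] mult_right_mono[OF C0]])
      (rule divide_nonneg_pos[OF op_norm_nonneg pos])
qed

end
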